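(* Let $G$ be a plane series-parallel 4-graph and let $T$ be an SPQ$^*$-tree of $G$. Then $G$ is rectilinear planar if and only if, for every node of $T$, the corresponding representability condition listed in the context is satisfied.
   Context: A 4-graph has maximum vertex degree at most $4$. A plane graph is a planar graph with a fixed planar embedding (including the external face), which drawings must preserve. An (embedding-preserving) orthogonal representation of a plane 4-graph assigns to every angle between consecutive edges around a vertex a value in $\{90^\circ,180^\circ,270^\circ,360^\circ\}$ ($360^\circ$ only at degree-1 vertices) and to every edge a finite ordered sequence of bends, each bend forming $90^\circ$ in one incident face and $270^\circ$ in the other, so that (1) angles at each vertex sum to $360^\circ$; (2) for each face $f$, $N_{90}(f)-N_{270}(f)-2N_{360}(f)$ is $4$ if $f$ is internal and $-4$ if $f$ is external, $N_a(f)$ being the number of $a^\circ$ angles (at vertices and bends) in $f$. A rectilinear representation is one with no bends; a plane graph is rectilinear planar if it has a rectilinear representation, i.e., it is drawable without bends. (Two-terminal) series-parallel graphs, with a source and a sink, are built from single edges by series compositions (identify the sink of each graph with the source of the next) and parallel compositions (identify all sources and all sinks). If $G$ is biconnected, the reference edge $e$ is any edge on the external face; otherwise $e$ is a dummy edge added to make $G$ biconnected, the embedding of $G$ being assumed to be such that $e$ can be added in the external face. The external face is to the right of $e=(s,t)$ when moving from $s$ to $t$. The SPQ$^*$-tree $T$ with respect to $e$ is the rooted decomposition tree whose leaves are Q$^*$-nodes (each representing a path of $\ell\ge1$ edges; $\ell$ is its length), whose S-nodes (P-nodes) represent series (parallel) compositions of the graphs of their children, and whose root $\rho$ (called the P$^r$-node,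 to distinguish it from the other P-nodes) represents the parallel composition of $e$ with the rest of the graph; $\rho$ has two children, the Q$^*$-node of $e$ and another node $\eta$. No non-root P-node has a P-node child and no S-node has an S-node child; P-nodes have two or three children, ordered left to right as in the embedding. For a node $\nu$, $G_\nu$ (the pertinent graph) is the subgraph formed by the edges in the Q$^*$-nodes of the subtree at $\nu$; its poles are its source and sink. For a pole $w$ of $\nu$, the indegree and outdegree of $w$ in $G_\nu$ are the degrees of $w$ inside and outside $G_\nu$, in the biconnected graph decomposed by $T$. Types of a P-node $\nu$ with two children $\mu_l$ (left), $\mu_r$ (right): - $\mathrm{I}_2\mathrm{O}_{\lambda\beta}$ ($1\le\lambda\le\beta\le2$): both poles have indegree two in $G_\nu$, one pole has outdegree $\lambda$ and the other $\beta$ in $G_\nu$. - $\mathrm{I}_{3d}\mathrm{O}_{\lambda\beta}$ ($d\in\{l,r\}$, $1\le\lambda\le\beta\le2$, not $\lambda=\beta=2$): one pole has indegree two in $G_\nu$, the other has indegree three in $G_\nu$ and indegree two in $G_{\mu_d}$; one pole has outdegree $\lambda$ and the other $\beta$ in $G_\nu$. - $\mathrm{I}_{3dd'}$ ($dd'\in\{ll,lr,rr\}$): both poles have indegree three in $G_\nu$; one has indegree two in $G_{\mu_d}$, the other has indegree two in $G_{\mu_{d'}}$. Let $\gamma=\lambda+\beta-2$, $\phi(r)=1$, $\phi(l)=0$. An interval $[a,b]$ of spirality values stands for all integers or all semi-integers in it. Each node $\nu$ whose condition holds has a representability interval $I_\nu$; write $I_{\mu_i}=[m_i,M_i]$ for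 the intervals of the children of $\nu$ (the condition of a node is stated assuming that the conditions of its children hold, so that these intervals are defined). Representability conditions and intervals: - Q$^*$-node of length $\ell$: condition true; $I_\nu=[-\ell+1,\ell-1]$. - S-node with children $\mu_1,\dots,\mu_h$: condition true; $I_\nu=[\sum_{i=1}^h m_i,\sum_{i=1}^h M_i]$. - P-node with three children $\mu_l,\mu_c,\mu_r$ from left to right: condition $[m_l-2,M_l-2]\cap[m_c,M_c]\cap[m_r+2,M_r+2]\neq\emptyset$; $I_\nu=[\max\{m_l-2,m_c,m_r+2\},\min\{M_l-2,M_c,M_r+2\}]$. - P-node of type $\mathrm{I}_2\mathrm{O}_{\lambda\beta}$: condition $[m_l-M_r,M_l-m_r]\cap[2,4-\gamma]\ne\emptyset$; $I_\nu=[\max\{m_l-2,m_r\}+\frac{\gamma}{2},\min\{M_l,M_r+2\}-\frac{\gamma}{2}]$. - P-node of type $\mathrm{I}_{3d}\mathrm{O}_{\lambda\beta}$: condition $[m_l-M_r,M_l-m_r]\cap[\frac52,\frac72-\gamma]\neq\emptyset$; $I_\nu=[\max\{m_l-\frac32,m_r+1\}+\frac{\gamma-\phi(d)}{2},\min\{M_l-\frac12,M_r+2\}-\frac{\gamma+\phi(d)}{2}]$. - P-node of type $\mathrm{I}_{3dd'}$: condition $3\in[m_l-M_r,M_l-m_r]$; $I_\nu=[\max\{m_l-1,m_r+2\}-\frac{\phi(d)+\phi(d')}{2},\min\{M_l-1,M_r+2\}-\frac{\phi(d)+\phi(d')}{2}]$. - Root $\rho$ (a condition to be verified only when the reference edge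 $e=(u,v)$ is not a dummy edge): $I_\eta\cap\Delta_\rho\ne\emptyset$, where $\Delta_\rho=[2,6]$, $[3,5]$ or $\{4\}$ according to whether two, exactly one, or none of the poles $u,v$ of $G_\eta$ have indegree one in $G_\eta$.
   Formalization: For a dummy e, G plus e must be a 4-graph, and if G is rectilinear planar it is assumed to have a rectilinear representation with angles of at least 180° where e is inserted; otherwise "only if" fails. Q*-nodes are maximal chains. *)

theory Defs
  imports Complex_Main "Graph_Theory.Graph_Theory" "HOL-Combinatorics.Orbits"
begin

text \<open>
  A plane graph is given by a rotation system of genus 0 together with its external face.
  Every undirected edge is a pair of opposite arcs \<open>a\<close>, \<open>opp M a\<close>; parallel edges are
  allowed. \<open>rot M a\<close> is the arc that follows \<open>a\<close> counterclockwise around the tail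
  of \<open>a\<close>. Consequently the successor \<open>rot M (opp M a)\<close> of \<open>a\<close> walks along the face that
  lies to the right of \<open>a\<close>, and a face is identified with the set of arcs that have it on
  their right.
\<close>

record ('v, 'a) plane_map =
  dgraph :: "('v, 'a) pre_digraph"
  opp :: "'a \<Rightarrow> 'a"
  rot :: "'a \<Rightarrow> 'a"
  outer :: "'a set"

abbreviation vertices :: "('v, 'a) plane_map \<Rightarrow> 'v set" where
  "vertices M \<equiv> verts (dgraph M)"

abbreviation darts :: "('v, 'a) plane_map \<Rightarrow> 'a set" where
  "darts M \<equiv> arcs (dgraph M)"

abbreviation src :: "('v, 'a) plane_map \<Rightarrow> 'a \<Rightarrow> 'v" where
  "src M \<equiv> tail (dgraph M)"

abbreviation tgt :: "('v, 'a) plane_map \<Rightarrow> 'a \<Rightarrow> 'v" where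
  "tgt M \<equiv> head (dgraph M)"

abbreviation out :: "('v, 'a) plane_map \<Rightarrow> 'v \<Rightarrow> 'a set" where
  "out M v \<equiv> out_arcs (dgraph M) v"

definition face_of :: "('v, 'a) plane_map \<Rightarrow> 'a \<Rightarrow> 'a set" where
  "face_of M a = orbit (\<lambda>b. rot M (opp M b)) a"

definition faces :: "('v, 'a) plane_map \<Rightarrow> 'a set set" where
  "faces M = face_of M ` darts M"

text \<open>The fifth conjunct is Euler's formula; the number of edges is half the number of arcs.\<close>

definition plane_graph :: "('v, 'a) plane_map \<Rightarrow> bool" where
  "plane_graph M \<longleftrightarrow>
     fin_digraph (dgraph M) \<and>
     bidirected_digraph (dgraph M) (opp M) \<and>
     connected (dgraph M) \<and>
     (\<forall>v\<in>vertices M. out M v \<noteq> {} \<longrightarrow> cyclic_on (rot M) (out M v)) \<and>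
     card (vertices M) + card (faces M) = card (darts M) div 2 + 2 \<and>
     outer M \<in> faces M"

definition four_graph :: "('v, 'a) plane_map \<Rightarrow> bool" where
  "four_graph M \<longleftrightarrow> (\<forall>v\<in>vertices M. out_degree (dgraph M) v \<le> 4)"

text \<open>A single edge does not count as biconnected.\<close>

definition biconnected :: "('v, 'a) plane_map \<Rightarrow> bool" where
  "biconnected M \<longleftrightarrow>
     connected (dgraph M) \<and> card (darts M) > 2 \<and>
     (\<forall>v\<in>vertices M. connected (pre_digraph.del_vert (dgraph M) v))"

text \<open>
  \<open>ang a\<close> is the angle, at the head of \<open>a\<close> and inside the face to the right of \<open>a\<close>, between
  \<open>a\<close> and its successor on that face. \<open>bnd a\<close> lists the angles that the bends of \<open>a\<close> form in
  the face to the right of \<open>a\<close>, in the order in which they are met along \<open>a\<close>.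
\<close>

definition num_angles ::
    "('a \<Rightarrow> nat) \<Rightarrow> ('a \<Rightarrow> nat list) \<Rightarrow> 'a set \<Rightarrow> nat \<Rightarrow> int" where
  "num_angles ang bnd f x =
     int (card {a \<in> f. ang a = x}) + (\<Sum>a\<in>f. int (count_list (bnd a) x))"

definition orthogonal_rep ::
    "('v, 'a) plane_map \<Rightarrow> ('a \<Rightarrow> nat) \<Rightarrow> ('a \<Rightarrow> nat list) \<Rightarrow> bool" where
  "orthogonal_rep M ang bnd \<longleftrightarrow>
     (\<forall>a\<in>darts M. ang a \<in> {90, 180, 270, 360} \<and>
        (ang a = 360 \<longrightarrow> out_degree (dgraph M) (tgt M a) = 1)) \<and>
     (\<forall>a\<in>darts M. set (bnd a) \<subseteq> {90, 270} \<and>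
        bnd (opp M a) = rev (map (\<lambda>x. 360 - x) (bnd a))) \<and>
     (\<forall>v\<in>vertices M. (\<Sum>a\<in>in_arcs (dgraph M) v. ang a) = 360) \<and>
     (\<forall>f\<in>faces M.
        num_angles ang bnd f 90 - num_angles ang bnd f 270 - 2 * num_angles ang bnd f 360 =
        (if f = outer M then - 4 else 4))"

definition rectilinear_rep :: "('v, 'a) plane_map \<Rightarrow> ('a \<Rightarrow> nat) \<Rightarrow> bool" where
  "rectilinear_rep M ang \<longleftrightarrow> orthogonal_rep M ang (\<lambda>_. [])"

definition rectilinear_planar :: "('v, 'a) plane_map \<Rightarrow> bool" where
  "rectilinear_planar M \<longleftrightarrow> (\<exists>ang. rectilinear_rep M ang)"

definition ends :: "('v, 'a) plane_map \<Rightarrow> 'a set \<Rightarrow> 'v set" where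
  "ends M A = src M ` A \<union> tgt M ` A"

text \<open>\<open>two_terminal M s t A\<close>: the edges in \<open>A\<close> form a series-parallel graph with
  source \<open>s\<close> and sink \<open>t\<close>.\<close>

inductive two_terminal :: "('v, 'a) plane_map \<Rightarrow> 'v \<Rightarrow> 'v \<Rightarrow> 'a set \<Rightarrow> bool" for M where
  edge: "a \<in> darts M \<Longrightarrow> src M a \<noteq> tgt M a \<Longrightarrow>
    two_terminal M (src M a) (tgt M a) {a, opp M a}"
| series: "two_terminal M s v A \<Longrightarrow> two_terminal M v t B \<Longrightarrow>
    ends M A \<inter> ends M B = {v} \<Longrightarrow> two_terminal M s t (A \<union> B)"
| parallel: "two_terminal M s t A \<Longrightarrow> two_terminal M s t B \<Longrightarrow> A \<inter> B = {} \<Longrightarrow>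
    ends M A \<inter> ends M B = {s, t} \<Longrightarrow> two_terminal M s t (A \<union> B)"

definition series_parallel :: "('v, 'a) plane_map \<Rightarrow> bool" where
  "series_parallel M \<longleftrightarrow> (\<exists>s t. two_terminal M s t (darts M))"

text \<open>A Q*-node stores its path as a list of arcs directed from source to sink, and the
  children of S- and P-nodes are listed from source to sink and from left to right.\<close>

datatype 'a spq =
    is_QNode: QNode "'a list"
  | is_SNode: SNode "'a spq list"
  | is_PNode: PNode "'a spq list"
  | Root "'a spq" "'a spq"

primrec nodes :: "'a spq \<Rightarrow> 'a spq set" where
  "nodes (QNode p) = {QNode p}"
| "nodes (SNode ts) = insert (SNode ts) (\<Union>(set (map nodes ts)))"
| "nodes (PNode ts) = insert (PNode ts) (\<Union>(set (map nodes ts)))"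
| "nodes (Root q t) = insert (Root q t) (nodes q \<union> nodes t)"

primrec pert :: "('v, 'a) plane_map \<Rightarrow> 'a spq \<Rightarrow> 'a set" where
  "pert M (QNode p) = set p \<union> opp M ` set p"
| "pert M (SNode ts) = \<Union>(set (map (pert M) ts))"
| "pert M (PNode ts) = \<Union>(set (map (pert M) ts))"
| "pert M (Root q t) = pert M q \<union> pert M t"

primrec source :: "('v, 'a) plane_map \<Rightarrow> 'a spq \<Rightarrow> 'v" where
  "source M (QNode p) = src M (hd p)"
| "source M (SNode ts) = hd (map (source M) ts)"
| "source M (PNode ts) = hd (map (source M) ts)"
| "source M (Root q t) = source M q"

primrec sink :: "('v, 'a) plane_map \<Rightarrow> 'a spq \<Rightarrow> 'v" where
  "sink M (QNode p) = tgt M (last p)"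
| "sink M (SNode ts) = last (map (sink M) ts)"
| "sink M (PNode ts) = hd (map (sink M) ts)"
| "sink M (Root q t) = sink M q"

definition ccw_order :: "('v, 'a) plane_map \<Rightarrow> 'v \<Rightarrow> 'a list \<Rightarrow> bool" where
  "ccw_order M v xs \<longleftrightarrow> distinct xs \<and> set xs = out M v \<and>
     (\<forall>i<length xs. rot M (xs ! i) = xs ! (Suc i mod length xs))"

text \<open>
  Facing from \<open>s\<close> to \<open>t\<close>, a counterclockwise turn around \<open>s\<close> that starts with the arcs
  outside the parallel composition (\<open>os\<close>) meets the components from right to left; around
  \<open>t\<close> it meets them from left to right.
\<close>

definition left_to_right ::
    "('v, 'a) plane_map \<Rightarrow> 'v \<Rightarrow> 'v \<Rightarrow> 'a spq list \<Rightarrow> bool" where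
  "left_to_right M s t ts \<longleftrightarrow>
     (\<exists>os bs. os \<noteq> [] \<and> ccw_order M s (os @ concat (rev bs)) \<and>
        list_all2 (\<lambda>b \<mu>. set b = out M s \<inter> pert M \<mu>) bs ts) \<and>
     (\<exists>os bs. os \<noteq> [] \<and> ccw_order M t (os @ concat bs) \<and>
        list_all2 (\<lambda>b \<mu>. set b = out M t \<inter> pert M \<mu>) bs ts)"

text \<open>
  Consecutive Q*-children of an S-node are excluded because the path of a Q*-node is a maximal
  chain: a series composition of two paths is again a path, hence a single Q*-node.
\<close>

fun spq_node :: "('v, 'a) plane_map \<Rightarrow> 'a spq \<Rightarrow> bool" where
  "spq_node M (QNode p) \<longleftrightarrow>
     p \<noteq> [] \<and> pre_digraph.apath (dgraph M) (src M (hd p)) p (tgt M (last p))"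
| "spq_node M (SNode ts) \<longleftrightarrow>
     2 \<le> length ts \<and>
     (\<forall>\<mu>\<in>set ts. spq_node M \<mu> \<and> \<not> is_SNode \<mu>) \<and>
     (\<forall>i. Suc i < length ts \<longrightarrow>
        \<not> (is_QNode (ts ! i) \<and> is_QNode (ts ! Suc i)) \<and>
        sink M (ts ! i) = source M (ts ! Suc i)) \<and>
     (\<forall>i j. i < j \<and> j < length ts \<longrightarrow>
        ends M (pert M (ts ! i)) \<inter> ends M (pert M (ts ! j)) =
          (if j = Suc i then {sink M (ts ! i)} else {}))"
| "spq_node M (PNode ts) \<longleftrightarrow>
     length ts \<in> {2, 3} \<and>
     (\<forall>\<mu>\<in>set ts. spq_node M \<mu> \<and> \<not> is_PNode \<mu> \<and>
        source M \<mu> = source M (PNode ts) \<and> sink M \<mu> = sink M (PNode ts)) \<and>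
     (\<forall>i j. i < j \<and> j < length ts \<longrightarrow>
        pert M (ts ! i) \<inter> pert M (ts ! j) = {} \<and>
        ends M (pert M (ts ! i)) \<inter> ends M (pert M (ts ! j)) =
          {source M (PNode ts), sink M (PNode ts)}) \<and>
     left_to_right M (source M (PNode ts)) (sink M (PNode ts)) ts"
| "spq_node M (Root q t) \<longleftrightarrow> False"

text \<open>\<open>e \<in> outer M\<close> says that the external face lies to the right of \<open>e\<close>.\<close>

definition spq_tree :: "('v, 'a) plane_map \<Rightarrow> 'a \<Rightarrow> 'a spq \<Rightarrow> bool" where
  "spq_tree M e T \<longleftrightarrow>
     (\<exists>\<eta>. T = Root (QNode [e]) \<eta> \<and>
        e \<in> darts M \<and> e \<in> outer M \<and> spq_node M \<eta> \<and>
        source M \<eta> = src M e \<and> sink M \<eta> = tgt M e \<and>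
        {e, opp M e} \<inter> pert M \<eta> = {} \<and> {e, opp M e} \<union> pert M \<eta> = darts M)"

text \<open>
  \<open>B\<close> arises from \<open>G\<close> by drawing the edge \<open>e\<close> in the external face: the rotation of
  \<open>G\<close> is that of \<open>B\<close> with the two arcs of \<open>e\<close> skipped, and the external face of \<open>G\<close> is
  the union of the two faces of \<open>B\<close> at \<open>e\<close>.
\<close>

definition adds_dummy_edge ::
    "('v, 'a) plane_map \<Rightarrow> 'a \<Rightarrow> ('v, 'a) plane_map \<Rightarrow> bool" where
  "adds_dummy_edge G e B \<longleftrightarrow>
     plane_graph B \<and> four_graph B \<and> biconnected B \<and>
     vertices B = vertices G \<and>
     e \<in> darts B \<and> darts G = darts B - {e, opp B e} \<and>
     (\<forall>a\<in>darts G. src G a = src B a \<and> tgt G a = tgt B a \<and> opp G a = opp B a \<and>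
        rot G a = (if rot B a \<in> {e, opp B e} then rot B (rot B a) else rot B a)) \<and>
     outer G = (face_of B e \<union> face_of B (opp B e)) - {e, opp B e}"

definition decomposed_graph ::
    "('v, 'a) plane_map \<Rightarrow> 'a \<Rightarrow> ('v, 'a) plane_map \<Rightarrow> bool" where
  "decomposed_graph G e B \<longleftrightarrow> (if biconnected G then B = G else adds_dummy_edge G e B)"

text \<open>
  The angles of \<open>G\<close> that are split when \<open>e\<close> is inserted, that is, the angles at the end
  vertices of \<open>e\<close> where \<open>e\<close> leaves into the external face, must have at least 180 degrees
  for \<open>e\<close> to fit into an orthogonal drawing.
\<close>

definition leaves_room_for ::
    "('v, 'a) plane_map \<Rightarrow> ('v, 'a) plane_map \<Rightarrow> 'a \<Rightarrow> ('a \<Rightarrow> nat) \<Rightarrow> bool" where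
  "leaves_room_for G B e ang \<longleftrightarrow>
     (\<forall>a\<in>darts G. rot B (opp B a) \<in> {e, opp B e} \<longrightarrow> 180 \<le> ang a)"

definition indeg :: "('v, 'a) plane_map \<Rightarrow> 'a spq \<Rightarrow> 'v \<Rightarrow> nat" where
  "indeg M \<nu> w = card (out M w \<inter> pert M \<nu>)"

definition outdeg :: "('v, 'a) plane_map \<Rightarrow> 'a spq \<Rightarrow> 'v \<Rightarrow> nat" where
  "outdeg M \<nu> w = card (out M w - pert M \<nu>)"

datatype side = Left | Right

datatype ptype =
    I2O nat nat
  | I3O side nat nat
  | I3 side side

fun has_ptype ::
    "('v, 'a) plane_map \<Rightarrow> 'a spq \<Rightarrow> 'a spq \<Rightarrow> ptype \<Rightarrow> bool" where
  "has_ptype M \<mu>l \<mu>r (I2O lam bet) \<longleftrightarrow>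
     (let \<nu> = PNode [\<mu>l, \<mu>r]; s = source M \<nu>; t = sink M \<nu> in
        1 \<le> lam \<and> lam \<le> bet \<and> bet \<le> 2 \<and>
        indeg M \<nu> s = 2 \<and> indeg M \<nu> t = 2 \<and>
        (\<exists>(w, w')\<in>{(s, t), (t, s)}. outdeg M \<nu> w = lam \<and> outdeg M \<nu> w' = bet))"
| "has_ptype M \<mu>l \<mu>r (I3O d lam bet) \<longleftrightarrow>
     (let \<nu> = PNode [\<mu>l, \<mu>r]; s = source M \<nu>; t = sink M \<nu>;
          \<mu> = (\<lambda>d. if d = Left then \<mu>l else \<mu>r) in
        1 \<le> lam \<and> lam \<le> bet \<and> bet \<le> 2 \<and> \<not> (lam = 2 \<and> bet = 2) \<and>
        (\<exists>(w, w')\<in>{(s, t), (t, s)}.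
           indeg M \<nu> w = 2 \<and> indeg M \<nu> w' = 3 \<and> indeg M (\<mu> d) w' = 2) \<and>
        (\<exists>(w, w')\<in>{(s, t), (t, s)}. outdeg M \<nu> w = lam \<and> outdeg M \<nu> w' = bet))"
| "has_ptype M \<mu>l \<mu>r (I3 d d') \<longleftrightarrow>
     (let \<nu> = PNode [\<mu>l, \<mu>r]; s = source M \<nu>; t = sink M \<nu>;
          \<mu> = (\<lambda>d. if d = Left then \<mu>l else \<mu>r) in
        (d, d') \<in> {(Left, Left), (Left, Right), (Right, Right)} \<and>
        indeg M \<nu> s = 3 \<and> indeg M \<nu> t = 3 \<and>
        (\<exists>(w, w')\<in>{(s, t), (t, s)}. indeg M (\<mu> d) w = 2 \<and> indeg M (\<mu> d') w' = 2))"

definition ptype_of :: "('v, 'a) plane_map \<Rightarrow> 'a spq \<Rightarrow> 'a spq \<Rightarrow> ptype" where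
  "ptype_of M \<mu>l \<mu>r = (THE \<tau>. has_ptype M \<mu>l \<mu>r \<tau>)"

text \<open>The end points of intervals are multiples of 1/2; an interval consists of the integers
  or of the semi-integers between its end points, according to what its end points are.\<close>

definition spiralities :: "real \<times> real \<Rightarrow> real set" where
  "spiralities I = {x. fst I \<le> x \<and> x \<le> snd I \<and> x - fst I \<in> \<int>}"

definition gam :: "nat \<Rightarrow> nat \<Rightarrow> real" where
  "gam lam bet = real lam + real bet - 2"

definition phi :: "side \<Rightarrow> real" where
  "phi d = (if d = Right then 1 else 0)"

fun rep_interval :: "('v, 'a) plane_map \<Rightarrow> 'a spq \<Rightarrow> real \<times> real" where
  "rep_interval M (QNode p) = (- real (length p) + 1, real (length p) - 1)"
| "rep_interval M (SNode ts) =
     (\<Sum>\<mu>\<leftarrow>ts. fst (rep_interval M \<mu>), \<Sum>\<mu>\<leftarrow>ts. snd (rep_interval M \<mu>))"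
| "rep_interval M (PNode [\<mu>l, \<mu>c, \<mu>r]) =
     (let (ml, Ml) = rep_interval M \<mu>l; (mc, Mc) = rep_interval M \<mu>c;
          (mr, Mr) = rep_interval M \<mu>r
      in (Max {ml - 2, mc, mr + 2}, Min {Ml - 2, Mc, Mr + 2}))"
| "rep_interval M (PNode [\<mu>l, \<mu>r]) =
     (let (ml, Ml) = rep_interval M \<mu>l; (mr, Mr) = rep_interval M \<mu>r
      in case ptype_of M \<mu>l \<mu>r of
        I2O lam bet \<Rightarrow>
          (max (ml - 2) mr + gam lam bet / 2,
           min Ml (Mr + 2) - gam lam bet / 2)
      | I3O d lam bet \<Rightarrow>
          (max (ml - 3/2) (mr + 1) + (gam lam bet - phi d) / 2,
           min (Ml - 1/2) (Mr + 2) - (gam lam bet + phi d) / 2)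
      | I3 d d' \<Rightarrow>
          (max (ml - 1) (mr + 2) - (phi d + phi d') / 2,
           min (Ml - 1) (Mr + 2) - (phi d + phi d') / 2))"

definition root_spiralities :: "('v, 'a) plane_map \<Rightarrow> 'a spq \<Rightarrow> real set" where
  "root_spiralities M \<eta> =
     (let k = card {w \<in> {source M \<eta>, sink M \<eta>}. indeg M \<eta> w = 1} in
      if k = 2 then spiralities (2, 6)
      else if k = 1 then spiralities (3, 5)
      else {4})"

fun rep_condition :: "('v, 'a) plane_map \<Rightarrow> bool \<Rightarrow> 'a spq \<Rightarrow> bool" where
  "rep_condition M dummy (QNode p) \<longleftrightarrow> True"
| "rep_condition M dummy (SNode ts) \<longleftrightarrow> True"
| "rep_condition M dummy (PNode [\<mu>l, \<mu>c, \<mu>r]) \<longleftrightarrow>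
     (let (ml, Ml) = rep_interval M \<mu>l; (mc, Mc) = rep_interval M \<mu>c;
          (mr, Mr) = rep_interval M \<mu>r
      in spiralities (ml - 2, Ml - 2) \<inter> spiralities (mc, Mc) \<inter>
         spiralities (mr + 2, Mr + 2) \<noteq> {})"
| "rep_condition M dummy (PNode [\<mu>l, \<mu>r]) \<longleftrightarrow>
     (let (ml, Ml) = rep_interval M \<mu>l; (mr, Mr) = rep_interval M \<mu>r;
          D = spiralities (ml - Mr, Ml - mr)
      in case ptype_of M \<mu>l \<mu>r of
        I2O lam bet \<Rightarrow> D \<inter> spiralities (2, 4 - gam lam bet) \<noteq> {}
      | I3O d lam bet \<Rightarrow> D \<inter> spiralities (5/2, 7/2 - gam lam bet) \<noteq> {}
      | I3 d d' \<Rightarrow> 3 \<in> D)"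
| "rep_condition M dummy (Root q \<eta>) \<longleftrightarrow>
     (\<not> dummy \<longrightarrow> spiralities (rep_interval M \<eta>) \<inter> root_spiralities M \<eta> \<noteq> {})"

end

theory Submission
  imports Defs
begin

text \<open>
  An angle of \<open>\<alpha>\<close> degrees is encoded by its turn \<open>2 - \<alpha> / 90\<close> and attached to the arc that precedes
  it in the rotation around its vertex. Every decomposition node is turned into a piece: the fans
  of arcs at its two poles, its left and right boundary walks, and the list of its inner faces.
  A representation of a piece fixes the angles at all vertices it owns, i.e. all except poles of
  indegree one; since no vertex of degree four leaves any freedom, representations of subpieces can
  be glued. Walking along the right boundary gives an integer turn; the turn along the left boundary
  differs only by sign and by the number of poles of indegree and outdegree two, so the spirality is
  the turn minus half that number. Series composition adds turns. In a parallel composition the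
  face between the two components prescribes the difference of their turns up to the angles at the
  poles, and a case distinction over the poles yields the intervals. Hence the turns realizable by
  a node are precisely those of its interval when all conditions below it hold, and there are none
  otherwise. The two faces at the reference edge give the root condition.
\<close>

section \<open>Cyclic lists and rotation systems\<close>

text \<open>Turns around a vertex of degree d add up to 2d - 4 and are at most 1 each, so at degree
  four all are 1. Two pieces that own a common vertex therefore never disagree there. A pole of
  indegree one is not owned because every angle at it involves an arc from outside the piece.

  The half-integers have one origin. The outline of a piece turns by -4 in total; a pole with one
  outside arc accounts for 2 of it, a pole of indegree and outdegree two for 3. Each pole of the
  second kind leaves an excess of 1 in right plus left turn, and halving the excess centres the
  spirality.

  The types of two-child P-nodes collapse to three numbers: q and c count the poles where the left
  or right child has indegree two, g the other poles of outdegree two. Every condition then concerns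
  the interval from 2 + (q+c)/2 to 4 - (q+c)/2 - g, and what remains is linear arithmetic.

  Removing a dummy edge merges turns x, y at each end into x + y - 2. The two faces at the edge have
  opposite sums, so the merged external face gets -4 whatever the spirality is; this is why no root
  condition appears.\<close>

lemma successively_predecessor:
  assumes "successively (\<lambda>x y. g x = y) xs" "y \<in> set xs" "y \<noteq> hd xs"
  shows "\<exists>x\<in>set (butlast xs). g x = y"
  using assms
proof (induction xs rule: induct_list012)
  case (3 a b xs)
  then show ?case by (cases "y = b") (auto split: if_splits)
qed auto

lemma successively_successor:
  assumes "successively (\<lambda>x y. g x = y) xs" "x \<in> set (butlast xs)"
  shows "g x \<in> set (tl xs)"
  using assms
proof (induction xs rule: induct_list012)
  case (3 a b xs)
  then show ?case by (cases "x = a") (auto split: if_splits)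
qed auto

lemma set_butlast_last: "xs \<noteq> [] \<Longrightarrow> set xs = insert (last xs) (set (butlast xs))"
  by (cases xs rule: rev_cases) auto

lemma hd_notin_tl: "distinct xs \<Longrightarrow> xs \<noteq> [] \<Longrightarrow> hd xs \<notin> set (tl xs)"
  by (cases xs) auto

lemma successively_determined:
  assumes "successively (\<lambda>x y. g x = y) xs" "successively (\<lambda>x y. g x = y) ys"
    and "xs \<noteq> []" "ys \<noteq> []" "hd xs = hd ys" "length xs = length ys"
  shows "xs = ys"
  using assms
proof (induction xs arbitrary: ys)
  case (Cons a xs)
  then obtain ys' where ys: "ys = a # ys'" by (cases ys) auto
  show ?case
  proof (cases "xs = []")
    case True then show ?thesis using Cons.prems ys by auto
  next
    case False
    then have "ys' \<noteq> []" using Cons.prems ys by auto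
    then show ?thesis using Cons False ys by (auto simp: successively_Cons)
  qed
qed auto

lemma orbit_of_cycle:
  assumes ch: "successively (\<lambda>x y. g x = y) f" and ne: "f \<noteq> []" and
    cl: "g (last f) = hd f" and a: "a \<in> set f"
  shows "orbit g a = set f"
proof
  have step: "g x \<in> set f" if "x \<in> set f" for x
    using that ne cl successively_successor[OF ch, of x] set_butlast_last[OF ne]
    by (auto dest: list.set_sel(2)) 
  show "orbit g a \<subseteq> set f"
  proof
    fix x assume "x \<in> orbit g a" then show "x \<in> set f"
      by induction (use a step in auto)
  qed
  have pre: "set f \<subseteq> orbit g (hd f)" if "hd f \<in> orbit g (hd f)"
  proof -
    have "f ! i \<in> orbit g (hd f)" if i: "i < length f" for i
      using i
    proof (induction i)
      case 0 then show ?case using \<open>hd f \<in> orbit g (hd f)\<close> ne by (simp add: hd_conv_nth)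
    next
      case (Suc i)
      then have "g (f ! i) = f ! Suc i" using ch by (simp add: successively_conv_nth)
      then show ?case using Suc orbit.step[of "f ! i" g "hd f"] by simp
    qed
    then show ?thesis by (auto simp: in_set_conv_nth)
  qed
  \<comment> \<open>\<open>orbit\<close> begins with the first image, so a point lies in its own
    orbit only after the cycle has closed; hence the extra alternative.\<close>
  have reach: "last f \<in> orbit g x \<or> x = last f" if "x \<in> set f" for x
  proof -
    obtain i where i: "i < length f" "x = f ! i" using \<open>x \<in> set f\<close> by (auto simp: in_set_conv_nth)
    have "f ! j \<in> orbit g (f ! i) \<or> j = i" if "i \<le> j" "j < length f" for j
      using that
    proof (induction j)
      case (Suc j)
      show ?case
      proof (cases "Suc j = i")
        case False
        then have "i \<le> j" "j < length f" using Suc by auto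
        moreover have "g (f ! j) = f ! Suc j" using ch Suc by (simp add: successively_conv_nth)
        ultimately show ?thesis using Suc.IH orbit.base[of g "f ! i"] orbit.step[of "f ! j" g "f ! i"]
          by auto
      qed simp
    qed simp
    moreover have "i \<le> length f - 1" "length f - 1 < length f" "last f = f ! (length f - 1)"
      using i ne by (auto simp: last_conv_nth)
    ultimately show ?thesis using i by metis
  qed
  have toh: "hd f \<in> orbit g x" if "x \<in> set f" for x
    using reach[OF that] cl orbit.base[of g x] orbit.step[of "last f" g x] by metis
  have "hd f \<in> orbit g (hd f)" using toh ne by auto
  from pre[OF this] toh[OF a] show "set f \<subseteq> orbit g a" by (meson orbit_trans subset_iff)
qed

text \<open>Used for the graph that the tree decomposes and, when the reference edge is a dummy, a
  second time for the original graph.\<close>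

locale rotation_system =
  fixes M :: "('v, 'a) plane_map"
  assumes finite_map: "fin_digraph (dgraph M)"
    and bidirected: "bidirected_digraph (dgraph M) (opp M)"
    and rot_cyclic: "\<And>v. v \<in> vertices M \<Longrightarrow> out M v \<noteq> {} \<Longrightarrow> cyclic_on (rot M) (out M v)"
    and degree_le_4: "\<And>v. v \<in> vertices M \<Longrightarrow> card (out M v) \<le> 4"
begin

lemma opp_opp [simp]: "opp M (opp M a) = a"
  using bidirected by (rule bidirected_digraph.arev_arev)

lemma opp_eq_iff [simp]: "opp M a = opp M b \<longleftrightarrow> a = b"
  by (metis opp_opp)

lemma opp_darts [simp]: "opp M a \<in> darts M \<longleftrightarrow> a \<in> darts M"
  by (metis bidirected bidirected_digraph.arev_in_arcs opp_opp)

lemma opp_neq: "a \<in> darts M \<Longrightarrow> opp M a \<noteq> a"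
  using bidirected by (simp add: bidirected_digraph.arev_neq)

lemma src_opp [simp]: "a \<in> darts M \<Longrightarrow> src M (opp M a) = tgt M a"
  using bidirected by (simp add: bidirected_digraph.tail_arev)

lemma tgt_opp [simp]: "a \<in> darts M \<Longrightarrow> tgt M (opp M a) = src M a"
  using bidirected by (simp add: bidirected_digraph.head_arev)

lemma wf: "wf_digraph (dgraph M)"
  using finite_map by (simp add: fin_digraph_def)

lemma src_vertex [simp]: "a \<in> darts M \<Longrightarrow> src M a \<in> vertices M"
  using wf by (simp add: wf_digraph.tail_in_verts)

lemma tgt_vertex [simp]: "a \<in> darts M \<Longrightarrow> tgt M a \<in> vertices M"
  using wf by (simp add: wf_digraph.head_in_verts)

lemma finite_darts: "finite (darts M)"
  using finite_map by (simp add: fin_digraph.finite_arcs)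

lemma finite_out [simp]: "finite (out M v)"
  using finite_map by (simp add: fin_digraph.finite_out_arcs)

lemma in_out_iff: "a \<in> out M v \<longleftrightarrow> a \<in> darts M \<and> src M a = v"
  by (auto simp: out_arcs_def)

lemma rot_out: "a \<in> out M v \<Longrightarrow> rot M a \<in> out M v"
  using rot_cyclic[of v] cyclic_on_inI[of "rot M" "out M v" a] in_out_iff[of a v] src_vertex[of a] by blast

lemma rot_darts [simp]: "a \<in> darts M \<Longrightarrow> rot M a \<in> darts M"
  using rot_out in_out_iff by blast

lemma src_rot [simp]: "a \<in> darts M \<Longrightarrow> src M (rot M a) = src M a"
  using rot_out in_out_iff by blast

text \<open>Arcs with the same image have the same tail, and around one vertex \<open>rot\<close> is
  onto a finite set, hence injective.\<close>

lemma rot_inj: "inj_on (rot M) (darts M)"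
proof (rule inj_onI)
  fix a b assume a: "a \<in> darts M" and b: "b \<in> darts M" and eq: "rot M a = rot M b"
  define v where "v = src M a"
  have ab: "a \<in> out M v" "b \<in> out M v" using a b eq src_rot v_def in_out_iff by metis+
  have c: "cyclic_on (rot M) (out M v)"
    using rot_cyclic[of v] ab a v_def by (metis empty_iff src_vertex)
  have "rot M ` out M v = out M v"
  proof
    show "rot M ` out M v \<subseteq> out M v" using rot_out by blast
    show "out M v \<subseteq> rot M ` out M v"
    proof
      fix x assume x: "x \<in> out M v"
      then have "x \<in> orbit (rot M) x" using c by (auto simp: cyclic_on_alldef)
      then show "x \<in> rot M ` out M v"
      proof cases
        case base then show ?thesis using x by blast
      next
        case (step y)
        have "y \<in> out M v" using step x c by (auto simp: cyclic_on_alldef)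
        then show ?thesis using step by blast
      qed
    qed
  qed
  then have "inj_on (rot M) (out M v)" by (simp add: eq_card_imp_inj_on)
  then show "a = b" using ab eq by (auto dest: inj_onD)
qed

text \<open>The clockwise neighbour. The angle between \<open>x\<close> and \<open>rot M x\<close>
  is stored at \<open>x\<close>, so the angle on the clockwise side of \<open>x\<close> is found at
  \<open>pred x\<close>.\<close>

definition pred :: "'a \<Rightarrow> 'a" where
  "pred x = inv_into (darts M) (rot M) x"

lemma pred_rot [simp]: "a \<in> darts M \<Longrightarrow> pred (rot M a) = a"
  unfolding pred_def using rot_inj by simp

lemma rot_eqD: "rot M a = rot M b \<Longrightarrow> a \<in> darts M \<Longrightarrow> b \<in> darts M \<Longrightarrow> a = b"
  using rot_inj by (auto dest: inj_onD)

text \<open>A single cycle has no proper nonempty invariant subset. This turns knowledge about which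
  arcs a component has at a pole into knowledge about their order.\<close>

lemma rot_closed_eq_out:
  assumes "S \<subseteq> out M v" "S \<noteq> {}" "rot M ` S \<subseteq> S"
  shows "S = out M v"
proof -
  obtain x where x: "x \<in> S" using assms by blast
  then have "x \<in> out M v" using assms by blast
  then have "cyclic_on (rot M) (out M v)" using rot_cyclic[of v] in_out_iff[of x v] src_vertex[of x] by blast
  then have o: "out M v = orbit (rot M) x" using \<open>x \<in> out M v\<close> by (auto simp: cyclic_on_alldef)
  have "y \<in> S" if "y \<in> orbit (rot M) x" for y
    using that by induction (use x assms in auto)
  then show ?thesis using o assms by blast
qed

abbreviation rot_chain :: "'a list \<Rightarrow> bool" where
  "rot_chain \<equiv> successively (\<lambda>x y. rot M x = y)"

abbreviation face_chain :: "'a list \<Rightarrow> bool" where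
  "face_chain \<equiv> successively (\<lambda>x y. rot M (opp M x) = y)"

definition face_cycle :: "'a list \<Rightarrow> bool" where
  "face_cycle f \<longleftrightarrow> f \<noteq> [] \<and> distinct f \<and> face_chain f \<and> rot M (opp M (last f)) = hd f"

lemma face_cycle_face_of: "face_cycle f \<Longrightarrow> a \<in> set f \<Longrightarrow> face_of M a = set f"
  unfolding face_cycle_def face_of_def by (rule orbit_of_cycle) auto

text \<open>The successor of the last arc cannot stay in \<open>xs\<close>, which would then be
  invariant, and cannot enter \<open>ys\<close> behind its head, where it would have a second
  predecessor.\<close>

lemma rot_last_block:
  assumes "rot_chain xs" "rot_chain ys" "xs \<noteq> []" "ys \<noteq> []" "distinct xs"
    and un: "set xs \<union> set ys = out M v" and dj: "set xs \<inter> set ys = {}"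
  shows "rot M (last xs) = hd ys"
proof -
  have l: "last xs \<in> out M v" "last xs \<in> set xs" using un assms by auto
  have d: "z \<in> darts M" if "z \<in> set xs \<union> set ys" for z using that un in_out_iff by blast
  have r: "rot M (last xs) \<in> set xs \<union> set ys" using rot_out[OF l(1)] un by blast
  have cl: "rot M x \<in> set xs" if "x \<in> set (butlast xs)" for x
    using successively_successor[OF assms(1) that] by (cases xs) auto
  have "rot M (last xs) \<notin> set xs"
  proof
    assume h: "rot M (last xs) \<in> set xs"
    then have "rot M ` set xs \<subseteq> set xs" using cl set_butlast_last[OF assms(3)] by auto
    then have "set xs = out M v" using rot_closed_eq_out[of "set xs" v] un assms(3) by auto
    then show False using un dj assms(4) by (metis Int_absorb1 set_empty2 sup_ge2)
  qed
  then have y: "rot M (last xs) \<in> set ys" using r by blast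
  show ?thesis
  proof (rule ccontr)
    assume "rot M (last xs) \<noteq> hd ys"
    then obtain z where z: "z \<in> set (butlast ys)" "rot M z = rot M (last xs)"
      using successively_predecessor[OF assms(2) y] by auto
    then have "z = last xs" using rot_eqD[OF z(2)] d l in_set_butlastD[OF z(1)] by blast
    then show False using z l dj in_set_butlastD by fastforce
  qed
qed

text \<open>A full circle could be cut open anywhere, but an arc set that misses some arc of the
  vertex has only one possible first element: any other start would make the set invariant.\<close>

lemma rot_chain_unique:
  assumes "rot_chain xs" "rot_chain ys" "distinct xs" "distinct ys"
    and eq: "set xs = set ys" and sub: "set xs \<subset> out M v"
  shows "xs = ys"
proof (cases "xs = []")
  case False
  then have ney: "ys \<noteq> []" using eq by auto
  have "hd xs = hd ys"
  proof (rule ccontr)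
    assume ne: "hd xs \<noteq> hd ys"
    have "hd xs \<in> set ys" using False eq by (metis hd_in_set)
    then obtain z where z: "z \<in> set (butlast ys)" "rot M z = hd xs"
      using successively_predecessor[OF assms(2) _ ne] by auto
    have zx: "z \<in> set xs" using z eq in_set_butlastD by fast
    have "z = last xs"
    proof (rule ccontr)
      assume "z \<noteq> last xs"
      then have "z \<in> set (butlast xs)" using zx set_butlast_last[OF False] by auto
      then have "rot M z \<in> set (tl xs)" using successively_successor[OF assms(1)] by auto
      then show False using z hd_notin_tl[OF assms(3) False] by auto
    qed
    have cl: "rot M x \<in> set xs" if "x \<in> set (butlast xs)" for x
      using successively_successor[OF assms(1) that] by (cases xs) auto
    then have "rot M ` set xs \<subseteq> set xs"
      using set_butlast_last[OF False] z \<open>z = last xs\<close> False by auto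
    then show False using rot_closed_eq_out[of "set xs" v] sub False by auto
  qed
  moreover have "length xs = length ys" using assms by (metis distinct_card)
  ultimately show ?thesis using successively_determined[OF assms(1,2) False ney] by auto
next
  case True then show ?thesis using eq by auto
qed

end

section \<open>Pieces and their compositions\<close>

text \<open>Fans are counterclockwise, so \<open>fan_s\<close> runs from right to left and
  \<open>fan_t\<close> from left to right. Both walks keep the outside of the piece on their right:
  \<open>rbd\<close> leads from source to sink, \<open>lbd\<close> from sink back to source.
  \<open>own\<close> holds the vertices whose angles a representation of the piece must fix.\<close>

record ('v, 'a) piece =
  psrc :: 'v
  psnk :: 'v
  pset :: "'a set"
  fan_s :: "'a list"
  fan_t :: "'a list"
  rbd :: "'a list"
  lbd :: "'a list"
  own :: "'v set"
  inner :: "'a list set"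

definition edge_piece :: "('v, 'a) plane_map \<Rightarrow> 'a \<Rightarrow> ('v, 'a) piece" where
  "edge_piece M a = \<lparr>psrc = src M a, psnk = tgt M a, pset = {a, opp M a},
     fan_s = [a], fan_t = [opp M a], rbd = [a], lbd = [opp M a], own = {}, inner = {}\<rparr>"

definition ser :: "('v, 'a) piece \<Rightarrow> ('v, 'a) piece \<Rightarrow> ('v, 'a) piece" where
  "ser X Y = \<lparr>psrc = psrc X, psnk = psnk Y, pset = pset X \<union> pset Y,
     fan_s = fan_s X, fan_t = fan_t Y, rbd = rbd X @ rbd Y, lbd = lbd Y @ lbd X,
     own = own X \<union> own Y \<union> {psnk X}, inner = inner X \<union> inner Y\<rparr>"

definition par :: "('v, 'a) piece \<Rightarrow> ('v, 'a) piece \<Rightarrow> ('v, 'a) piece" where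
  "par X Y = \<lparr>psrc = psrc X, psnk = psnk X, pset = pset X \<union> pset Y,
     fan_s = fan_s Y @ fan_s X, fan_t = fan_t X @ fan_t Y, rbd = rbd Y, lbd = lbd X,
     own = own X \<union> own Y \<union> {psrc X, psnk X},
     inner = insert (rbd X @ lbd Y) (inner X \<union> inner Y)\<rparr>"

lemmas piece_simps [simp] = edge_piece_def ser_def par_def

fun fold_nonempty :: "('b \<Rightarrow> 'b \<Rightarrow> 'b) \<Rightarrow> 'b list \<Rightarrow> 'b" where
  "fold_nonempty f [] = undefined"
| "fold_nonempty f [x] = x"
| "fold_nonempty f (x # y # r) = f x (fold_nonempty f (y # r))"

primrec piece_of :: "('v, 'a) plane_map \<Rightarrow> 'a spq \<Rightarrow> ('v, 'a) piece" where
  "piece_of M (QNode p) = fold_nonempty ser (map (edge_piece M) p)"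
| "piece_of M (SNode ts) = fold_nonempty ser (map (piece_of M) ts)"
| "piece_of M (PNode ts) = fold_nonempty par (map (piece_of M) ts)"
| "piece_of M (Root q t) = piece_of M t"

context rotation_system
begin

definition fan :: "'v \<Rightarrow> 'a list \<Rightarrow> 'a set \<Rightarrow> bool" where
  "fan v xs A \<longleftrightarrow> xs \<noteq> [] \<and> distinct xs \<and> set xs = out M v \<inter> A \<and> rot_chain xs"

text \<open>\<open>butlast\<close> appears because the last arc ends at a pole, which may be
  unowned.\<close>

definition boundary :: "'a list \<Rightarrow> 'a set \<Rightarrow> 'v set \<Rightarrow> bool" where
  "boundary xs A W \<longleftrightarrow> xs \<noteq> [] \<and> distinct xs \<and> face_chain xs \<and> set xs \<subseteq> A \<and>
     tgt M ` set (butlast xs) \<subseteq> W"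

text \<open>The covering of \<open>pset X\<close> by the walks and inner faces is what later shows
  that the listed cycles are all faces of the graph. A pole is owned exactly when the piece has an
  angle of its own there.\<close>

definition valid :: "('v, 'a) piece \<Rightarrow> bool" where
  "valid X \<longleftrightarrow>
     psrc X \<noteq> psnk X \<and> pset X \<subseteq> darts M \<and> opp M ` pset X \<subseteq> pset X \<and>
     (\<forall>a\<in>pset X. src M a \<noteq> tgt M a) \<and>
     fan (psrc X) (fan_s X) (pset X) \<and> fan (psnk X) (fan_t X) (pset X) \<and>
     boundary (rbd X) (pset X) (own X) \<and> boundary (lbd X) (pset X) (own X) \<and>
     hd (rbd X) = hd (fan_s X) \<and> opp M (last (rbd X)) = last (fan_t X) \<and>
     hd (lbd X) = hd (fan_t X) \<and> opp M (last (lbd X)) = last (fan_s X) \<and>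
     own X \<subseteq> ends M (pset X) \<and> ends M (pset X) - {psrc X, psnk X} \<subseteq> own X \<and>
     (psrc X \<in> own X \<longleftrightarrow> 2 \<le> length (fan_s X)) \<and>
     (psnk X \<in> own X \<longleftrightarrow> 2 \<le> length (fan_t X)) \<and>
     pset X = set (rbd X) \<union> set (lbd X) \<union> \<Union>(set ` inner X) \<and>
     (\<forall>f\<in>inner X. face_cycle f \<and> set f \<subseteq> pset X \<and> tgt M ` set f \<subseteq> own X)"

lemma ends_Un: "ends M (A \<union> B) = ends M A \<union> ends M B"
  by (auto simp: ends_def)

lemma fan_nonempty: "fan v xs A \<Longrightarrow> xs \<noteq> [] \<and> distinct xs \<and> rot_chain xs \<and> set xs = out M v \<inter> A"
  by (simp add: fan_def)

lemma fan_in_ends: "fan v xs A \<Longrightarrow> v \<in> ends M A"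
  using in_out_iff[of "hd xs" v] hd_in_set[of xs] by (auto simp: fan_def ends_def)

lemma fan_hd: "fan v xs A \<Longrightarrow> hd xs \<in> darts M \<and> src M (hd xs) = v \<and> hd xs \<in> A"
  using in_out_iff[of "hd xs" v] hd_in_set[of xs] by (auto simp: fan_def)

lemma fan_last: "fan v xs A \<Longrightarrow> last xs \<in> darts M \<and> src M (last xs) = v \<and> last xs \<in> A"
  using in_out_iff[of "last xs" v] last_in_set[of xs] by (auto simp: fan_def)

lemma validD:
  assumes "valid X"
  shows "psrc X \<noteq> psnk X" "pset X \<subseteq> darts M" "opp M ` pset X \<subseteq> pset X"
    "\<forall>a\<in>pset X. src M a \<noteq> tgt M a"
  using assms unfolding valid_def by - (elim conjE, assumption)+

lemma valid_fans:
  assumes "valid X"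
  shows "fan (psrc X) (fan_s X) (pset X)" "fan (psnk X) (fan_t X) (pset X)"
  using assms unfolding valid_def by - (elim conjE, assumption)+

lemma valid_boundaries:
  assumes "valid X"
  shows "boundary (rbd X) (pset X) (own X)" "boundary (lbd X) (pset X) (own X)"
    "hd (rbd X) = hd (fan_s X)" "opp M (last (rbd X)) = last (fan_t X)"
    "hd (lbd X) = hd (fan_t X)" "opp M (last (lbd X)) = last (fan_s X)"
  using assms unfolding valid_def by - (elim conjE, assumption)+

lemma valid_own:
  assumes "valid X"
  shows "own X \<subseteq> ends M (pset X)" "ends M (pset X) - {psrc X, psnk X} \<subseteq> own X"
    "psrc X \<in> own X \<longleftrightarrow> 2 \<le> length (fan_s X)" "psnk X \<in> own X \<longleftrightarrow> 2 \<le> length (fan_t X)"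
  using assms unfolding valid_def by - (elim conjE, assumption)+

lemma valid_inner:
  assumes "valid X"
  shows "pset X = set (rbd X) \<union> set (lbd X) \<union> \<Union>(set ` inner X)"
    "\<forall>f\<in>inner X. face_cycle f \<and> set f \<subseteq> pset X \<and> tgt M ` set f \<subseteq> own X"
  using assms unfolding valid_def by - (elim conjE, assumption)+

lemma valid_last:
  assumes "valid X"
  shows "last (rbd X) \<in> darts M" "last (lbd X) \<in> darts M"
    "tgt M (last (rbd X)) = psnk X" "tgt M (last (lbd X)) = psrc X"
    "rbd X \<noteq> []" "lbd X \<noteq> []" "fan_s X \<noteq> []" "fan_t X \<noteq> []"
proof -
  note b = valid_boundaries[OF assms] and f = valid_fans[OF assms]
  show "rbd X \<noteq> []" "lbd X \<noteq> []" using b unfolding boundary_def by blast+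
  show "fan_s X \<noteq> []" "fan_t X \<noteq> []" using f unfolding fan_def by blast+
  show d: "last (rbd X) \<in> darts M" "last (lbd X) \<in> darts M"
    using b(1,2) validD(2)[OF assms] unfolding boundary_def by (meson last_in_set subset_iff)+
  show "tgt M (last (rbd X)) = psnk X" "tgt M (last (lbd X)) = psrc X"
    using src_opp[OF d(1)] src_opp[OF d(2)] b fan_last[OF f(1)] fan_last[OF f(2)] by metis+
qed

lemma boundary_mono: "boundary xs A W \<Longrightarrow> A \<subseteq> A' \<Longrightarrow> W \<subseteq> W' \<Longrightarrow> boundary xs A' W'"
  by (auto simp: boundary_def)

lemma boundary_append:
  assumes "boundary xs A W" "boundary ys B W" "A \<inter> B = {}" "tgt M (last xs) \<in> W"
    "rot M (opp M (last xs)) = hd ys"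
  shows "boundary (xs @ ys) (A \<union> B) W"
  using assms set_butlast_last[of xs]
  by (auto simp: boundary_def butlast_append successively_append_iff)

text \<open>The last conjunct makes the joint an interior vertex: no arc from outside separates the
  two fans.\<close>

definition series_ok :: "('v, 'a) piece \<Rightarrow> ('v, 'a) piece \<Rightarrow> bool" where
  "series_ok X Y \<longleftrightarrow> valid X \<and> valid Y \<and> psrc Y = psnk X \<and>
     ends M (pset X) \<inter> ends M (pset Y) = {psnk X} \<and> out M (psnk X) \<subseteq> pset X \<union> pset Y"

text \<open>The last two conjuncts provide an outside arc at each pole, so the joined fan is never a
  full circle.\<close>

definition parallel_ok :: "('v, 'a) piece \<Rightarrow> ('v, 'a) piece \<Rightarrow> bool" where
  "parallel_ok X Y \<longleftrightarrow> valid X \<and> valid Y \<and> psrc Y = psrc X \<and> psnk Y = psnk X \<and>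
     pset X \<inter> pset Y = {} \<and> ends M (pset X) \<inter> ends M (pset Y) = {psrc X, psnk X} \<and>
     rot M (last (fan_t X)) = hd (fan_t Y) \<and> rot M (last (fan_s Y)) = hd (fan_s X) \<and>
     rot M (last (fan_t Y)) \<notin> pset X \<union> pset Y \<and> rot M (last (fan_s X)) \<notin> pset X \<union> pset Y"

lemma valid_edge:
  assumes "a \<in> darts M" "src M a \<noteq> tgt M a"
  shows "valid (edge_piece M a)"
  using assms
  by (auto simp: valid_def fan_def boundary_def ends_def in_out_iff)

text \<open>A common arc would have both ends at the joint and be a loop.\<close>

lemma series_disjoint:
  assumes "series_ok X Y"
  shows "pset X \<inter> pset Y = {}"
proof (rule ccontr)
  assume "pset X \<inter> pset Y \<noteq> {}"
  then obtain a where a: "a \<in> pset X" "a \<in> pset Y" by blast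
  then have "src M a \<in> ends M (pset X) \<inter> ends M (pset Y)"
    "tgt M a \<in> ends M (pset X) \<inter> ends M (pset Y)" by (auto simp: ends_def)
  then have "src M a = tgt M a" using assms unfolding series_ok_def by (metis singletonD)
  then show False using a assms validD(4) unfolding series_ok_def by metis
qed

lemma series_rot:
  assumes "series_ok X Y"
  shows "set (fan_t X) \<union> set (fan_s Y) = out M (psnk X)"
    and "set (fan_t X) \<inter> set (fan_s Y) = {}"
    and "rot M (last (fan_t X)) = hd (fan_s Y)"
    and "rot M (last (fan_s Y)) = hd (fan_t X)"
proof -
  have f: "fan (psnk X) (fan_t X) (pset X)" "fan (psnk X) (fan_s Y) (pset Y)"
    using assms valid_fans unfolding series_ok_def by metis+
  show 1: "set (fan_t X) \<union> set (fan_s Y) = out M (psnk X)"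
    using f assms by (auto simp: fan_def series_ok_def)
  show 2: "set (fan_t X) \<inter> set (fan_s Y) = {}"
    using f series_disjoint[OF assms] by (auto simp: fan_def)
  show "rot M (last (fan_t X)) = hd (fan_s Y)"
    using f 1 2 by (intro rot_last_block) (auto simp: fan_def)
  show "rot M (last (fan_s Y)) = hd (fan_t X)"
    using f 1 2 by (intro rot_last_block) (auto simp: fan_def)
qed

lemma fan_extend: 
  assumes "fan v xs A" "v \<notin> ends M B"
  shows "fan v xs (A \<union> B)"
proof -
  have "out M v \<inter> B = {}" using assms in_out_iff by (auto simp: ends_def)
  then show ?thesis using assms by (simp add: fan_def Int_Un_distrib)
qed

lemma valid_ser:
  assumes ok: "series_ok X Y"
  shows "valid (ser X Y)"
proof -
  have X: "valid X" and Y: "valid Y" and w: "psrc Y = psnk X"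
    and e: "ends M (pset X) \<inter> ends M (pset Y) = {psnk X}"
    using ok unfolding series_ok_def by blast+
  note r = series_rot[OF ok]
  have dj: "pset X \<inter> pset Y = {}" by (rule series_disjoint[OF ok])
  have fX: "fan (psrc X) (fan_s X) (pset X)" "fan (psnk X) (fan_t X) (pset X)"
    and fY: "fan (psnk X) (fan_s Y) (pset Y)" "fan (psnk Y) (fan_t Y) (pset Y)"
    using valid_fans X Y w by metis+
  have s: "psrc X \<in> ends M (pset X)" "psnk Y \<in> ends M (pset Y)"
    using fan_in_ends fX fY by auto
  have ne: "psrc X \<noteq> psnk X" "psnk Y \<noteq> psnk X" using validD(1)[OF X] validD(1)[OF Y] w by auto
  have sn: "psrc X \<notin> ends M (pset Y)" "psnk Y \<notin> ends M (pset X)" using s ne e by blast+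
  let ?W = "own X \<union> own Y \<union> {psnk X}"
  have lx: "tgt M (last (rbd X)) = psnk X" "tgt M (last (lbd Y)) = psnk X"
    and fx: "rot M (opp M (last (rbd X))) = hd (rbd Y)"
       "rot M (opp M (last (lbd Y))) = hd (lbd X)"
    using valid_last[OF X] valid_last[OF Y] w r valid_boundaries[OF X] valid_boundaries[OF Y] by simp_all
  have bx: "boundary (rbd X) (pset X) ?W" "boundary (lbd X) (pset X) ?W"
     "boundary (rbd Y) (pset Y) ?W" "boundary (lbd Y) (pset Y) ?W"
    using valid_boundaries(1,2)[OF X] valid_boundaries(1,2)[OF Y]
    by (auto elim!: boundary_mono)
  have b: "boundary (rbd X @ rbd Y) (pset X \<union> pset Y) ?W"
    "boundary (lbd Y @ lbd X) (pset X \<union> pset Y) ?W"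
    using boundary_append[OF bx(1,3) dj] boundary_append[OF bx(4,2)] dj fx lx
    by (auto simp: Un_commute Int_commute)
  have f: "fan (psrc X) (fan_s X) (pset X \<union> pset Y)" "fan (psnk Y) (fan_t Y) (pset X \<union> pset Y)"
    using fan_extend[OF fX(1) sn(1)] fan_extend[OF fY(2) sn(2)] by (auto simp: Un_commute)
  have nn: "rbd X \<noteq> []" "rbd Y \<noteq> []" "lbd X \<noteq> []" "lbd Y \<noteq> []"
    using bx by (auto simp: boundary_def)
  have oX: "own X \<subseteq> ends M (pset X)" "own Y \<subseteq> ends M (pset Y)" using valid_own X Y by blast+
  \<comment> \<open>The outer poles lie in one component only, so their ownership is inherited
    unchanged.\<close>
  have o1: "psrc X \<in> ?W \<longleftrightarrow> 2 \<le> length (fan_s X)" "psnk Y \<in> ?W \<longleftrightarrow> 2 \<le> length (fan_t Y)"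
    using valid_own(3)[OF X] valid_own(4)[OF Y] oX sn ne by blast+
  have o2: "?W \<subseteq> ends M (pset X) \<union> ends M (pset Y)" using oX e by blast
  have o3: "ends M (pset X) \<union> ends M (pset Y) - {psrc X, psnk Y} \<subseteq> ?W"
    using valid_own(2)[OF X] valid_own(2)[OF Y] w by auto
  have p: "psrc X \<noteq> psnk Y" using sn s by auto
  have h: "hd (rbd X @ rbd Y) = hd (fan_s X)" "opp M (last (rbd X @ rbd Y)) = last (fan_t Y)"
    "hd (lbd Y @ lbd X) = hd (fan_t Y)" "opp M (last (lbd Y @ lbd X)) = last (fan_s X)"
    using nn valid_boundaries[OF X] valid_boundaries[OF Y] by simp_all
  have u: "pset X \<union> pset Y = set (rbd X @ rbd Y) \<union> set (lbd Y @ lbd X) \<union> \<Union>(set ` (inner X \<union> inner Y))"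
    using valid_inner(1)[OF X] valid_inner(1)[OF Y] by (simp only: image_Un Union_Un_distrib set_append) blast
  have i: "\<forall>f\<in>inner X \<union> inner Y. face_cycle f \<and> set f \<subseteq> pset X \<union> pset Y \<and> tgt M ` set f \<subseteq> ?W"
    using valid_inner(2)[OF X] valid_inner(2)[OF Y] by blast
  have m: "pset X \<union> pset Y \<subseteq> darts M" "opp M ` (pset X \<union> pset Y) \<subseteq> pset X \<union> pset Y"
     "\<forall>a\<in>pset X \<union> pset Y. src M a \<noteq> tgt M a"
    using validD[OF X] validD[OF Y] by blast+
  show ?thesis
    unfolding valid_def ser_def piece.simps ends_Un
    by (intro conjI; fact p m f b h o1 o2 o3 u i)
qed

lemma valid_par:
  assumes ok: "parallel_ok X Y"
  shows "valid (par X Y)"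
proof -
  have X: "valid X" and Y: "valid Y" and w: "psrc Y = psrc X" "psnk Y = psnk X"
    and e: "ends M (pset X) \<inter> ends M (pset Y) = {psrc X, psnk X}"
    and dj: "pset X \<inter> pset Y = {}"
    and r: "rot M (last (fan_t X)) = hd (fan_t Y)" "rot M (last (fan_s Y)) = hd (fan_s X)"
    using ok unfolding parallel_ok_def by blast+
  have fX: "fan (psrc X) (fan_s X) (pset X)" "fan (psnk X) (fan_t X) (pset X)"
    and fY: "fan (psrc X) (fan_s Y) (pset Y)" "fan (psnk X) (fan_t Y) (pset Y)"
    using valid_fans X Y w by metis+
  have f: "fan (psrc X) (fan_s Y @ fan_s X) (pset X \<union> pset Y)"
    "fan (psnk X) (fan_t X @ fan_t Y) (pset X \<union> pset Y)"
    using fX fY r dj by (auto simp: fan_def successively_append_iff)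
  let ?W = "own X \<union> own Y \<union> {psrc X, psnk X}"
  have lx: "tgt M (last (rbd X)) = psnk X" "tgt M (last (lbd Y)) = psrc X"
    and fx: "rot M (opp M (last (rbd X))) = hd (lbd Y)" "rot M (opp M (last (lbd Y))) = hd (rbd X)"
    using valid_last[OF X] valid_last[OF Y] w r valid_boundaries[OF X] valid_boundaries[OF Y] by simp_all
  have bx: "boundary (rbd X) (pset X) ?W" "boundary (lbd X) (pset X) ?W"
     "boundary (rbd Y) (pset Y) ?W" "boundary (lbd Y) (pset Y) ?W"
    using valid_boundaries(1,2)[OF X] valid_boundaries(1,2)[OF Y]
    by (auto elim!: boundary_mono)
  \<comment> \<open>The right walk of the left component continues into the left walk of the right
    one and closes up at the source: this is the face between them.\<close>
  have bf: "boundary (rbd X @ lbd Y) (pset X \<union> pset Y) ?W"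
    using boundary_append[OF bx(1,4) dj] fx lx by auto
  have b: "boundary (rbd Y) (pset X \<union> pset Y) ?W" "boundary (lbd X) (pset X \<union> pset Y) ?W"
    using bx boundary_mono[of _ _ ?W _ ?W] by blast+
  have nn: "rbd X \<noteq> []" "lbd Y \<noteq> []"
    using bx by (auto simp: boundary_def)
  have fc: "face_cycle (rbd X @ lbd Y)" "set (rbd X @ lbd Y) \<subseteq> pset X \<union> pset Y"
    using bf fx nn by (auto simp: face_cycle_def boundary_def)
  have tf: "tgt M ` set (rbd X @ lbd Y) \<subseteq> ?W"
    using bx lx nn set_butlast_last[of "rbd X"] set_butlast_last[of "lbd Y"]
    by (auto simp: boundary_def)
  have oX: "own X \<subseteq> ends M (pset X)" "own Y \<subseteq> ends M (pset Y)" using valid_own X Y by blast+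
  have len: "2 \<le> length (fan_s Y @ fan_s X)" "2 \<le> length (fan_t X @ fan_t Y)"
    using fX fY by (auto simp: fan_def neq_Nil_conv)
  have o2: "?W \<subseteq> ends M (pset X) \<union> ends M (pset Y)" using oX e by blast
  have o3: "ends M (pset X) \<union> ends M (pset Y) - {psrc X, psnk X} \<subseteq> ?W"
    using valid_own(2)[OF X] valid_own(2)[OF Y] w by auto
  have h: "hd (rbd Y) = hd (fan_s Y @ fan_s X)" "opp M (last (rbd Y)) = last (fan_t X @ fan_t Y)"
    "hd (lbd X) = hd (fan_t X @ fan_t Y)" "opp M (last (lbd X)) = last (fan_s Y @ fan_s X)"
    using valid_last[OF X] valid_last[OF Y] valid_boundaries[OF X] valid_boundaries[OF Y] by simp_all
  have u: "pset X \<union> pset Y = set (rbd Y) \<union> set (lbd X) \<union>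
     \<Union>(set ` insert (rbd X @ lbd Y) (inner X \<union> inner Y))"
    using valid_inner(1)[OF X] valid_inner(1)[OF Y]
    by (simp only: image_Un Union_Un_distrib set_append image_insert Union_insert) blast
  have i: "\<forall>f\<in>insert (rbd X @ lbd Y) (inner X \<union> inner Y).
      face_cycle f \<and> set f \<subseteq> pset X \<union> pset Y \<and> tgt M ` set f \<subseteq> ?W"
    using valid_inner(2)[OF X] valid_inner(2)[OF Y] fc tf by blast
  have m: "psrc X \<noteq> psnk X" "pset X \<union> pset Y \<subseteq> darts M" "opp M ` (pset X \<union> pset Y) \<subseteq> pset X \<union> pset Y"
     "\<forall>a\<in>pset X \<union> pset Y. src M a \<noteq> tgt M a"
    using validD[OF X] validD[OF Y] by blast+
  have o1: "psrc X \<in> ?W \<longleftrightarrow> 2 \<le> length (fan_s Y @ fan_s X)"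
    "psnk X \<in> ?W \<longleftrightarrow> 2 \<le> length (fan_t X @ fan_t Y)"
    using len by blast+
  show ?thesis
    unfolding valid_def par_def piece.simps ends_Un
    by (intro conjI; fact m f b h o1 o2 o3 u i)
qed

end

section \<open>Chains of compositions\<close>

lemma fold_ser:
  assumes "Xs \<noteq> []"
  shows "psrc (fold_nonempty ser Xs) = psrc (hd Xs)" "psnk (fold_nonempty ser Xs) = psnk (last Xs)"
    "pset (fold_nonempty ser Xs) = \<Union>(pset ` set Xs)"
    "fan_s (fold_nonempty ser Xs) = fan_s (hd Xs)" "fan_t (fold_nonempty ser Xs) = fan_t (last Xs)"
  using assms by (induction Xs rule: induct_list012) auto

lemma fold_par:
  assumes "Xs \<noteq> []"
  shows "psrc (fold_nonempty par Xs) = psrc (hd Xs)" "psnk (fold_nonempty par Xs) = psnk (hd Xs)"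
    "pset (fold_nonempty par Xs) = \<Union>(pset ` set Xs)"
    "fan_s (fold_nonempty par Xs) = concat (rev (map fan_s Xs))"
    "fan_t (fold_nonempty par Xs) = concat (map fan_t Xs)"
  using assms by (induction Xs rule: induct_list012) auto

lemma ends_UN: "ends M (\<Union>(f ` S)) = (\<Union>x\<in>S. ends M (f x))"
  by (auto simp: ends_def)

context rotation_system
begin

fun series_chain :: "('v, 'a) piece list \<Rightarrow> bool" where
  "series_chain [] \<longleftrightarrow> False"
| "series_chain [X] \<longleftrightarrow> valid X"
| "series_chain (X # Y # r) \<longleftrightarrow> series_ok X (fold_nonempty ser (Y # r)) \<and> series_chain (Y # r)"

fun parallel_chain :: "('v, 'a) piece list \<Rightarrow> bool" where
  "parallel_chain [] \<longleftrightarrow> False"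
| "parallel_chain [X] \<longleftrightarrow> valid X"
| "parallel_chain (X # Y # r) \<longleftrightarrow> parallel_ok X (fold_nonempty par (Y # r)) \<and> parallel_chain (Y # r)"

lemma valid_series_chain: "series_chain Xs \<Longrightarrow> valid (fold_nonempty ser Xs)"
  by (induction Xs rule: series_chain.induct) (auto simp del: piece_simps intro: valid_ser)

lemma valid_parallel_chain: "parallel_chain Xs \<Longrightarrow> valid (fold_nonempty par Xs)"
  by (induction Xs rule: parallel_chain.induct) (auto simp del: piece_simps intro: valid_par)

lemma series_chainI:
  assumes "Xs \<noteq> []" "\<forall>X\<in>set Xs. valid X"
    and "\<forall>i. Suc i < length Xs \<longrightarrow> psrc (Xs ! Suc i) = psnk (Xs ! i)"
    and "\<forall>i j. i < j \<and> j < length Xs \<longrightarrow> ends M (pset (Xs ! i)) \<inter> ends M (pset (Xs ! j)) =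
        (if j = Suc i then {psnk (Xs ! i)} else {})"
    and "\<forall>i. Suc i < length Xs \<longrightarrow> out M (psnk (Xs ! i)) \<subseteq> pset (Xs ! i) \<union> pset (Xs ! Suc i)"
  shows "series_chain Xs"
  using assms
proof (induction Xs rule: series_chain.induct)
  case (3 X Y r)
  have "series_chain (Y # r)"
  proof (rule "3.IH")
    show "\<forall>i. Suc i < length (Y # r) \<longrightarrow> psrc ((Y # r) ! Suc i) = psnk ((Y # r) ! i)"
      using "3.prems"(3) by (metis Suc_less_eq length_Cons nth_Cons_Suc)
    show "\<forall>i j. i < j \<and> j < length (Y # r) \<longrightarrow> ends M (pset ((Y # r) ! i)) \<inter> ends M (pset ((Y # r) ! j)) =
        (if j = Suc i then {psnk ((Y # r) ! i)} else {})"
    proof (intro allI impI)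
      fix i j assume "i < j \<and> j < length (Y # r)"
      then show "ends M (pset ((Y # r) ! i)) \<inter> ends M (pset ((Y # r) ! j)) =
        (if j = Suc i then {psnk ((Y # r) ! i)} else {})"
        using "3.prems"(4)[rule_format, of "Suc i" "Suc j"] by simp
    qed
    show "\<forall>i. Suc i < length (Y # r) \<longrightarrow>
        out M (psnk ((Y # r) ! i)) \<subseteq> pset ((Y # r) ! i) \<union> pset ((Y # r) ! Suc i)"
      using "3.prems"(5) by (metis Suc_less_eq length_Cons nth_Cons_Suc)
  qed (use "3.prems" in auto)
  moreover have "series_ok X (fold_nonempty ser (Y # r))"
  proof -
    have c0: "ends M (pset X) \<inter> ends M (pset Y) = {psnk X}"
      using "3.prems"(4)[rule_format, of 0 1] by simp
    have cr: "ends M (pset X) \<inter> ends M (pset Z) = {}" if "Z \<in> set r" for Z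
    proof -
      obtain k where "k < length r" "Z = r ! k" using \<open>Z \<in> set r\<close> by (auto simp: in_set_conv_nth)
      then show ?thesis using "3.prems"(4)[rule_format, of 0 "Suc (Suc k)"] by simp
    qed
    have "ends M (pset X) \<inter> ends M (pset (fold_nonempty ser (Y # r))) = {psnk X}"
      unfolding fold_ser(3)[OF list.distinct(2)] ends_UN using c0 cr by auto
    moreover have "psrc Y = psnk X" "out M (psnk X) \<subseteq> pset X \<union> pset Y"
      using "3.prems"(3)[rule_format, of 0] "3.prems"(5)[rule_format, of 0] by simp_all
    moreover have "valid X" using "3.prems" by simp
    ultimately show ?thesis
      using valid_series_chain[OF \<open>series_chain (Y # r)\<close>] fold_ser[of "Y # r"]
      unfolding series_ok_def by auto
  qed
  ultimately show ?case by simp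
qed auto

lemma parallel_chainI:
  assumes "Xs \<noteq> []" "\<forall>X\<in>set Xs. valid X \<and> psrc X = s \<and> psnk X = t"
    and "\<forall>i j. i < j \<and> j < length Xs \<longrightarrow> pset (Xs ! i) \<inter> pset (Xs ! j) = {} \<and>
        ends M (pset (Xs ! i)) \<inter> ends M (pset (Xs ! j)) = {s, t}"
    and "rot_chain (concat (map fan_t Xs))" "rot_chain (concat (rev (map fan_s Xs)))"
    and "rot M (last (concat (map fan_t Xs))) \<notin> \<Union>(pset ` set Xs)"
    and "rot M (last (fan_s (hd Xs))) \<notin> \<Union>(pset ` set Xs)"
  shows "parallel_chain Xs"
  using assms
proof (induction Xs rule: parallel_chain.induct)
  case (3 X Y r)
  have v: "valid X" "valid Y" "\<forall>Z\<in>set r. valid Z" using "3.prems"(2) by auto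
  note l = valid_last[OF v(1)] valid_last[OF v(2)]
  have dj: "pset X \<inter> pset Z = {} \<and> ends M (pset X) \<inter> ends M (pset Z) = {s, t}" if Z: "Z \<in> set (Y # r)" for Z
  proof -
    obtain k where "k < length (Y # r)" "Z = (Y # r) ! k"
      using Z by (auto simp only: in_set_conv_nth)
    then show ?thesis using "3.prems"(3)[rule_format, of 0 "Suc k"] by simp
  qed
  have ne: "concat (map fan_t (Y # r)) \<noteq> []" "concat (rev (map fan_s (Y # r))) \<noteq> []"
    using l by auto
  have la: "last (concat (rev (map fan_s (Y # r)))) = last (fan_s Y)"
    "last (concat (map fan_t (X # Y # r))) = last (concat (map fan_t (Y # r)))"
    using l ne by auto
  have ht: "hd (concat (map fan_t (Y # r))) = hd (fan_t Y)" using l by auto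
  have ch: "rot_chain (fan_t X @ concat (map fan_t (Y # r)))"
      "rot_chain (concat (rev (map fan_s (Y # r))) @ fan_s X)" using "3.prems"(4,5) by auto
  have r1: "rot M (last (fan_t X)) = hd (fan_t Y)" "rot M (last (fan_s Y)) = hd (fan_s X)"
  proof -
    show "rot M (last (fan_t X)) = hd (fan_t Y)" "rot M (last (fan_s Y)) = hd (fan_s X)"
      using ch l ne la ht unfolding successively_append_iff by metis+
  qed
  have hx: "hd (fan_s X) \<in> pset X" using fan_hd valid_fans(1)[OF v(1)] by blast
  have "parallel_chain (Y # r)"
  proof (rule "3.IH")
    show "\<forall>i j. i < j \<and> j < length (Y # r) \<longrightarrow> pset ((Y # r) ! i) \<inter> pset ((Y # r) ! j) = {} \<and>
        ends M (pset ((Y # r) ! i)) \<inter> ends M (pset ((Y # r) ! j)) = {s, t}"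
    proof (intro allI impI)
      fix i j assume "i < j \<and> j < length (Y # r)"
      then show "pset ((Y # r) ! i) \<inter> pset ((Y # r) ! j) = {} \<and>
        ends M (pset ((Y # r) ! i)) \<inter> ends M (pset ((Y # r) ! j)) = {s, t}"
        using "3.prems"(3)[rule_format, of "Suc i" "Suc j"] by simp
    qed
    show "rot_chain (concat (map fan_t (Y # r)))" "rot_chain (concat (rev (map fan_s (Y # r))))"
      using ch unfolding successively_append_iff by blast+
    show "rot M (last (concat (map fan_t (Y # r)))) \<notin> \<Union>(pset ` set (Y # r))"
      using "3.prems"(6) la by simp
    \<comment> \<open>At the source the arc behind the leftmost remaining component is the first arc
      of \<open>X\<close>, which is outside the rest.\<close>
    show "rot M (last (fan_s (hd (Y # r)))) \<notin> \<Union>(pset ` set (Y # r))"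
      using r1 hx dj by fastforce
  qed (use "3.prems"(2) in auto)
  moreover have "parallel_ok X (fold_nonempty par (Y # r))"
  proof -
    let ?F = "fold_nonempty par (Y # r)"
    have F: "psrc ?F = s" "psnk ?F = t" "psrc X = s" "psnk X = t" "pset ?F = \<Union>(pset ` set (Y # r))"
       "fan_s ?F = concat (rev (map fan_s (Y # r)))" "fan_t ?F = concat (map fan_t (Y # r))"
      using "3.prems"(2) by (simp_all only: fold_par[OF list.distinct(2)] list.sel list.set ball_simps simp_thms)
    have "ends M (pset X) \<inter> ends M (pset ?F) = {s, t}"
      unfolding F(5) ends_UN using dj by auto
    moreover have "pset X \<inter> pset ?F = {}" unfolding F(5) using dj by auto
    moreover have "rot M (last (fan_t X)) = hd (fan_t ?F)" "rot M (last (fan_s ?F)) = hd (fan_s X)"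
      unfolding F(6,7) la ht using r1 by auto
    moreover have "rot M (last (fan_t ?F)) \<notin> pset X \<union> pset ?F"
      "rot M (last (fan_s X)) \<notin> pset X \<union> pset ?F"
      unfolding F(5,7) using "3.prems"(6,7) la by auto
    moreover have "valid ?F" using valid_parallel_chain[OF \<open>parallel_chain (Y # r)\<close>] .
    ultimately show ?thesis
      using v F unfolding parallel_ok_def by metis
  qed
  ultimately show ?case by simp
qed auto

text \<open>Not a clause of \<open>spq_node\<close>: it holds for the child of the root, because
  there only the reference edge lies outside, and is handed down the tree. It is the reason why
  joints of an S-node see no foreign arcs.\<close>

definition closed_off :: "'a set \<Rightarrow> 'v \<Rightarrow> 'v \<Rightarrow> bool" where
  "closed_off A s t \<longleftrightarrow> (\<forall>w\<in>ends M A - {s, t}. out M w \<subseteq> A)"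

lemma awalk_verts_map:
  "pre_digraph.awalk (dgraph M) u p v \<Longrightarrow> pre_digraph.awalk_verts (dgraph M) u p = u # map (tgt M) p"
proof (induction p arbitrary: u)
  case Nil then show ?case by (simp add: pre_digraph.awalk_verts.simps)
next
  case (Cons a p)
  then show ?case using wf_digraph.awalk_Cons_iff[OF wf, of u a p v]
    by (simp add: pre_digraph.awalk_verts.simps)
qed

lemma apath_Cons:
  "pre_digraph.apath (dgraph M) u (a # p) v \<longleftrightarrow>
    a \<in> darts M \<and> src M a = u \<and> pre_digraph.apath (dgraph M) (tgt M a) p v \<and> u \<notin> set (tgt M a # map (tgt M) p)"
  using awalk_verts_map[of "tgt M a" p v] wf_digraph.apath_Cons_iff[OF wf, of u a p v]
  by (auto simp: pre_digraph.apath_def)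

lemma ends_edges:
  "set p \<subseteq> darts M \<Longrightarrow> ends M (set p \<union> opp M ` set p) = src M ` set p \<union> tgt M ` set p"
  by (force simp: ends_def image_iff subset_iff)

lemma apath_ends:
  assumes "pre_digraph.apath (dgraph M) u p v" "p \<noteq> []"
  shows "set p \<subseteq> darts M" "src M ` set p \<union> tgt M ` set p = insert u (tgt M ` set p)"
    "src M (hd p) = u" "tgt M (last p) = v"
  using assms
proof (induction p arbitrary: u)
  case (Cons a p)
  {
    case 1 then show ?case using Cons by (cases "p = []") (auto simp: apath_Cons)
  next
    case 2 then show ?case using Cons(2)[of "tgt M a"] by (cases "p = []") (auto simp: apath_Cons)
  next
    case 3 then show ?case by (simp add: apath_Cons)
  next
    case 4 then show ?case using Cons(4)[of "tgt M a"]
      by (cases "p = []") (auto simp: apath_Cons wf_digraph.apath_Nil_iff[OF wf])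
  }
qed auto

text \<open>A path never returns to a vertex, so its first edge meets the rest in one vertex, and
  all arcs at that vertex belong to the path.\<close>

lemma series_chain_path:
  assumes "pre_digraph.apath (dgraph M) u p v" "p \<noteq> []"
    and "\<forall>w\<in>tgt M ` set (butlast p). out M w \<subseteq> set p \<union> opp M ` set p"
  shows "series_chain (map (edge_piece M) p)"
  using assms
proof (induction p arbitrary: u)
  case (Cons a p)
  have a: "a \<in> darts M" "src M a = u" "pre_digraph.apath (dgraph M) (tgt M a) p v"
    "u \<noteq> tgt M a" "u \<notin> tgt M ` set p" using Cons.prems(1) by (auto simp: apath_Cons)
  have va: "valid (edge_piece M a)" using a by (intro valid_edge) auto
  show ?case
  proof (cases p)
    case Nil then show ?thesis using va by (simp del: piece_simps)
  next
    case (Cons b q)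
    then have pne: "p \<noteq> []" by simp
    note pe = apath_ends[OF a(3) pne]
    have d: "distinct (tgt M a # map (tgt M) p)"
      using a(3) awalk_verts_map by (auto simp: pre_digraph.apath_def)
    have sc: "series_chain (map (edge_piece M) p)"
    proof (rule Cons.IH[OF a(3) pne])
      show "\<forall>w\<in>tgt M ` set (butlast p). out M w \<subseteq> set p \<union> opp M ` set p"
      proof
        fix w assume w: "w \<in> tgt M ` set (butlast p)"
        then have "out M w \<subseteq> set (a # p) \<union> opp M ` set (a # p)" using Cons.prems(3) pne by auto
        moreover have wp: "w \<in> tgt M ` set p" using w by (auto dest: in_set_butlastD)
        \<comment> \<open>The two arcs of the first edge leave from vertices different from
          \<open>w\<close>, so the containment survives dropping that edge.\<close>
        moreover have "a \<notin> out M w" using wp a in_out_iff by auto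
        moreover have "opp M a \<notin> out M w" using wp d a in_out_iff by auto
        ultimately show "out M w \<subseteq> set p \<union> opp M ` set p"
          unfolding list.set image_insert by blast
      qed
    qed
    have "series_ok (edge_piece M a) (fold_nonempty ser (map (edge_piece M) p))"
    proof -
      let ?F = "fold_nonempty ser (map (edge_piece M) p)"
      have F: "psrc ?F = tgt M a" "pset ?F = set p \<union> opp M ` set p"
        using fold_ser[of "map (edge_piece M) p"] pne pe by (auto simp: hd_map)
      have e1: "ends M {a, opp M a} = {u, tgt M a}" using a by (auto simp: ends_def)
      have e2: "ends M (pset ?F) = insert (tgt M a) (tgt M ` set p)"
        unfolding F ends_edges[OF pe(1)] pe(2) ..
      have "ends M {a, opp M a} \<inter> ends M (pset ?F) = {tgt M a}" unfolding e1 e2 using a by auto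
      moreover have "out M (tgt M a) \<subseteq> {a, opp M a} \<union> pset ?F"
      proof -
        have "out M (tgt M a) \<subseteq> set (a # p) \<union> opp M ` set (a # p)"
          using Cons.prems(3) pne by auto
        then show ?thesis unfolding F by auto
      qed
      ultimately show ?thesis
        using va valid_series_chain[OF sc] F
        unfolding series_ok_def by simp
    qed
    then show ?thesis using Cons sc by (simp del: piece_simps)
  qed
qed auto

section \<open>Pieces of decomposition nodes\<close>

lemma ccw_order_chain:
  assumes "ccw_order M v xs" "xs \<noteq> []"
  shows "rot_chain xs" "rot M (last xs) = hd xs" "distinct xs" "set xs = out M v"
proof -
  have r: "rot M (xs ! i) = xs ! (Suc i mod length xs)" if "i < length xs" for i
    using assms that by (auto simp: ccw_order_def)
  show "rot_chain xs"
    unfolding successively_conv_nth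
  proof (intro allI impI)
    fix i assume "Suc i < length xs"
    then show "rot M (xs ! i) = xs ! Suc i" using r[of i] by simp
  qed
  show "rot M (last xs) = hd xs"
    using r[of "length xs - 1"] assms(2) by (simp add: last_conv_nth hd_conv_nth)
  show "distinct xs" "set xs = out M v" using assms by (auto simp: ccw_order_def)
qed

lemma source_sink_SNode:
  "ts \<noteq> [] \<Longrightarrow> source M (SNode ts) = source M (hd ts)"
  "ts \<noteq> [] \<Longrightarrow> sink M (SNode ts) = sink M (last ts)"
  by (simp_all add: hd_map last_map)

lemma source_sink_PNode:
  "ts \<noteq> [] \<Longrightarrow> source M (PNode ts) = source M (hd ts)"
  "ts \<noteq> [] \<Longrightarrow> sink M (PNode ts) = sink M (hd ts)"
  by (simp_all add: hd_map)

lemma ends_pert_child: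
  "\<mu> \<in> set ts \<Longrightarrow> ends M (pert M \<mu>) \<subseteq> ends M (\<Union>(set (map (pert M) ts)))"
  by (auto simp: ends_def)

lemma spq_node_poles_in_ends:
  "spq_node M \<nu> \<Longrightarrow> source M \<nu> \<in> ends M (pert M \<nu>) \<and> sink M \<nu> \<in> ends M (pert M \<nu>)"
proof (induction \<nu>)
  case (QNode p)
  then have "hd p \<in> set p" "last p \<in> set p" by auto
  then show ?case by (auto simp: ends_def)
next
  case (SNode ts)
  have ne: "ts \<noteq> []" and sp: "\<forall>\<mu>\<in>set ts. spq_node M \<mu>" using SNode.prems by auto
  have "source M \<mu> \<in> ends M (pert M (SNode ts)) \<and> sink M \<mu> \<in> ends M (pert M (SNode ts))"
    if "\<mu> \<in> set ts" for \<mu>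
    using SNode.IH[OF that] sp that ends_pert_child[OF that] by auto
  from this[of "hd ts"] this[of "last ts"] show ?case
    using ne by (simp only: source_sink_SNode[OF ne] hd_in_set last_in_set simp_thms)
next
  case (PNode ts)
  have ne: "ts \<noteq> []" and sp: "\<forall>\<mu>\<in>set ts. spq_node M \<mu>" using PNode.prems by auto
  have "source M \<mu> \<in> ends M (pert M (PNode ts)) \<and> sink M \<mu> \<in> ends M (pert M (PNode ts))"
    if "\<mu> \<in> set ts" for \<mu>
    using PNode.IH[OF that] sp that ends_pert_child[OF that] by auto
  from this[of "hd ts"] show ?case
    using ne by (simp only: source_sink_PNode[OF ne] hd_in_set simp_thms)
qed auto

definition proper_node :: "'a spq \<Rightarrow> bool" where
  "proper_node \<nu> \<longleftrightarrow> spq_node M \<nu> \<and> closed_off (pert M \<nu>) (source M \<nu>) (sink M \<nu>)"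

definition represents :: "('v, 'a) piece \<Rightarrow> 'a spq \<Rightarrow> bool" where
  "represents X \<nu> \<longleftrightarrow> valid X \<and> psrc X = source M \<nu> \<and> psnk X = sink M \<nu> \<and> pset X = pert M \<nu>"

text \<open>A vertex of a child that is not one of its poles lies in no other child. So it is not a
  pole of the S-node, all its arcs stay in the S-node, and each of them can only belong to this
  child.\<close>

lemma proper_SNode_child:
  assumes ok: "proper_node (SNode ts)" and i: "i < length ts"
  shows "proper_node (ts ! i)"
proof -
  let ?t = "\<lambda>k. ts ! k" and ?e = "\<lambda>k. ends M (pert M (ts ! k))"
  define s where "s = source M (SNode ts)"
  define t where "t = sink M (SNode ts)"
  have sp: "spq_node M (SNode ts)" and cl: "closed_off (pert M (SNode ts)) s t"
    using ok by (auto simp: proper_node_def s_def t_def)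
  have ne: "ts \<noteq> []" using i by auto
  have node: "spq_node M (?t k)" if "k < length ts" for k using sp that by simp
  have pole: "source M (?t k) \<in> ?e k" "sink M (?t k) \<in> ?e k" if "k < length ts" for k
    using spq_node_poles_in_ends[OF node[OF that]] by auto
  have joint: "sink M (?t k) = source M (?t (Suc k))" if "Suc k < length ts" for k
    using sp that by simp
  have meet: "?e k \<inter> ?e l = (if l = Suc k then {sink M (?t k)} else {})" if "k < l" "l < length ts" for k l
    using sp that by simp
  have st: "s = source M (?t 0)" "t = sink M (?t (length ts - 1))"
    unfolding s_def t_def using ne by (simp_all add: source_sink_SNode hd_conv_nth last_conv_nth del: source.simps sink.simps)
  have "out M w \<subseteq> pert M (?t i)" if w: "w \<in> ?e i - {source M (?t i), sink M (?t i)}" for w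
  proof -
    \<comment> \<open>The source of the S-node lies in child 0. If it also lay in a later child, it
      would be the joint of children 0 and 1, a pole of the latter.\<close>
    have ws: "w \<noteq> s"
    proof
      assume h: "w = s"
      show False
      proof (cases "i = 0")
        case True then show False using w st h by auto
      next
        case False
      then have "w \<in> ?e 0 \<inter> ?e i" using w h st pole[of 0] i ne by auto
      then have "i = Suc 0" "w = sink M (?t 0)" using meet[of 0 i] i False by (auto split: if_splits)
      then show False using w joint[of 0] i by auto
      qed
    qed
    have wt: "w \<noteq> t"
    proof
      assume h: "w = t"
      let ?n = "length ts - 1"
      have "i \<noteq> ?n" using w st h by auto
      then have lt: "i < ?n" "?n < length ts" using i by auto
      then have "w \<in> ?e i \<inter> ?e ?n" using w h st pole[of ?n] by auto
      then show False using w meet[of i ?n] lt by (auto split: if_splits)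
    qed
    have we: "w \<in> ends M (pert M (SNode ts))"
      using w ends_pert_child[of "?t i" ts] i by auto
    then have sub: "out M w \<subseteq> pert M (SNode ts)" using cl ws wt unfolding closed_off_def by blast
    show ?thesis
    proof
      fix a assume a: "a \<in> out M w"
      then have "a \<in> pert M (SNode ts)" using sub by blast
      then obtain \<mu> where "\<mu> \<in> set ts" "a \<in> pert M \<mu>" by auto
      then obtain j where j: "j < length ts" "a \<in> pert M (?t j)" by (metis in_set_conv_nth)
      have wj: "w \<in> ?e j" using a j in_out_iff by (auto simp: ends_def)
      have "\<not> i < j" using meet[of i j] j w wj by (auto split: if_splits)
      moreover have "\<not> j < i"
      proof
        assume "j < i"
        then have "i = Suc j" "w = sink M (?t j)" using meet[of j i] i w wj by (auto split: if_splits)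
        then show False using joint[of j] i w by auto
      qed
      ultimately show "a \<in> pert M (?t i)" using j by (simp add: linorder_neq_iff)
    qed
  qed
  then show ?thesis using node[OF i] by (auto simp: proper_node_def closed_off_def)
qed

text \<open>The missing ingredient is \<open>full\<close>. A joint is not a pole of the S-node,
  since a valid child has distinct poles, so \<open>closed_off\<close> applies; and only the two
  adjacent children contain the joint.\<close>

lemma SNode_series_chain:
  assumes ok: "proper_node (SNode ts)" and rep: "\<forall>\<mu>\<in>set ts. represents (piece_of M \<mu>) \<mu>"
  shows "series_chain (map (piece_of M) ts)"
proof -
  let ?t = "\<lambda>k. ts ! k" and ?e = "\<lambda>k. ends M (pert M (ts ! k))"
  define s where "s = source M (SNode ts)"
  define t where "t = sink M (SNode ts)"
  have sp: "spq_node M (SNode ts)" and cl: "closed_off (pert M (SNode ts)) s t"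
    using ok by (auto simp: proper_node_def s_def t_def)
  have ne: "ts \<noteq> []" using sp by auto
  have node: "spq_node M (?t k)" if "k < length ts" for k using sp that by simp
  have pole: "source M (?t k) \<in> ?e k" "sink M (?t k) \<in> ?e k" if "k < length ts" for k
    using spq_node_poles_in_ends[OF node[OF that]] by auto
  have joint: "sink M (?t k) = source M (?t (Suc k))" if "Suc k < length ts" for k
    using sp that by simp
  have meet: "?e k \<inter> ?e l = (if l = Suc k then {sink M (?t k)} else {})" if "k < l" "l < length ts" for k l
    using sp that by simp
  have st: "s = source M (?t 0)" "t = sink M (?t (length ts - 1))"
    unfolding s_def t_def using ne by (simp_all add: source_sink_SNode hd_conv_nth last_conv_nth del: source.simps sink.simps)
  have r: "valid (piece_of M (?t k))" "psrc (piece_of M (?t k)) = source M (?t k)"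
     "psnk (piece_of M (?t k)) = sink M (?t k)" "pset (piece_of M (?t k)) = pert M (?t k)"
    if "k < length ts" for k
    using rep that by (auto simp: represents_def)
  have neq: "source M (?t k) \<noteq> sink M (?t k)" if "k < length ts" for k
    using validD(1)[OF r(1)[OF that]] r[OF that] by simp
  have full: "out M (sink M (?t i)) \<subseteq> pert M (?t i) \<union> pert M (?t (Suc i))" if i: "Suc i < length ts" for i
  proof -
    define w where "w = sink M (?t i)"
    have wi: "w \<in> ?e i" "w \<in> ?e (Suc i)" using pole[of i] pole[of "Suc i"] joint[OF i] i w_def by auto
    have ws: "w \<noteq> s"
    proof (cases "i = 0")
      case True then show ?thesis using neq[of 0] i st w_def by (metis Suc_lessD)
    next
      case False
      then show ?thesis using meet[of 0 "Suc i"] i wi pole[of 0] st ne by auto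
    qed
    have wt: "w \<noteq> t"
    proof (cases "Suc i = length ts - 1")
      case True then show ?thesis using neq[of "Suc i"] joint[OF i] i st w_def by auto
    next
      case False
      then have "i < length ts - 1" "length ts - 1 < length ts" "length ts - 1 \<noteq> Suc i" using i by auto
      then show ?thesis using meet[of i "length ts - 1"] wi pole(2)[of "length ts - 1"] st by auto
    qed
    have we: "w \<in> ends M (pert M (SNode ts))"
      using wi ends_pert_child[of "?t i" ts] i by auto
    then have sub: "out M w \<subseteq> pert M (SNode ts)" using cl ws wt unfolding closed_off_def by blast
    show ?thesis
    proof
      fix a assume "a \<in> out M (sink M (?t i))"
      then have a: "a \<in> out M w" by (simp add: w_def)
      then have "a \<in> pert M (SNode ts)" using sub by blast
      then obtain \<mu> where "\<mu> \<in> set ts" "a \<in> pert M \<mu>" by auto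
      then obtain j where j: "j < length ts" "a \<in> pert M (?t j)" by (metis in_set_conv_nth)
      have wj: "w \<in> ?e j" using a j in_out_iff by (auto simp: ends_def)
      have "\<not> Suc i < j" using meet[of i j] j wi wj by auto
      moreover have "\<not> j < i" using meet[of j "Suc i"] i wi wj by auto
      ultimately have "j = i \<or> j = Suc i" by auto
      then show "a \<in> pert M (?t i) \<union> pert M (?t (Suc i))" using j by auto
    qed
  qed
  show ?thesis
    by (rule series_chainI) (use ne r joint meet full in \<open>auto simp: in_set_conv_nth simp del: piece_simps\<close>)
qed

lemma proper_PNode_child:
  assumes ok: "proper_node (PNode ts)" and i: "i < length ts"
  shows "proper_node (ts ! i)"
proof -
  let ?t = "\<lambda>k. ts ! k" and ?e = "\<lambda>k. ends M (pert M (ts ! k))"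
  have sp: "spq_node M (PNode ts)" and cl: "closed_off (pert M (PNode ts)) (source M (PNode ts)) (sink M (PNode ts))"
    using ok by (auto simp: proper_node_def)
  have node: "spq_node M (?t i)" "source M (?t i) = source M (PNode ts)" "sink M (?t i) = sink M (PNode ts)"
    using sp i by auto
  have meet: "?e k \<inter> ?e l = {source M (PNode ts), sink M (PNode ts)}" if "k < l" "l < length ts" for k l
    using sp that by simp
  note [simp del] = source.simps sink.simps
  have "out M w \<subseteq> pert M (?t i)" if w: "w \<in> ?e i - {source M (?t i), sink M (?t i)}" for w
  proof
    fix a assume a: "a \<in> out M w"
    have "w \<in> ends M (pert M (PNode ts))" using w ends_pert_child[of "?t i" ts] i by auto
    then have "out M w \<subseteq> pert M (PNode ts)" using cl w node unfolding closed_off_def by auto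
    then have "a \<in> pert M (PNode ts)" using a by blast
    then obtain \<mu> where "\<mu> \<in> set ts" "a \<in> pert M \<mu>" by auto
    then obtain j where j: "j < length ts" "a \<in> pert M (?t j)" by (metis in_set_conv_nth)
    then have wj: "w \<in> ?e j" using a in_out_iff by (auto simp: ends_def)
    have "\<not> i < j" using meet[of i j] j w wj node by auto
    moreover have "\<not> j < i" using meet[of j i] i w wj node by auto
    ultimately show "a \<in> pert M (?t i)" using j by (simp add: linorder_neq_iff)
  qed
  then show ?thesis using node by (auto simp: proper_node_def closed_off_def)
qed

text \<open>\<open>left_to_right\<close> gives the blocks only as sets in a cyclic order. A
  contiguous block of a proper part of the rotation has a unique order, so each block is the fan
  computed for the child.\<close>

lemma concat_eq_fans:
  assumes "list_all2 (\<lambda>b \<mu>. set b = out M v \<inter> pert M \<mu>) bs ts"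
    and "\<forall>\<mu>\<in>set ts. fan v (g \<mu>) (pert M \<mu>)"
    and "rot_chain (concat bs')" "distinct (concat bs')" "set (concat bs') \<subset> out M v"
    and "set bs = set bs'"
  shows "bs = map g ts"
proof -
  have *: "b = g \<mu>" if b: "b \<in> set bs'" "set b = out M v \<inter> pert M \<mu>" "\<mu> \<in> set ts" for b \<mu>
  proof -
    obtain xs ys where "bs' = xs @ b # ys" using split_list[OF b(1)] by auto
    then have "rot_chain b" "distinct b" "set b \<subset> out M v"
      using assms(3,4,5) by (auto simp: successively_append_iff)
    then show ?thesis using assms(2) b by (intro rot_chain_unique) (auto simp: fan_def)
  qed
  have l: "length bs = length ts" using assms(1) by (auto simp: list_all2_conv_all_nth)
  have "bs ! i = g (ts ! i)" if i: "i < length ts" for i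
    using *[of "bs ! i" "ts ! i"] assms(1,6) i l nth_mem[of i bs] nth_mem[of i ts]
    by (auto simp: list_all2_conv_all_nth)
  then show ?thesis using l by (intro nth_equalityI) auto
qed

text \<open>The nonempty lists \<open>os\<close> and \<open>os'\<close> play two roles: they keep
  the blocks from filling the whole rotation, and they supply the outside arcs that
  \<open>parallel_ok\<close> asks for.\<close>

lemma PNode_parallel_chain:
  assumes ok: "proper_node (PNode ts)" and rep: "\<forall>\<mu>\<in>set ts. represents (piece_of M \<mu>) \<mu>"
  shows "parallel_chain (map (piece_of M) ts)"
proof -
  define s where "s = source M (PNode ts)"
  define t where "t = sink M (PNode ts)"
  have sp: "spq_node M (PNode ts)" using ok by (auto simp: proper_node_def)
  have ne: "ts \<noteq> []" using sp by auto
  have r: "valid (piece_of M \<mu>)" "psrc (piece_of M \<mu>) = s" "psnk (piece_of M \<mu>) = t"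
    "pset (piece_of M \<mu>) = pert M \<mu>" if "\<mu> \<in> set ts" for \<mu>
    using rep sp that by (auto simp: represents_def s_def t_def)
  have fs: "\<forall>\<mu>\<in>set ts. fan s (fan_s (piece_of M \<mu>)) (pert M \<mu>)"
    and ft: "\<forall>\<mu>\<in>set ts. fan t (fan_t (piece_of M \<mu>)) (pert M \<mu>)"
    using valid_fans r by metis+
  have l2r: "left_to_right M s t ts" using sp by (simp add: s_def t_def)
  obtain os bs where s1: "os \<noteq> []" "ccw_order M s (os @ concat (rev bs))"
      "list_all2 (\<lambda>b \<mu>. set b = out M s \<inter> pert M \<mu>) bs ts"
    using l2r unfolding left_to_right_def by blast
  obtain os' bs' where t1: "os' \<noteq> []" "ccw_order M t (os' @ concat bs')"
      "list_all2 (\<lambda>b \<mu>. set b = out M t \<inter> pert M \<mu>) bs' ts"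
    using l2r unfolding left_to_right_def by blast
  note cs = ccw_order_chain[OF s1(2)] and ct = ccw_order_chain[OF t1(2)]
  have "os @ concat (rev bs) \<noteq> []" "os' @ concat bs' \<noteq> []" using s1 t1 by auto
  note cs = cs[OF this(1)] and ct = ct[OF this(2)]
  \<comment> \<open>The head of \<open>os\<close> witnesses that the components occupy a proper
    subset of the arcs at each pole.\<close>
  have po: "hd os \<in> out M s - set (concat (rev bs))" "hd os' \<in> out M t - set (concat bs')"
    using cs(3,4) ct(3,4) hd_in_set[OF s1(1)] hd_in_set[OF t1(1)] by auto
  have ps: "set (concat (rev bs)) \<subset> out M s" "set (concat bs') \<subset> out M t"
    using po cs(4) ct(4) unfolding set_append by blast+
  have bs: "bs = map (\<lambda>\<mu>. fan_s (piece_of M \<mu>)) ts"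
    by (rule concat_eq_fans[OF s1(3) fs, of "rev bs"])
      (use cs(1,3) ps(1) in \<open>auto simp: successively_append_iff\<close>)
  have bs': "bs' = map (\<lambda>\<mu>. fan_t (piece_of M \<mu>)) ts"
    by (rule concat_eq_fans[OF t1(3) ft, of bs'])
      (use ct(1,3) ps(2) in \<open>auto simp: successively_append_iff\<close>)
  have "hd ts \<in> set ts" using ne by simp
  have nes: "concat (rev bs) \<noteq> []" "concat bs' \<noteq> []" "fan_s (piece_of M (hd ts)) \<noteq> []"
    using valid_last(7,8)[OF r(1)[OF \<open>hd ts \<in> set ts\<close>]] \<open>hd ts \<in> set ts\<close> unfolding bs bs' by auto
  have lst: "last (concat (rev bs)) = last (fan_s (piece_of M (hd ts)))"
    using ne nes(3) unfolding bs by (cases ts) auto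
  have ends1: "rot M (last (concat bs')) = hd os'" "rot M (last (fan_s (piece_of M (hd ts)))) = hd os"
    using cs(2) ct(2) nes s1(1) t1(1) lst by auto
  have out_notin: "x \<notin> \<Union>(pset ` set (map (piece_of M) ts))" if "x \<in> set os \<or> x \<in> set os'" for x
  proof
    assume "x \<in> \<Union>(pset ` set (map (piece_of M) ts))"
    then obtain \<mu> where m: "\<mu> \<in> set ts" "x \<in> pert M \<mu>" using r by auto
    show False
    proof (cases "x \<in> set os")
      case True
      then have "x \<in> out M s" using cs(4) by auto
      then have "x \<in> set (fan_s (piece_of M \<mu>))" using fs m by (auto simp: fan_def)
      then have "x \<in> set (concat (rev bs))" using m unfolding bs by auto
      then show False using True cs(3) by auto
    next
      case False
      then have x: "x \<in> set os'" using that by simp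
      then have "x \<in> out M t" using ct(4) by auto
      then have "x \<in> set (fan_t (piece_of M \<mu>))" using ft m by (auto simp: fan_def)
      then have "x \<in> set (concat bs')" using m unfolding bs' by auto
      then show False using x ct(3) by auto
    qed
  qed
  show ?thesis
  proof (rule parallel_chainI[where s = s and t = t])
    show "rot_chain (concat (map fan_t (map (piece_of M) ts)))"
      using ct(1) unfolding bs' by (simp add: successively_append_iff comp_def)
    show "rot_chain (concat (rev (map fan_s (map (piece_of M) ts))))"
      using cs(1) unfolding bs by (simp add: successively_append_iff comp_def)
    show "rot M (last (concat (map fan_t (map (piece_of M) ts)))) \<notin> \<Union>(pset ` set (map (piece_of M) ts))"
      using out_notin[of "hd os'"] t1(1) ends1(1) unfolding bs' by (simp add: comp_def)
    show "rot M (last (fan_s (hd (map (piece_of M) ts)))) \<notin> \<Union>(pset ` set (map (piece_of M) ts))"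
      using out_notin[of "hd os"] s1(1) ends1(2) ne by (simp add: hd_map)
    show "\<forall>i j. i < j \<and> j < length (map (piece_of M) ts) \<longrightarrow>
        pset (map (piece_of M) ts ! i) \<inter> pset (map (piece_of M) ts ! j) = {} \<and>
        ends M (pset (map (piece_of M) ts ! i)) \<inter> ends M (pset (map (piece_of M) ts ! j)) = {s, t}"
      using sp r unfolding s_def t_def by simp
  qed (use ne r in auto)
qed

lemma QNode_series_chain:
  assumes "proper_node (QNode p)"
  shows "series_chain (map (edge_piece M) p)"
proof (rule series_chain_path)
  have p: "p \<noteq> []" and ap: "pre_digraph.apath (dgraph M) (src M (hd p)) p (tgt M (last p))"
    and cl: "closed_off (set p \<union> opp M ` set p) (src M (hd p)) (tgt M (last p))"
    using assms by (auto simp: proper_node_def)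
  show "p \<noteq> []" "pre_digraph.apath (dgraph M) (src M (hd p)) p (tgt M (last p))" by fact+
  have d: "distinct (src M (hd p) # map (tgt M) p)"
    using ap awalk_verts_map by (auto simp: pre_digraph.apath_def)
  show "\<forall>w\<in>tgt M ` set (butlast p). out M w \<subseteq> set p \<union> opp M ` set p"
  proof
    fix w assume w: "w \<in> tgt M ` set (butlast p)"
    then have wp: "w \<in> tgt M ` set p" by (auto dest: in_set_butlastD)
    have "distinct (map (tgt M) (butlast p) @ [tgt M (last p)])"
      using d p by (metis append_butlast_last_id distinct.simps(2) list.simps(8,9) map_append)
    then have "tgt M (last p) \<notin> tgt M ` set (butlast p)" by simp
    then have "w \<noteq> tgt M (last p)" using w by metis
    moreover have "w \<noteq> src M (hd p)" using d wp by (metis distinct.simps(2) list.set_map)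
    moreover have "w \<in> ends M (set p \<union> opp M ` set p)" using wp by (auto simp: ends_def)
    ultimately show "out M w \<subseteq> set p \<union> opp M ` set p" using cl by (auto simp: closed_off_def)
  qed
qed

text \<open>Properness passes down to the children, validity comes back up through the
  compositions.\<close>

lemma represents_piece_of: "proper_node \<nu> \<Longrightarrow> represents (piece_of M \<nu>) \<nu>"
proof (induction \<nu>)
  case (QNode p)
  then have p: "p \<noteq> []" by (simp add: proper_node_def)
  show ?case using valid_series_chain[OF QNode_series_chain[OF QNode]] p
      fold_ser[of "map (edge_piece M) p"] by (auto simp: represents_def hd_map last_map)
next
  case (SNode ts)
  have rep: "\<forall>\<mu>\<in>set ts. represents (piece_of M \<mu>) \<mu>"
  proof
    fix \<mu> assume m: "\<mu> \<in> set ts"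
    then obtain i where "i < length ts" "ts ! i = \<mu>" by (auto simp: in_set_conv_nth)
    then show "represents (piece_of M \<mu>) \<mu>"
      using SNode.IH[OF m] proper_SNode_child[OF SNode.prems] by auto
  qed
  have ne: "ts \<noteq> []" using SNode.prems by (auto simp: proper_node_def)
  have h: "hd ts \<in> set ts" "last ts \<in> set ts" using ne by auto
  show ?case
    using valid_series_chain[OF SNode_series_chain[OF SNode.prems rep]] ne h rep
      fold_ser[of "map (piece_of M) ts"]
    by (simp add: represents_def hd_map last_map del: piece_simps)
next
  case (PNode ts)
  have rep: "\<forall>\<mu>\<in>set ts. represents (piece_of M \<mu>) \<mu>"
  proof
    fix \<mu> assume m: "\<mu> \<in> set ts"
    then obtain i where "i < length ts" "ts ! i = \<mu>" by (auto simp: in_set_conv_nth)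
    then show "represents (piece_of M \<mu>) \<mu>"
      using PNode.IH[OF m] proper_PNode_child[OF PNode.prems] by auto
  qed
  have ne: "ts \<noteq> []" using PNode.prems by (auto simp: proper_node_def)
  have h: "hd ts \<in> set ts" using ne by auto
  show ?case
    using valid_parallel_chain[OF PNode_parallel_chain[OF PNode.prems rep]] ne h rep
      fold_par[of "map (piece_of M) ts"]
    by (simp add: represents_def hd_map last_map del: piece_simps)
qed (simp add: proper_node_def)

section \<open>Local representations and turns\<close>

text \<open>The angle sum of 360 degrees in turns: 2 for each angle, minus 360/90. The turn -2 of a
  full angle is left out, because owned vertices have degree at least two.\<close>

definition good :: "('a \<Rightarrow> int) \<Rightarrow> 'v \<Rightarrow> bool" where
  "good \<theta> v \<longleftrightarrow> (\<forall>x\<in>out M v. \<theta> x \<in> {-1, 0, 1}) \<and> (\<Sum>x\<in>out M v. \<theta> x) = 2 * int (card (out M v)) - 4"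

text \<open>The face to the right of \<open>a\<close> has its angle at the head of \<open>a\<close>
  between \<open>opp M a\<close> and its successor, so the turn is stored at
  \<open>opp M a\<close>.\<close>

definition face_sum :: "('a \<Rightarrow> int) \<Rightarrow> 'a list \<Rightarrow> int" where
  "face_sum \<theta> xs = (\<Sum>a\<leftarrow>xs. \<theta> (opp M a))"

definition local_rep :: "('v, 'a) piece \<Rightarrow> ('a \<Rightarrow> int) \<Rightarrow> bool" where
  "local_rep X \<theta> \<longleftrightarrow> (\<forall>v\<in>own X. good \<theta> v) \<and> (\<forall>f\<in>inner X. face_sum \<theta> f = 4)"

text \<open>The two summands behind the walk are the right outer angles at sink and source. They
  count only when the pole is owned, so the turn depends on owned vertices alone.\<close>

definition turn_r :: "('v, 'a) piece \<Rightarrow> ('a \<Rightarrow> int) \<Rightarrow> int" where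
  "turn_r X \<theta> = face_sum \<theta> (butlast (rbd X)) +
     (if 2 \<le> length (fan_t X) then \<theta> (last (fan_t X)) else 0) +
     (if 2 \<le> length (fan_s X) then \<theta> (pred (hd (fan_s X))) else 0)"

definition turn_l :: "('v, 'a) piece \<Rightarrow> ('a \<Rightarrow> int) \<Rightarrow> int" where
  "turn_l X \<theta> = face_sum \<theta> (butlast (lbd X)) +
     (if 2 \<le> length (fan_s X) then \<theta> (last (fan_s X)) else 0) +
     (if 2 \<le> length (fan_t X) then \<theta> (pred (hd (fan_t X))) else 0)"

text \<open>At a pole of indegree and outdegree two there are three outer angles. The right and left
  turn see two of them; the third, between the outside arcs, shifts their sum by one.\<close>

definition full_pole :: "'v \<Rightarrow> 'a list \<Rightarrow> int" where
  "full_pole v xs = (if length xs = 2 \<and> card (out M v) = 4 then 1 else 0)"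

definition full_poles :: "('v, 'a) piece \<Rightarrow> int" where
  "full_poles X = full_pole (psrc X) (fan_s X) + full_pole (psnk X) (fan_t X)"

definition achieves :: "('v, 'a) piece \<Rightarrow> int \<Rightarrow> bool" where
  "achieves X x \<longleftrightarrow> (\<exists>\<theta>. local_rep X \<theta> \<and> turn_r X \<theta> = x)"

text \<open>Total turning around the outside: with one outside arc at each owned pole the right and
  left turn cancel, and each full pole adds 1.\<close>

definition balanced :: "('v, 'a) piece \<Rightarrow> bool" where
  "balanced X \<longleftrightarrow> (\<forall>\<theta>. local_rep X \<theta> \<longrightarrow> turn_r X \<theta> + turn_l X \<theta> = full_poles X)"

lemma face_sum_simps [simp]:
  "face_sum \<theta> [] = 0" "face_sum \<theta> (a # xs) = \<theta> (opp M a) + face_sum \<theta> xs"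
  "face_sum \<theta> (xs @ ys) = face_sum \<theta> xs + face_sum \<theta> ys"
  by (simp_all add: face_sum_def)

lemma face_sum_butlast: "xs \<noteq> [] \<Longrightarrow> face_sum \<theta> xs = face_sum \<theta> (butlast xs) + \<theta> (opp M (last xs))"
  by (cases xs rule: rev_cases) auto

lemma outD: "x \<in> out M v \<Longrightarrow> x \<in> darts M" "x \<in> out M v \<Longrightarrow> src M x = v"
  "x \<in> out M v \<Longrightarrow> v \<in> vertices M"
  using in_out_iff[of x v] src_vertex[of x] by auto

lemma rot_surj: "x \<in> out M v \<Longrightarrow> \<exists>y\<in>out M v. rot M y = x"
proof -
  assume x: "x \<in> out M v"
  have "inj_on (rot M) (out M v)" using rot_inj in_out_iff by (meson inj_on_subset subsetI)
  then have "rot M ` out M v = out M v"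
    by (intro endo_inj_surj) (auto intro: rot_out)
  then show ?thesis using x by (metis imageE)
qed

lemma pred_out: "x \<in> out M v \<Longrightarrow> pred x \<in> out M v \<and> rot M (pred x) = x"
  using rot_surj[of x v] pred_rot in_out_iff by metis

text \<open>Four turns of at most 1 that sum to 4 leave no slack.\<close>

lemma good_full:
  assumes "good \<theta> v" "4 \<le> card (out M v)" "x \<in> out M v"
  shows "\<theta> x = 1"
proof (rule ccontr)
  assume "\<theta> x \<noteq> 1"
  moreover have "\<theta> x \<in> {-1, 0, 1}" using assms(1,3) unfolding good_def by blast
  ultimately have lt: "\<theta> x < 1" by auto
  have "v \<in> vertices M" using assms(3) outD(3) by metis
  then have c: "card (out M v) = 4" using degree_le_4 assms(2) by (simp add: le_antisym)
  have "(\<Sum>y\<in>out M v. \<theta> y) < (\<Sum>y\<in>out M v. 1)"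
    using assms(1,3) lt by (intro sum_strict_mono_ex1) (auto simp: good_def)
  then show False using assms(1) c by (simp add: good_def)
qed

lemma good_fullI:
  assumes "card (out M v) = 4" "\<And>x. x \<in> out M v \<Longrightarrow> \<theta> x = 1"
  shows "good \<theta> v"
  using assms by (simp add: good_def)

section \<open>Changing and gluing local representations\<close>

definition agree :: "'v set \<Rightarrow> ('a \<Rightarrow> int) \<Rightarrow> ('a \<Rightarrow> int) \<Rightarrow> bool" where
  "agree W \<theta> \<theta>' \<longleftrightarrow> (\<forall>v\<in>W. \<forall>x\<in>out M v. \<theta> x = \<theta>' x)"

lemma agree_good: "agree W \<theta> \<theta>' \<Longrightarrow> v \<in> W \<Longrightarrow> good \<theta> v \<longleftrightarrow> good \<theta>' v"
  by (simp add: agree_def good_def)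

lemma agree_face_sum:
  assumes "agree W \<theta> \<theta>'" "tgt M ` set f \<subseteq> W" "set f \<subseteq> darts M"
  shows "face_sum \<theta> f = face_sum \<theta>' f"
proof -
  have "\<theta> (opp M a) = \<theta>' (opp M a)" if "a \<in> set f" for a
  proof -
    have "a \<in> darts M" "tgt M a \<in> W" using that assms(2,3) by auto
    moreover from this have "opp M a \<in> out M (tgt M a)" unfolding in_out_iff by simp
    ultimately show ?thesis using assms(1) unfolding agree_def by blast
  qed
  then show ?thesis by (simp add: face_sum_def cong: map_cong)
qed

lemma agree_local_rep:
  assumes "valid X" "agree (own X) \<theta> \<theta>'"
  shows "local_rep X \<theta> \<longleftrightarrow> local_rep X \<theta>'"
proof -
  have "face_sum \<theta> f = face_sum \<theta>' f" if "f \<in> inner X" for f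
    using that valid_inner(2)[OF assms(1)] validD(2)[OF assms(1)]
    by (intro agree_face_sum[OF assms(2)]) auto
  then show ?thesis using agree_good[OF assms(2)] by (simp add: local_rep_def)
qed

lemma fan_pred: "fan v xs A \<Longrightarrow> pred (hd xs) \<in> out M v"
  using pred_out fan_hd in_out_iff by metis

lemma fan_last_out: "fan v xs A \<Longrightarrow> last xs \<in> out M v"
  using fan_last in_out_iff by metis

text \<open>The walk meets owned vertices before its last head, and a pole enters the turn only if
  it is owned.\<close>

lemma agree_turn_r:
  assumes X: "valid X" and a: "agree (own X) \<theta> \<theta>'"
  shows "turn_r X \<theta> = turn_r X \<theta>'"
proof -
  note f = valid_fans[OF X]
  have "boundary (rbd X) (pset X) (own X)" by (rule valid_boundaries[OF X])
  then have "face_sum \<theta> (butlast (rbd X)) = face_sum \<theta>' (butlast (rbd X))"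
    using validD(2)[OF X] by (intro agree_face_sum[OF a]) (auto simp: boundary_def dest: in_set_butlastD)
  then show ?thesis
    using a valid_own(3,4)[OF X] fan_pred[OF f(1)] fan_last_out[OF f(2)]
    by (auto simp: turn_r_def agree_def)
qed

text \<open>On vertices owned by both pieces degree four forces all turns to be 1 on either side.
  \<open>\<theta>0\<close> prescribes the turns where neither piece has a say.\<close>

lemma glue:
  assumes r1: "local_rep X \<theta>1" and r2: "local_rep Y \<theta>2"
    and full: "\<And>v. v \<in> own X \<Longrightarrow> v \<in> own Y \<Longrightarrow> 4 \<le> card (out M v)"
  shows "\<exists>\<theta>. agree (own X) \<theta> \<theta>1 \<and> agree (own Y) \<theta> \<theta>2 \<and>
    (\<forall>a. src M a \<notin> own X \<union> own Y \<longrightarrow> \<theta> a = \<theta>0 a)"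
proof -
  define \<theta> where "\<theta> a = (if src M a \<in> own X then \<theta>1 a else if src M a \<in> own Y then \<theta>2 a else \<theta>0 a)" for a
  have "agree (own X) \<theta> \<theta>1" unfolding agree_def \<theta>_def using outD(2) by simp
  moreover have "agree (own Y) \<theta> \<theta>2"
    unfolding agree_def
  proof (intro ballI)
    fix v x assume v: "v \<in> own Y" and x: "x \<in> out M v"
    have sx: "src M x = v" using x outD(2) by metis
    show "\<theta> x = \<theta>2 x"
    proof (cases "v \<in> own X")
      case True
      then have "good \<theta>1 v" "good \<theta>2 v" using r1 r2 v by (auto simp: local_rep_def)
      then have "\<theta>1 x = 1" "\<theta>2 x = 1" using good_full full[OF True v] x by blast+
      then show ?thesis using True sx by (simp add: \<theta>_def)
    next
      case False then show ?thesis using v sx by (simp add: \<theta>_def)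
    qed
  qed
  moreover have "\<forall>a. src M a \<notin> own X \<union> own Y \<longrightarrow> \<theta> a = \<theta>0 a" by (simp add: \<theta>_def)
  ultimately show ?thesis by blast
qed

text \<open>The composed walk passes the joint once. \<open>c\<close> is this one pass minus the
  number of components that have already counted it, hence 1, 0 or -1.\<close>

lemma series_turn:
  assumes ok: "series_ok X Y"
  defines "c \<equiv> 1 - (if 2 \<le> length (fan_t X) then 1 else 0) - (if 2 \<le> length (fan_s Y) then 1 else 0)"
  shows "turn_r (ser X Y) \<theta> = turn_r X \<theta> + turn_r Y \<theta> + \<theta> (last (fan_t X)) * c"
    and "turn_l (ser X Y) \<theta> = turn_l X \<theta> + turn_l Y \<theta> + \<theta> (last (fan_s Y)) * c"
proof -
  have X: "valid X" and Y: "valid Y" using ok by (auto simp: series_ok_def)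
  note lX = valid_last[OF X] and lY = valid_last[OF Y]
  have d: "last (fan_t X) \<in> darts M" "last (fan_s Y) \<in> darts M"
    using fan_last valid_fans X Y by blast+
  have p: "pred (hd (fan_s Y)) = last (fan_t X)" "pred (hd (fan_t X)) = last (fan_s Y)"
    using series_rot(3,4)[OF ok] pred_rot d by metis+
  have b: "face_sum \<theta> (butlast (rbd X @ rbd Y)) =
      face_sum \<theta> (butlast (rbd X)) + \<theta> (last (fan_t X)) + face_sum \<theta> (butlast (rbd Y))"
    "face_sum \<theta> (butlast (lbd Y @ lbd X)) =
      face_sum \<theta> (butlast (lbd Y)) + \<theta> (last (fan_s Y)) + face_sum \<theta> (butlast (lbd X))"
    using lX lY valid_boundaries[OF X] valid_boundaries[OF Y]
      face_sum_butlast[of "rbd X" \<theta>] face_sum_butlast[of "lbd Y" \<theta>]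
    by (simp_all add: butlast_append)
  show "turn_r (ser X Y) \<theta> = turn_r X \<theta> + turn_r Y \<theta> + \<theta> (last (fan_t X)) * c"
    unfolding turn_r_def ser_def piece.simps b p c_def by simp
  show "turn_l (ser X Y) \<theta> = turn_l X \<theta> + turn_l Y \<theta> + \<theta> (last (fan_s Y)) * c"
    unfolding turn_l_def ser_def piece.simps b p c_def by simp
qed

lemma length_one: "length xs = 1 \<Longrightarrow> xs = [last xs]"
  by (cases xs) auto

lemma series_degree:
  assumes ok: "series_ok X Y"
  shows "card (out M (psnk X)) = length (fan_t X) + length (fan_s Y)"
    and "length (fan_t X) + length (fan_s Y) \<le> 4"
    and "1 \<le> length (fan_t X)" "1 \<le> length (fan_s Y)"
proof -
  have X: "valid X" and Y: "valid Y" and w: "psrc Y = psnk X" using ok by (auto simp: series_ok_def)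
  have d: "distinct (fan_t X)" "distinct (fan_s Y)"
    using valid_fans[OF X] valid_fans[OF Y] by (auto simp: fan_def)
  show c: "card (out M (psnk X)) = length (fan_t X) + length (fan_s Y)"
    using series_rot(1,2)[OF ok] d by (metis List.finite_set card_Un_disjoint distinct_card)
  have "psnk X \<in> vertices M" using valid_last(1,3)[OF X] tgt_vertex by metis
  from degree_le_4[OF this] c show "length (fan_t X) + length (fan_s Y) \<le> 4" by simp
  show "1 \<le> length (fan_t X)" "1 \<le> length (fan_s Y)"
    using valid_last[OF X] valid_last[OF Y] by (simp_all add: Suc_le_eq)
qed

text \<open>What the joint adds to the turns of the parts: a free bend at a joint of degree two,
  nothing if exactly one part counts it, and -1 if both count the forced right angle.\<close>

definition joint_turn :: "nat \<Rightarrow> nat \<Rightarrow> int \<Rightarrow> bool" where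
  "joint_turn k l j \<longleftrightarrow> (if k = 1 \<and> l = 1 then j \<in> {-1, 0, 1} else if 2 \<le> k \<and> 2 \<le> l then j = -1 else j = 0)"

text \<open>The second claim is the contribution to balance: at degree two the two turns are
  opposite, and at degree four with two arcs on each side both corrections are -1, which makes up
  for two full poles that become interior.\<close>

lemma series_joint:
  assumes ok: "series_ok X Y" and g: "good \<theta> (psnk X)"
  defines "c \<equiv> 1 - (if 2 \<le> length (fan_t X) then 1 else 0) - (if 2 \<le> length (fan_s Y) then 1 else 0)"
  shows "joint_turn (length (fan_t X)) (length (fan_s Y)) (\<theta> (last (fan_t X)) * c)" (is ?J)
    and "\<theta> (last (fan_t X)) * c + \<theta> (last (fan_s Y)) * c =
      full_pole (psnk Y) (fan_t Y) + full_pole (psrc X) (fan_s X) - full_poles X - full_poles Y" (is ?K)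
proof -
  have X: "valid X" and Y: "valid Y" and w: "psrc Y = psnk X" using ok by (auto simp: series_ok_def)
  note d = series_degree[OF ok]
  have l: "last (fan_t X) \<in> out M (psnk X)" "last (fan_s Y) \<in> out M (psnk X)"
    using fan_last_out valid_fans X Y w by metis+
  consider (1) "length (fan_t X) = 1" "length (fan_s Y) = 1"
    | (2) "length (fan_t X) = 2" "length (fan_s Y) = 2"
    | (3) "length (fan_t X) = 1" "2 \<le> length (fan_s Y)"
    | (4) "2 \<le> length (fan_t X)" "length (fan_s Y) = 1" using d by linarith
  then have "?J \<and> ?K"
  proof cases
    case 1
    have o: "out M (psnk X) = {last (fan_t X), last (fan_s Y)}"
      using series_rot(1)[OF ok] length_one[OF 1(1)] length_one[OF 1(2)] by (metis list.set(1,2) insert_is_Un)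
    have "last (fan_t X) \<noteq> last (fan_s Y)" using o d(1) 1 by (auto simp: card_insert_if split: if_splits)
    then have "\<theta> (last (fan_t X)) + \<theta> (last (fan_s Y)) = 0" using g o by (simp add: good_def)
    moreover have "\<theta> (last (fan_t X)) \<in> {-1, 0, 1}" using g l by (auto simp: good_def)
    ultimately show ?thesis using 1 w d(1) by (auto simp: c_def joint_turn_def full_poles_def full_pole_def)
  next
    case 2
    have "\<theta> (last (fan_t X)) = 1" "\<theta> (last (fan_s Y)) = 1" using good_full[OF g] l d 2 by auto
    then show ?thesis using 2 w d(1) by (auto simp: c_def joint_turn_def full_poles_def full_pole_def)
  next
    case 3
    then show ?thesis using w d(1) by (auto simp: c_def joint_turn_def full_poles_def full_pole_def)
  next
    case 4
    then show ?thesis using w d(1) by (auto simp: c_def joint_turn_def full_poles_def full_pole_def)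
  qed
  then show ?J ?K by auto
qed

lemma local_rep_ser:
  "local_rep (ser X Y) \<theta> \<longleftrightarrow> local_rep X \<theta> \<and> local_rep Y \<theta> \<and> good \<theta> (psnk X)"
  by (auto simp: local_rep_def)

lemma balanced_ser:
  assumes ok: "series_ok X Y" and "balanced X" "balanced Y"
  shows "balanced (ser X Y)"
  unfolding balanced_def
proof (intro allI impI)
  fix \<theta> assume r: "local_rep (ser X Y) \<theta>"
  then have "turn_r X \<theta> + turn_l X \<theta> = full_poles X" "turn_r Y \<theta> + turn_l Y \<theta> = full_poles Y"
    using assms by (auto simp: local_rep_ser balanced_def simp del: piece_simps)
  then show "turn_r (ser X Y) \<theta> + turn_l (ser X Y) \<theta> = full_poles (ser X Y)"
    using series_turn[OF ok, of \<theta>] series_joint(2)[OF ok, of \<theta>] r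
    unfolding local_rep_ser full_poles_def[of "ser X Y"] by (simp add: ser_def)
qed

text \<open>Conversely, representations of the parts are glued; a vertex owned by both is a joint
  with two arcs from each side, so it has degree four.\<close>

lemma achieves_ser:
  assumes ok: "series_ok X Y"
  shows "achieves (ser X Y) x \<longleftrightarrow> (\<exists>y z j. achieves X y \<and> achieves Y z \<and>
    joint_turn (length (fan_t X)) (length (fan_s Y)) j \<and> x = y + z + j)"
proof
  assume "achieves (ser X Y) x"
  then obtain \<theta> where r: "local_rep X \<theta>" "local_rep Y \<theta>" "good \<theta> (psnk X)" "turn_r (ser X Y) \<theta> = x"
    unfolding achieves_def local_rep_ser by blast
  show "\<exists>y z j. achieves X y \<and> achieves Y z \<and>
      joint_turn (length (fan_t X)) (length (fan_s Y)) j \<and> x = y + z + j"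
    using series_turn(1)[OF ok, of \<theta>] series_joint(1)[OF ok r(3)] r unfolding achieves_def by blast
next
  assume "\<exists>y z j. achieves X y \<and> achieves Y z \<and>
    joint_turn (length (fan_t X)) (length (fan_s Y)) j \<and> x = y + z + j"
  then obtain \<theta>1 \<theta>2 j where r1: "local_rep X \<theta>1" and r2: "local_rep Y \<theta>2"
    and j: "joint_turn (length (fan_t X)) (length (fan_s Y)) j"
    and x: "x = turn_r X \<theta>1 + turn_r Y \<theta>2 + j"
    unfolding achieves_def by blast
  have X: "valid X" and Y: "valid Y" and w: "psrc Y = psnk X"
    and e: "ends M (pset X) \<inter> ends M (pset Y) = {psnk X}" using ok by (auto simp: series_ok_def)
  note d = series_degree[OF ok]
  \<comment> \<open>At a joint of degree two the turns must sum to 0, so the second arc gets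
    \<open>- j\<close>.\<close>
  define \<theta>0 where "\<theta>0 = (\<lambda>a. if a = last (fan_t X) then j else - j)"
  have full: "4 \<le> card (out M v)" if v: "v \<in> own X" "v \<in> own Y" for v
  proof -
    have "v = psnk X" using v valid_own(1)[OF X] valid_own(1)[OF Y] e by blast
    then have "2 \<le> length (fan_t X)" "2 \<le> length (fan_s Y)"
      using v valid_own(4)[OF X] valid_own(3)[OF Y] w by auto
    then show ?thesis using d \<open>v = psnk X\<close> by simp
  qed
  obtain \<theta> where t: "agree (own X) \<theta> \<theta>1" "agree (own Y) \<theta> \<theta>2"
    "\<forall>a. src M a \<notin> own X \<union> own Y \<longrightarrow> \<theta> a = \<theta>0 a" using glue[OF r1 r2 full] by blast
  have rX: "local_rep X \<theta>" and rY: "local_rep Y \<theta>"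
    using agree_local_rep X Y t r1 r2 by blast+
  have owX: "psnk X \<in> own X \<longleftrightarrow> 2 \<le> length (fan_t X)" and owY: "psnk X \<in> own Y \<longleftrightarrow> 2 \<le> length (fan_s Y)"
    using valid_own(4)[OF X] valid_own(3)[OF Y] w by auto
  have gw: "good \<theta> (psnk X) \<and> (length (fan_t X) = 1 \<and> length (fan_s Y) = 1 \<longrightarrow> \<theta> (last (fan_t X)) = j)"
  proof (cases "length (fan_t X) = 1 \<and> length (fan_s Y) = 1")
    case True
    then have n: "psnk X \<notin> own X \<union> own Y" using owX owY by auto
    have o: "out M (psnk X) = {last (fan_t X), last (fan_s Y)}"
      using series_rot(1)[OF ok] length_one[of "fan_t X"] length_one[of "fan_s Y"] True
      by (metis list.set(1,2) insert_is_Un)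
    have ne: "last (fan_t X) \<noteq> last (fan_s Y)" using o d(1) True by (auto simp: card_insert_if split: if_splits)
    have sr: "src M (last (fan_t X)) = psnk X" "src M (last (fan_s Y)) = psnk X"
      using o in_out_iff by auto
    have v: "\<theta> (last (fan_t X)) = j" "\<theta> (last (fan_s Y)) = - j"
      using t(3) n sr ne by (auto simp: \<theta>0_def)
    have jj: "j \<in> {-1, 0, 1}" using j True by (auto simp: joint_turn_def)
    show ?thesis unfolding good_def o using v ne jj by auto
  next
    case False
    then have "psnk X \<in> own X \<or> psnk X \<in> own Y" using owX owY d by linarith
    then show ?thesis using rX rY False by (auto simp: local_rep_def)
  qed
  have tr: "turn_r X \<theta> = turn_r X \<theta>1" "turn_r Y \<theta> = turn_r Y \<theta>2" using agree_turn_r X Y t by blast+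
  define c :: int where "c = 1 - (if 2 \<le> length (fan_t X) then 1 else 0) - (if 2 \<le> length (fan_s Y) then 1 else 0)"
  have "joint_turn (length (fan_t X)) (length (fan_s Y)) (\<theta> (last (fan_t X)) * c)"
    using series_joint(1)[OF ok conjunct1[OF gw]] unfolding c_def .
  \<comment> \<open>Except at a joint of degree two, where the turn was chosen to be
    \<open>j\<close>, \<open>joint_turn\<close> allows only one value.\<close>
  then have "\<theta> (last (fan_t X)) * c = j" using j gw by (auto simp: joint_turn_def c_def split: if_splits)
  then have "turn_r (ser X Y) \<theta> = x"
    using series_turn(1)[OF ok, of \<theta>] x tr unfolding c_def by simp
  then show "achieves (ser X Y) x" using rX rY gw unfolding achieves_def local_rep_ser by blast
qed

lemma edge_achieves: "achieves (edge_piece M a) x \<longleftrightarrow> x = 0"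
  by (auto simp: achieves_def local_rep_def turn_r_def)

lemma edge_balanced: "balanced (edge_piece M a)"
  by (auto simp: balanced_def turn_r_def turn_l_def full_poles_def full_pole_def)

section \<open>Parallel composition\<close>

text \<open>Two consecutive fans followed by an outside arc. At the sink the left component comes
  first, at the source the right one, so a single analysis serves both poles with the roles
  exchanged.\<close>

definition flank :: "'v \<Rightarrow> 'a list \<Rightarrow> 'a list \<Rightarrow> bool" where
  "flank v xs ys \<longleftrightarrow> xs \<noteq> [] \<and> ys \<noteq> [] \<and> distinct (xs @ ys) \<and> set (xs @ ys) \<subseteq> out M v \<and>
     rot M (last xs) = hd ys \<and> rot M (last ys) \<notin> set (xs @ ys)"

lemma parallel_flank:
  assumes ok: "parallel_ok X Y"
  shows "flank (psnk X) (fan_t X) (fan_t Y)" "flank (psrc X) (fan_s Y) (fan_s X)"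
proof -
  have X: "valid X" and Y: "valid Y" and w: "psrc Y = psrc X" "psnk Y = psnk X"
    and dj: "pset X \<inter> pset Y = {}"
    and r: "rot M (last (fan_t X)) = hd (fan_t Y)" "rot M (last (fan_s Y)) = hd (fan_s X)"
      "rot M (last (fan_t Y)) \<notin> pset X \<union> pset Y" "rot M (last (fan_s X)) \<notin> pset X \<union> pset Y"
    using ok unfolding parallel_ok_def by blast+
  have f: "fan (psrc X) (fan_s X) (pset X)" "fan (psnk X) (fan_t X) (pset X)"
    "fan (psrc X) (fan_s Y) (pset Y)" "fan (psnk X) (fan_t Y) (pset Y)"
    using valid_fans[OF X] valid_fans[OF Y] w by auto
  show "flank (psnk X) (fan_t X) (fan_t Y)"
    using f(2,4) r(1,3) dj unfolding flank_def fan_def distinct_append set_append by blast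
  show "flank (psrc X) (fan_s Y) (fan_s X)"
    using f(1,3) r(2,4) dj unfolding flank_def fan_def distinct_append set_append by blast
qed

lemma flank_degree:
  assumes "flank v xs ys"
  shows "length xs + length ys + 1 \<le> card (out M v)" "card (out M v) \<le> 4"
    "1 \<le> length xs" "1 \<le> length ys"
proof -
  have l: "last ys \<in> out M v" using assms last_in_set[of ys] unfolding flank_def set_append by blast
  then have "rot M (last ys) \<in> out M v" by (rule rot_out)
  then have "insert (rot M (last ys)) (set (xs @ ys)) \<subseteq> out M v"
    using assms unfolding flank_def by blast
  then have "card (insert (rot M (last ys)) (set (xs @ ys))) \<le> card (out M v)"
    by (intro card_mono) auto
  moreover have "card (insert (rot M (last ys)) (set (xs @ ys))) = length xs + length ys + 1"
    using assms distinct_card[of "xs @ ys"] unfolding flank_def by (subst card_insert_disjoint) auto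
  ultimately show "length xs + length ys + 1 \<le> card (out M v)" by simp
  show "card (out M v) \<le> 4" using degree_le_4[OF outD(3)[OF l]] .
  show "1 \<le> length xs" "1 \<le> length ys" using assms by (auto simp: flank_def Suc_le_eq)
qed

text \<open>With one arc per component only one outside arc \<open>z\<close> is left. The rotation
  must lead from \<open>z\<close> back to \<open>xs\<close>, so \<open>z\<close> is the predecessor
  of its head.\<close>

lemma flank_degree3:
  assumes f: "flank v xs ys" and c: "card (out M v) = 3"
  shows "length xs = 1" "length ys = 1" "out M v = {last xs, last ys, pred (hd xs)}"
    "last xs \<noteq> last ys" "last xs \<noteq> pred (hd xs)" "last ys \<noteq> pred (hd xs)"
proof -
  show l: "length xs = 1" "length ys = 1" using flank_degree[OF f] c by auto
  define x y z where "x = last xs" and "y = last ys" and "z = rot M (last ys)"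
  have xs: "xs = [x]" and ys: "ys = [y]" using l length_one x_def y_def by auto
  have xy: "x \<in> out M v" "y \<in> out M v" "x \<noteq> y" "rot M x = y" "z \<noteq> x" "z \<noteq> y"
    using f unfolding flank_def xs ys z_def by auto
  have z: "z \<in> out M v" using rot_out[OF xy(2)] by (simp add: y_def z_def)
  have "{x, y, z} \<subseteq> out M v" "card {x, y, z} = 3" using xy z by auto
  then have o: "out M v = {x, y, z}" using c by (metis card_subset_eq finite_out)
  have d: "x \<in> darts M" "y \<in> darts M" "z \<in> darts M" using outD(1)[OF xy(1)] outD(1)[OF xy(2)] outD(1)[OF z] by auto
  have "rot M z \<in> {x, y, z}" using rot_out[OF z] o by simp
  moreover have "rot M z \<noteq> y" using rot_eqD[of z x] xy d by auto
  moreover have "rot M z \<noteq> z" using rot_eqD[of z y] xy d z_def y_def by auto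
  ultimately have "rot M z = x" by blast
  then have "pred (hd xs) = z" using pred_rot d xs by auto
  then show "out M v = {last xs, last ys, pred (hd xs)}" "last xs \<noteq> last ys"
    "last xs \<noteq> pred (hd xs)" "last ys \<noteq> pred (hd xs)"
    using o xy x_def y_def by auto
qed

lemma flank_mem:
  assumes f: "flank v xs ys"
  shows "last xs \<in> out M v" "last ys \<in> out M v" "pred (hd xs) \<in> out M v"
proof -
  have "last xs \<in> set xs" "last ys \<in> set ys" "hd xs \<in> set xs" using f by (auto simp: flank_def)
  then show "last xs \<in> out M v" "last ys \<in> out M v" "pred (hd xs) \<in> out M v"
    using f pred_out[of "hd xs" v] unfolding flank_def set_append by blast+
qed

text \<open>The pair \<open>(\<rho>, \<eta>)\<close> records what a pole adds to the turn along the right boundary and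
  to the turn around the face between the two components, beyond what the components count.\<close>

definition pole_turn :: "nat \<Rightarrow> nat \<Rightarrow> nat \<Rightarrow> int \<Rightarrow> int \<Rightarrow> bool" where
  "pole_turn k l d \<rho> \<eta> \<longleftrightarrow>
     (if d = 3 then \<rho> \<in> {0, 1} \<and> \<eta> \<in> {0, 1} \<and> 1 \<le> \<rho> + \<eta>
      else \<rho> = (if 2 \<le> l then 0 else 1) \<and> \<eta> = (if 2 \<le> k \<or> 2 \<le> l then 0 else 1))"

text \<open>1 exactly when a component with so many arcs at the pole leaves the pole out of its own
  turns.\<close>

definition weight :: "nat \<Rightarrow> int" where
  "weight k = (if 2 \<le> k then 0 else 1)"

text \<open>At degree three the turns sum to 2 and are at most 1, so none of them is
  negative.\<close>

lemma flank_good: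
  assumes f: "flank v xs ys" and g: "good \<theta> v"
  shows "(card (out M v) = 3 \<and> \<theta> (last xs) \<in> {0, 1} \<and> \<theta> (last ys) \<in> {0, 1} \<and> \<theta> (pred (hd xs)) \<in> {0, 1} \<and>
      \<theta> (last xs) + \<theta> (last ys) + \<theta> (pred (hd xs)) = 2) \<or>
    (card (out M v) = 4 \<and> \<theta> (last xs) = 1 \<and> \<theta> (last ys) = 1 \<and> \<theta> (pred (hd xs)) = 1)"
proof -
  note d = flank_degree[OF f]
  consider "card (out M v) = 3" | "card (out M v) = 4" using d by linarith
  then show ?thesis
  proof cases
    case 1
    note t = flank_degree3[OF f 1]
    have "\<theta> (last xs) + \<theta> (last ys) + \<theta> (pred (hd xs)) = 2"
      using g 1 t(4-6) unfolding good_def t(3) by (simp add: add.assoc)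
    moreover have "\<theta> (last xs) \<in> {-1, 0, 1}" "\<theta> (last ys) \<in> {-1, 0, 1}" "\<theta> (pred (hd xs)) \<in> {-1, 0, 1}"
      using g unfolding good_def t(3) by blast+
    ultimately show ?thesis using 1 by auto
  next
    case 2
    then show ?thesis using good_full[OF g] flank_mem[OF f] by auto
  qed
qed

lemma flank_goodI:
  assumes f: "flank v xs ys" and c: "card (out M v) = 3"
    and "\<theta> (last xs) \<in> {0, 1}" "\<theta> (last ys) \<in> {0, 1}" "\<theta> (pred (hd xs)) \<in> {0, 1}"
    and "\<theta> (last xs) + \<theta> (last ys) + \<theta> (pred (hd xs)) = 2"
  shows "good \<theta> v"
  using assms(3-6) c flank_degree3(4-6)[OF f c]
  unfolding good_def flank_degree3(3)[OF f c] by auto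

text \<open>The face passes each pole once, while a component of weight 0 has counted it already;
  one pass minus both counts is the sum of the weights minus 1.\<close>

lemma parallel_turn:
  assumes ok: "parallel_ok X Y"
  shows "face_sum \<theta> (rbd X @ lbd Y) = turn_r X \<theta> + turn_l Y \<theta> +
      \<theta> (last (fan_t X)) * (weight (length (fan_t X)) + weight (length (fan_t Y)) - 1) +
      \<theta> (last (fan_s Y)) * (weight (length (fan_s X)) + weight (length (fan_s Y)) - 1)" (is ?F)
    and "turn_r (par X Y) \<theta> = turn_r Y \<theta> + \<theta> (last (fan_t Y)) * weight (length (fan_t Y)) +
      \<theta> (pred (hd (fan_s Y))) * weight (length (fan_s Y))" (is ?R)
    and "turn_l (par X Y) \<theta> = turn_l X \<theta> + \<theta> (last (fan_s X)) * weight (length (fan_s X)) +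
      \<theta> (pred (hd (fan_t X))) * weight (length (fan_t X))" (is ?L)
proof -
  have X: "valid X" and Y: "valid Y" using ok by (auto simp: parallel_ok_def)
  note lX = valid_last[OF X] and lY = valid_last[OF Y]
  have d: "last (fan_t X) \<in> darts M" "last (fan_s Y) \<in> darts M"
    using fan_last valid_fans X Y by blast+
  have "rot M (last (fan_t X)) = hd (fan_t Y)" "rot M (last (fan_s Y)) = hd (fan_s X)"
    using ok unfolding parallel_ok_def by blast+
  then have p: "pred (hd (fan_t Y)) = last (fan_t X)" "pred (hd (fan_s X)) = last (fan_s Y)"
    using pred_rot d by metis+
  have b: "face_sum \<theta> (rbd X) = face_sum \<theta> (butlast (rbd X)) + \<theta> (last (fan_t X))"
    "face_sum \<theta> (lbd Y) = face_sum \<theta> (butlast (lbd Y)) + \<theta> (last (fan_s Y))"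
    using lX lY valid_boundaries[OF X] valid_boundaries[OF Y]
      face_sum_butlast[of "rbd X" \<theta>] face_sum_butlast[of "lbd Y" \<theta>] by simp_all
  show ?F
    unfolding face_sum_simps(3) b turn_r_def turn_l_def p weight_def by simp
  have h: "hd (fan_s Y @ fan_s X) = hd (fan_s Y)" "last (fan_t X @ fan_t Y) = last (fan_t Y)"
    "hd (fan_t X @ fan_t Y) = hd (fan_t X)" "last (fan_s Y @ fan_s X) = last (fan_s X)"
    using lX lY by simp_all
  have g: "2 \<le> length (fan_s Y @ fan_s X)" "2 \<le> length (fan_t X @ fan_t Y)"
    using flank_degree(3,4)[OF parallel_flank(1)[OF ok]] flank_degree(3,4)[OF parallel_flank(2)[OF ok]]
    by simp_all
  show ?R
    unfolding turn_r_def par_def piece.simps h if_P[OF g(1)] if_P[OF g(2)] weight_def by simp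
  show ?L
    unfolding turn_l_def par_def piece.simps h if_P[OF g(1)] if_P[OF g(2)] weight_def by simp
qed

lemma local_rep_par:
  "local_rep (par X Y) \<theta> \<longleftrightarrow> local_rep X \<theta> \<and> local_rep Y \<theta> \<and> good \<theta> (psrc X) \<and> good \<theta> (psnk X) \<and>
    face_sum \<theta> (rbd X @ lbd Y) = 4"
  unfolding local_rep_def par_def piece.simps by blast

text \<open>The balance of one pole. The 2 subtracted is its half of the sum 4 around the face
  between the components.\<close>

lemma flank_sum:
  assumes f: "flank v xs ys" and g: "good \<theta> v"
  shows "\<theta> (last xs) * (weight (length xs) + weight (length ys) - 1) + \<theta> (last ys) * weight (length ys) +
      \<theta> (pred (hd xs)) * weight (length xs) + full_pole v xs + full_pole v ys - 2 = full_pole v (xs @ ys)"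
proof -
  note d = flank_degree[OF f]
  consider "card (out M v) = 3" "length xs = 1" "length ys = 1"
    | "card (out M v) = 4" "length xs = 1" "length ys = 1"
    | "card (out M v) = 4" "length xs = 2" "length ys = 1"
    | "card (out M v) = 4" "length xs = 1" "length ys = 2"
    using d by linarith
  then show ?thesis
    using flank_good[OF f g] by cases (auto simp: weight_def full_pole_def)
qed

lemma flank_pole_turn:
  assumes f: "flank v xs ys" and g: "good \<theta> v"
  shows "pole_turn (length xs) (length ys) (card (out M v)) (\<theta> (last ys) * weight (length ys))
      (\<theta> (last xs) * (weight (length xs) + weight (length ys) - 1))" (is ?A)
    and "pole_turn (length ys) (length xs) (card (out M v)) (\<theta> (pred (hd xs)) * weight (length xs))
      (\<theta> (last xs) * (weight (length xs) + weight (length ys) - 1))" (is ?B)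
proof -
  consider "card (out M v) = 3" "length xs = 1" "length ys = 1"
    | "card (out M v) = 4" "length xs = 1" "length ys = 1"
    | "card (out M v) = 4" "length xs = 2" "length ys = 1"
    | "card (out M v) = 4" "length xs = 1" "length ys = 2"
    using flank_degree[OF f] by linarith
  then have "?A \<and> ?B"
    using flank_good[OF f g] by cases (auto simp: weight_def pole_turn_def)
  then show ?A ?B by auto
qed

text \<open>The outer walks are the left one of \<open>X\<close> and the right one of
  \<open>Y\<close>. Their partners bound the common face of sum 4, so subtracting the face equation
  from the two balances gives the claim.\<close>

lemma balanced_par:
  assumes ok: "parallel_ok X Y" and "balanced X" "balanced Y"
  shows "balanced (par X Y)"
  unfolding balanced_def
proof (intro allI impI)
  fix \<theta> assume r: "local_rep (par X Y) \<theta>"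
  have w: "psrc Y = psrc X" "psnk Y = psnk X" using ok by (auto simp: parallel_ok_def)
  have b: "turn_r X \<theta> + turn_l X \<theta> = full_poles X" "turn_r Y \<theta> + turn_l Y \<theta> = full_poles Y"
    using r assms by (auto simp: local_rep_par balanced_def simp del: piece_simps)
  have p: "full_poles (par X Y) = full_pole (psrc X) (fan_s Y @ fan_s X) + full_pole (psnk X) (fan_t X @ fan_t Y)"
    by (simp add: full_poles_def)
  have g: "good \<theta> (psrc X)" "good \<theta> (psnk X)" "face_sum \<theta> (rbd X @ lbd Y) = 4"
    using r unfolding local_rep_par by blast+
  show "turn_r (par X Y) \<theta> + turn_l (par X Y) \<theta> = full_poles (par X Y)"
    using parallel_turn[OF ok, of \<theta>] b g(3) flank_sum[OF parallel_flank(1)[OF ok] g(2)]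
      flank_sum[OF parallel_flank(2)[OF ok] g(1)] w
    unfolding p full_poles_def by (simp add: algebra_simps)
qed

text \<open>The equation for \<open>xl\<close> is the face equation with the left turn of
  \<open>Y\<close> replaced by \<open>full_poles Y\<close> minus its right turn.\<close>

lemma achieves_par:
  assumes ok: "parallel_ok X Y" and bal: "balanced Y"
  shows "achieves (par X Y) x \<longleftrightarrow> (\<exists>xl xr \<rho> \<eta> \<rho>' \<eta>'. achieves X xl \<and> achieves Y xr \<and>
    pole_turn (length (fan_s X)) (length (fan_s Y)) (card (out M (psrc X))) \<rho> \<eta> \<and>
    pole_turn (length (fan_t X)) (length (fan_t Y)) (card (out M (psnk X))) \<rho>' \<eta>' \<and>
    xl = xr + 4 - full_poles Y - \<eta> - \<eta>' \<and> x = xr + \<rho> + \<rho>')"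
  (is "_ \<longleftrightarrow> ?R")
proof
  assume "achieves (par X Y) x"
  then obtain \<theta> where r: "local_rep (par X Y) \<theta>" "turn_r (par X Y) \<theta> = x" unfolding achieves_def by blast
  have g: "good \<theta> (psrc X)" "good \<theta> (psnk X)" "face_sum \<theta> (rbd X @ lbd Y) = 4"
    "local_rep X \<theta>" "local_rep Y \<theta>"
    using r unfolding local_rep_par by blast+
  have b: "turn_r Y \<theta> + turn_l Y \<theta> = full_poles Y" using bal g(5) by (simp add: balanced_def)
  have a: "achieves X (turn_r X \<theta>)" "achieves Y (turn_r Y \<theta>)" using g achieves_def by blast+
  note p = flank_pole_turn(1)[OF parallel_flank(1)[OF ok] g(2)]
    flank_pole_turn(2)[OF parallel_flank(2)[OF ok] g(1)]
  show ?R
  proof (intro exI conjI)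
    show "turn_r X \<theta> = turn_r Y \<theta> + 4 - full_poles Y -
      \<theta> (last (fan_s Y)) * (weight (length (fan_s Y)) + weight (length (fan_s X)) - 1) -
      \<theta> (last (fan_t X)) * (weight (length (fan_t X)) + weight (length (fan_t Y)) - 1)"
      using parallel_turn(1)[OF ok, of \<theta>] g(3) b by (simp add: algebra_simps)
    show "x = turn_r Y \<theta> + \<theta> (pred (hd (fan_s Y))) * weight (length (fan_s Y)) +
      \<theta> (last (fan_t Y)) * weight (length (fan_t Y))"
      using parallel_turn(2)[OF ok, of \<theta>] r(2) by simp
  qed (use a p in auto)
next
  assume ?R
  then obtain \<theta>1 \<theta>2 \<rho> \<eta> \<rho>' \<eta>' where r1: "local_rep X \<theta>1" and r2: "local_rep Y \<theta>2"
    and ps: "pole_turn (length (fan_s X)) (length (fan_s Y)) (card (out M (psrc X))) \<rho> \<eta>"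
    and pt: "pole_turn (length (fan_t X)) (length (fan_t Y)) (card (out M (psnk X))) \<rho>' \<eta>'"
    and xl: "turn_r X \<theta>1 = turn_r Y \<theta>2 + 4 - full_poles Y - \<eta> - \<eta>'"
    and x: "x = turn_r Y \<theta>2 + \<rho> + \<rho>'"
    unfolding achieves_def by blast
  have X: "valid X" and Y: "valid Y" and w: "psrc Y = psrc X" "psnk Y = psnk X"
    and e: "ends M (pset X) \<inter> ends M (pset Y) = {psrc X, psnk X}" using ok by (auto simp: parallel_ok_def)
  define s t where "s = psrc X" and "t = psnk X"
  have fs: "flank s (fan_s Y) (fan_s X)" and ft: "flank t (fan_t X) (fan_t Y)"
    using parallel_flank[OF ok] by (auto simp: s_def t_def)
  have st: "s \<noteq> t" using validD(1)[OF X] s_def t_def by simp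
  note ds = flank_degree[OF fs] and dt = flank_degree[OF ft]
  \<comment> \<open>At a pole of degree three two turns are prescribed and the third is what is
    missing to 2; at degree four the only possible value is 1.\<close>
  define \<theta>0 where "\<theta>0 a = (if src M a = s
       then (if card (out M s) = 3 then (if a = last (fan_s Y) then \<eta> else if a = last (fan_s X) then 2 - \<rho> - \<eta> else \<rho>) else 1)
       else (if card (out M t) = 3 then (if a = last (fan_t X) then \<eta>' else if a = last (fan_t Y) then \<rho>' else 2 - \<rho>' - \<eta>') else 1))" for a
  have own_s: "s \<in> own X \<longleftrightarrow> 2 \<le> length (fan_s X)" "s \<in> own Y \<longleftrightarrow> 2 \<le> length (fan_s Y)"
    and own_t: "t \<in> own X \<longleftrightarrow> 2 \<le> length (fan_t X)" "t \<in> own Y \<longleftrightarrow> 2 \<le> length (fan_t Y)"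
    using valid_own(3,4)[OF X] valid_own(3,4)[OF Y] w by (auto simp: s_def t_def)
  have full: "4 \<le> card (out M v)" if v: "v \<in> own X" "v \<in> own Y" for v
  proof -
    have "v = s \<or> v = t" using v valid_own(1)[OF X] valid_own(1)[OF Y] e s_def t_def by blast
    then show ?thesis using own_s own_t v ds dt by auto
  qed
  obtain \<theta> where th: "agree (own X) \<theta> \<theta>1" "agree (own Y) \<theta> \<theta>2"
    "\<forall>a. src M a \<notin> own X \<union> own Y \<longrightarrow> \<theta> a = \<theta>0 a" using glue[OF r1 r2 full] by blast
  have rX: "local_rep X \<theta>" and rY: "local_rep Y \<theta>"
    using agree_local_rep X Y th r1 r2 by blast+
  have tr: "turn_r X \<theta> = turn_r X \<theta>1" "turn_r Y \<theta> = turn_r Y \<theta>2" using agree_turn_r X Y th by blast+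
  have o: "\<theta> a = \<theta>0 a" if "a \<in> out M v" "v \<notin> own X \<union> own Y" for a v
    using th(3) that outD(2)[OF that(1)] by simp
  have gs: "good \<theta> s \<and> (card (out M s) = 3 \<longrightarrow> \<theta> (last (fan_s Y)) = \<eta> \<and> \<theta> (pred (hd (fan_s Y))) = \<rho>)"
  proof (cases "card (out M s) = 3")
    case True
    note t3 = flank_degree3[OF fs True]
    have n: "s \<notin> own X \<union> own Y" using own_s t3 by auto
    have m: "src M (last (fan_s Y)) = s" "src M (last (fan_s X)) = s" "src M (pred (hd (fan_s Y))) = s"
      using flank_mem[OF fs] outD(2) by metis+
    have v: "\<theta> (last (fan_s Y)) = \<eta>" "\<theta> (last (fan_s X)) = 2 - \<rho> - \<eta>" "\<theta> (pred (hd (fan_s Y))) = \<rho>"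
      using o[OF flank_mem(1)[OF fs] n] o[OF flank_mem(2)[OF fs] n] o[OF flank_mem(3)[OF fs] n] m t3(4-6) True
      by (auto simp: \<theta>0_def)
    have "\<rho> \<in> {0, 1} \<and> \<eta> \<in> {0, 1} \<and> 1 \<le> \<rho> + \<eta>" using ps True by (simp add: pole_turn_def s_def)
    then have "good \<theta> s" using v by (intro flank_goodI[OF fs True]) auto
    then show ?thesis using v by simp
  next
    case False
    then have c: "card (out M s) = 4" using ds by linarith
    show ?thesis
    proof (cases "s \<in> own X \<union> own Y")
      case True
      then show ?thesis using rX rY c by (auto simp: local_rep_def)
    next
      case n: False
      \<comment> \<open>A pole of degree four with one arc from each component is owned by neither,
        so the default turn 1 takes effect.\<close>
      have "\<theta> a = 1" if "a \<in> out M s" for a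
        using o[OF that n] outD(2)[OF that] c by (auto simp: \<theta>0_def)
      then show ?thesis using good_fullI[OF c] c by auto
    qed
  qed
  have gt: "good \<theta> t \<and> (card (out M t) = 3 \<longrightarrow> \<theta> (last (fan_t X)) = \<eta>' \<and> \<theta> (last (fan_t Y)) = \<rho>')"
  proof (cases "card (out M t) = 3")
    case True
    note t3 = flank_degree3[OF ft True]
    have n: "t \<notin> own X \<union> own Y" using own_t t3 by auto
    have m: "src M (last (fan_t X)) = t" "src M (last (fan_t Y)) = t" "src M (pred (hd (fan_t X))) = t"
      using flank_mem[OF ft] outD(2) by metis+
    have v: "\<theta> (last (fan_t X)) = \<eta>'" "\<theta> (last (fan_t Y)) = \<rho>'" "\<theta> (pred (hd (fan_t X))) = 2 - \<rho>' - \<eta>'"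
      using o[OF flank_mem(1)[OF ft] n] o[OF flank_mem(2)[OF ft] n] o[OF flank_mem(3)[OF ft] n] m t3(4-6) True st
      by (auto simp: \<theta>0_def)
    have "\<rho>' \<in> {0, 1} \<and> \<eta>' \<in> {0, 1} \<and> 1 \<le> \<rho>' + \<eta>'" using pt True by (simp add: pole_turn_def t_def)
    then have "good \<theta> t" using v by (intro flank_goodI[OF ft True]) auto
    then show ?thesis using v by simp
  next
    case False
    then have c: "card (out M t) = 4" using dt by linarith
    show ?thesis
    proof (cases "t \<in> own X \<union> own Y")
      case True
      then show ?thesis using rX rY c by (auto simp: local_rep_def)
    next
      case n: False
      have "\<theta> a = 1" if "a \<in> out M t" for a
        using o[OF that n] outD(2)[OF that] c st by (auto simp: \<theta>0_def)
      then show ?thesis using good_fullI[OF c] c by auto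
    qed
  qed
  have qs: "\<theta> (last (fan_s Y)) * (weight (length (fan_s X)) + weight (length (fan_s Y)) - 1) = \<eta> \<and>
      \<theta> (pred (hd (fan_s Y))) * weight (length (fan_s Y)) = \<rho>"
  proof (cases "card (out M s) = 3")
    case True
    then show ?thesis using gs flank_degree3(1,2)[OF fs True] by (simp add: weight_def)
  next
    case False
    \<comment> \<open>At degree four \<open>pole_turn\<close> determines both numbers, so the given
      ones and those of \<open>\<theta>\<close> coincide.\<close>
    then show ?thesis using ps flank_pole_turn(2)[OF fs conjunct1[OF gs]]
      by (auto simp: pole_turn_def s_def add.commute)
  qed
  have qt: "\<theta> (last (fan_t X)) * (weight (length (fan_t X)) + weight (length (fan_t Y)) - 1) = \<eta>' \<and>
      \<theta> (last (fan_t Y)) * weight (length (fan_t Y)) = \<rho>'"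
  proof (cases "card (out M t) = 3")
    case True
    then show ?thesis using gt flank_degree3(1,2)[OF ft True] by (simp add: weight_def)
  next
    case False
    then show ?thesis using pt flank_pole_turn(1)[OF ft conjunct1[OF gt]]
      by (auto simp: pole_turn_def t_def)
  qed
  have b: "turn_r Y \<theta> + turn_l Y \<theta> = full_poles Y" using bal rY by (simp add: balanced_def)
  have "face_sum \<theta> (rbd X @ lbd Y) = 4"
    unfolding parallel_turn(1)[OF ok] using qs qt xl tr b by linarith
  then have "local_rep (par X Y) \<theta>"
    unfolding local_rep_par using rX rY gs gt s_def t_def by blast
  moreover have "turn_r (par X Y) \<theta> = x"
    unfolding parallel_turn(2)[OF ok] using qs qt x tr by linarith
  ultimately show "achieves (par X Y) x" unfolding achieves_def by blast
qed

end

section \<open>Intervals of realizable turns\<close>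

text \<open>The common offset \<open>r\<close> covers integers and semi-integers at once.\<close>

lemma spiralities_shift:
  "spiralities (of_int a + r, of_int b + r) = (\<lambda>z. of_int z + r) ` {a..b}"
proof
  show "spiralities (of_int a + r, of_int b + r) \<subseteq> (\<lambda>z. of_int z + r) ` {a..b}"
  proof
    fix x assume x: "x \<in> spiralities (of_int a + r, of_int b + r)"
    then obtain k :: int where k: "x - (of_int a + r) = of_int k" by (auto simp: spiralities_def elim: Ints_cases)
    then have "x = of_int (a + k) + r" by simp
    moreover have "a \<le> a + k" "a + k \<le> b" using x k by (auto simp: spiralities_def)
    ultimately show "x \<in> (\<lambda>z. of_int z + r) ` {a..b}"
      by (intro image_eqI[of _ _ "a + k"]) auto
  qed
qed (auto simp: spiralities_def simp flip: of_int_diff)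

text \<open>With a common offset both sets lie in the same residue class, so they meet iff the
  integer end points overlap.\<close>

lemma spiralities_meet:
  "spiralities (of_int a + r, of_int b + r) \<inter> spiralities (of_int c + r, of_int d + r) \<noteq> {} \<longleftrightarrow>
    max a c \<le> min b d"
  unfolding spiralities_shift
proof
  assume "(\<lambda>z. of_int z + r) ` {a..b} \<inter> (\<lambda>z. of_int z + r) ` {c..d} \<noteq> {}"
  then show "max a c \<le> min b d" by auto
next
  assume "max a c \<le> min b d"
  then have "of_int (max a c) + r \<in> (\<lambda>z. of_int z + r) ` {a..b} \<inter> (\<lambda>z. of_int z + r) ` {c..d}" by auto
  then show "(\<lambda>z. of_int z + r) ` {a..b} \<inter> (\<lambda>z. of_int z + r) ` {c..d} \<noteq> {}" by blast
qed

declare piece_simps [simp del]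

context rotation_system
begin

definition realizes :: "('v, 'a) piece \<Rightarrow> int \<Rightarrow> int \<Rightarrow> bool" where
  "realizes X a A \<longleftrightarrow> a \<le> A \<and> (\<forall>x. achieves X x \<longleftrightarrow> a \<le> x \<and> x \<le> A)"

definition has_interval :: "('v, 'a) piece \<Rightarrow> real \<times> real \<Rightarrow> bool" where
  "has_interval X I \<longleftrightarrow> (\<exists>a A. realizes X a A \<and>
     I = (of_int a - of_int (full_poles X) / 2, of_int A - of_int (full_poles X) / 2))"

section \<open>Intervals of series compositions\<close>

lemma full_poles_ser:
  assumes ok: "series_ok X Y"
  shows "full_poles (ser X Y) = full_poles X + full_poles Y -
    (if 2 \<le> length (fan_t X) \<and> 2 \<le> length (fan_s Y) then 2 else 0)"
proof -
  have w: "psrc Y = psnk X" using ok by (auto simp: series_ok_def)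
  note d = series_degree[OF ok]
  have "full_pole (psnk X) (fan_t X) + full_pole (psnk X) (fan_s Y) =
      (if 2 \<le> length (fan_t X) \<and> 2 \<le> length (fan_s Y) then 2 else 0)"
    using d(2-4) unfolding full_pole_def d(1) by auto
  then show ?thesis
    by (simp add: full_poles_def ser_def w)
qed

text \<open>By \<open>n\<close> the joint turn is a fixed \<open>j\<close>, and
  \<open>full_poles\<close> changes by \<open>2 * j\<close>. Half of that change cancels
  \<open>j\<close>, so spiralities add without a correction.\<close>

lemma has_interval_ser:
  assumes ok: "series_ok X Y" and X: "has_interval X I" and Y: "has_interval Y J"
    and n: "\<not> (length (fan_t X) = 1 \<and> length (fan_s Y) = 1)"
  shows "has_interval (ser X Y) (fst I + fst J, snd I + snd J)"
proof -
  obtain a A where a: "realizes X a A"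
    "I = (of_int a - of_int (full_poles X) / 2, of_int A - of_int (full_poles X) / 2)"
    using X unfolding has_interval_def by blast
  obtain b B where b: "realizes Y b B"
    "J = (of_int b - of_int (full_poles Y) / 2, of_int B - of_int (full_poles Y) / 2)"
    using Y unfolding has_interval_def by blast
  define j :: int where "j = (if 2 \<le> length (fan_t X) \<and> 2 \<le> length (fan_s Y) then -1 else 0)"
  have jt: "joint_turn (length (fan_t X)) (length (fan_s Y)) i \<longleftrightarrow> i = j" for i
    using n by (auto simp: joint_turn_def j_def)
  have "achieves (ser X Y) x \<longleftrightarrow> a + b + j \<le> x \<and> x \<le> A + B + j" for x
  proof -
    have "achieves (ser X Y) x \<longleftrightarrow> (\<exists>y z. a \<le> y \<and> y \<le> A \<and> b \<le> z \<and> z \<le> B \<and> x = y + z + j)"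
      unfolding achieves_ser[OF ok] jt using a(1) b(1) unfolding realizes_def by metis
    also have "\<dots> \<longleftrightarrow> a + b + j \<le> x \<and> x \<le> A + B + j"
    proof
      assume "a + b + j \<le> x \<and> x \<le> A + B + j"
      moreover have "a \<le> A" "b \<le> B" using a b by (auto simp: realizes_def)
      \<comment> \<open>The summand for \<open>X\<close> is taken as large as \<open>A\<close> and
        the lower bound \<open>b\<close> of the other summand permit.\<close>
      ultimately have "a \<le> min A (x - j - b)" "b \<le> x - j - min A (x - j - b)" 
        "x - j - min A (x - j - b) \<le> B" by linarith+
      then show "\<exists>y z. a \<le> y \<and> y \<le> A \<and> b \<le> z \<and> z \<le> B \<and> x = y + z + j"
        by (intro exI[of _ "min A (x - j - b)"] exI[of _ "x - j - min A (x - j - b)"]) auto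
    qed auto
    finally show ?thesis .
  qed
  then have "realizes (ser X Y) (a + b + j) (A + B + j)"
    using a b by (auto simp: realizes_def)
  moreover have "of_int (full_poles (ser X Y)) = of_int (full_poles X) + of_int (full_poles Y) + 2 * real_of_int j"
    using full_poles_ser[OF ok] by (simp add: j_def)
  ultimately show ?thesis
    unfolding has_interval_def a b
    by (intro exI[of _ "a + b + j"] exI[of _ "A + B + j"]) (simp add: field_simps)
qed

lemma achieves_serD:
  "series_ok X Y \<Longrightarrow> achieves (ser X Y) x \<Longrightarrow> (\<exists>y. achieves X y) \<and> (\<exists>z. achieves Y z)"
  using achieves_ser by blast

lemma series_chain_balanced:
  "series_chain Xs \<Longrightarrow> \<forall>X\<in>set Xs. balanced X \<Longrightarrow> balanced (fold_nonempty ser Xs)"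
  by (induction Xs rule: series_chain.induct) (auto intro: balanced_ser)

lemma series_chain_achievesD:
  "series_chain Xs \<Longrightarrow> achieves (fold_nonempty ser Xs) x \<Longrightarrow> \<forall>X\<in>set Xs. \<exists>y. achieves X y"
proof (induction Xs arbitrary: x rule: series_chain.induct)
  case (3 X Y r)
  then have "(\<exists>y. achieves X y) \<and> (\<exists>z. achieves (fold_nonempty ser (Y # r)) z)"
    using achieves_serD by (metis fold_nonempty.simps(3) series_chain.simps(3))
  then show ?case using "3.IH" "3.prems"(1) by auto
qed auto

lemma series_chain_interval:
  assumes "series_chain Xs" "length Is = length Xs"
    "\<forall>i < length Xs. has_interval (Xs ! i) (Is ! i)"
    "\<forall>i. Suc i < length Xs \<longrightarrow> \<not> (length (fan_t (Xs ! i)) = 1 \<and> length (fan_s (Xs ! Suc i)) = 1)"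
  shows "has_interval (fold_nonempty ser Xs) (\<Sum>I\<leftarrow>Is. fst I, \<Sum>I\<leftarrow>Is. snd I)"
  using assms
proof (induction Xs arbitrary: Is rule: series_chain.induct)
  case (2 X)
  then obtain I where "Is = [I]" by (cases Is) auto
  then show ?case using 2 by simp
next
  case (3 X Y r)
  then obtain I J where Is: "Is = I # J" by (cases Is) auto
  have ok: "series_ok X (fold_nonempty ser (Y # r))" and ch: "series_chain (Y # r)"
    using "3.prems"(1) by simp_all
  have "has_interval (fold_nonempty ser (Y # r)) (\<Sum>I\<leftarrow>J. fst I, \<Sum>I\<leftarrow>J. snd I)"
  proof (rule "3.IH"[OF ch])
    show "length J = length (Y # r)" using "3.prems"(2) Is by simp
    show "\<forall>i<length (Y # r). has_interval ((Y # r) ! i) (J ! i)"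
    proof (intro allI impI)
      fix i assume "i < length (Y # r)"
      then show "has_interval ((Y # r) ! i) (J ! i)"
        using "3.prems"(3)[rule_format, of "Suc i"] Is by simp
    qed
    show "\<forall>i. Suc i < length (Y # r) \<longrightarrow>
        \<not> (length (fan_t ((Y # r) ! i)) = 1 \<and> length (fan_s ((Y # r) ! Suc i)) = 1)"
    proof (intro allI impI)
      fix i assume "Suc i < length (Y # r)"
      then show "\<not> (length (fan_t ((Y # r) ! i)) = 1 \<and> length (fan_s ((Y # r) ! Suc i)) = 1)"
        using "3.prems"(4)[rule_format, of "Suc i"] by simp
    qed
  qed
  moreover have "has_interval X I" using "3.prems"(3)[rule_format, of 0] Is by simp
  moreover have "\<not> (length (fan_t X) = 1 \<and> length (fan_s (fold_nonempty ser (Y # r))) = 1)"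
    using "3.prems"(4)[rule_format, of 0] fold_ser(4)[of "Y # r"] by simp
  ultimately show ?case
    using has_interval_ser[OF ok, of I "(\<Sum>I\<leftarrow>J. fst I, \<Sum>I\<leftarrow>J. snd I)"] Is by simp
qed simp

text \<open>Each of the inner vertices, one fewer than the edges, contributes a free turn from -1,
  0, 1.\<close>

lemma path_achieves:
  assumes "series_chain (map (edge_piece M) p)"
  shows "achieves (fold_nonempty ser (map (edge_piece M) p)) x \<longleftrightarrow> \<bar>x\<bar> < int (length p)"
  using assms
proof (induction p arbitrary: x rule: induct_list012)
  case (2 a)
  then show ?case using edge_achieves[of a x] by simp
next
  case (3 a b r)
  let ?F = "fold_nonempty ser (map (edge_piece M) (b # r))"
  have ok: "series_ok (edge_piece M a) ?F" and ch: "series_chain (map (edge_piece M) (b # r))"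
    using "3.prems" by simp_all
  have l: "length (fan_t (edge_piece M a)) = 1" "length (fan_s ?F) = 1"
    using fold_ser(4)[of "map (edge_piece M) (b # r)"] by (simp_all add: edge_piece_def)
  have "achieves (ser (edge_piece M a) ?F) x \<longleftrightarrow>
      (\<exists>z j. \<bar>z\<bar> < int (length (b # r)) \<and> j \<in> {-1, 0, 1} \<and> x = z + j)"
    unfolding achieves_ser[OF ok] l edge_achieves "3.IH"(2)[OF ch] by (simp add: joint_turn_def)
  also have "\<dots> \<longleftrightarrow> \<bar>x\<bar> < int (length (a # b # r))"
  proof
    assume h: "\<bar>x\<bar> < int (length (a # b # r))"
    show "\<exists>z j. \<bar>z\<bar> < int (length (b # r)) \<and> j \<in> {-1, 0, 1} \<and> x = z + j"
      \<comment> \<open>The first bend takes one unit towards \<open>x\<close>, which leaves a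
        smaller absolute value for the shorter path.\<close>
      using h by (intro exI[of _ "x - sgn x"] exI[of _ "sgn x"]) (auto simp: sgn_if)
  qed auto
  finally show ?case by simp
qed simp

text \<open>Rewrites the case distinction on degrees as linear inequalities in three indicators, so
  that the contributions of both poles can be added.\<close>

lemma pole_turn_iff:
  assumes "flank v xs ys"
  defines "q \<equiv> full_pole v xs" and "c \<equiv> full_pole v ys" and "g \<equiv> full_pole v (xs @ ys)"
  shows "pole_turn (length xs) (length ys) (card (out M v)) \<rho> \<eta> \<longleftrightarrow>
     q + g \<le> \<rho> \<and> \<rho> \<le> 1 - c \<and> g \<le> \<eta> \<and> \<eta> \<le> 1 - q - c \<and> 1 - c + g \<le> \<rho> + \<eta>" (is ?A)
    and "pole_turn (length ys) (length xs) (card (out M v)) \<rho> \<eta> \<longleftrightarrow>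
     c + g \<le> \<rho> \<and> \<rho> \<le> 1 - q \<and> g \<le> \<eta> \<and> \<eta> \<le> 1 - c - q \<and> 1 - q + g \<le> \<rho> + \<eta>" (is ?B)
    and "(q, c, g) \<in> {(0, 0, 0), (0, 0, 1), (1, 0, 0), (0, 1, 0)}" (is ?C)
proof -
  have "(card (out M v) = 3 \<and> length xs = 1 \<and> length ys = 1)
    \<or> (card (out M v) = 4 \<and> length xs = 1 \<and> length ys = 1)
    \<or> (card (out M v) = 4 \<and> length xs = 2 \<and> length ys = 1)
    \<or> (card (out M v) = 4 \<and> length xs = 1 \<and> length ys = 2)"
    using flank_degree[OF assms(1)] by linarith
  then show ?A ?B ?C
    unfolding q_def c_def g_def by (elim disjE; auto simp: full_pole_def pole_turn_def)+
qed

text \<open>At a pole the left component (\<open>q\<close>), the right one (\<open>c\<close>) or neither has indegree two; \<open>g\<close>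
  marks the poles of degree four of the last kind.\<close>

lemma pole_turn_sum:
  fixes q c g q' c' g' :: int
  assumes "(q, c, g) \<in> {(0, 0, 0), (0, 0, 1), (1, 0, 0), (0, 1, 0)}"
    and "(q', c', g') \<in> {(0, 0, 0), (0, 0, 1), (1, 0, 0), (0, 1, 0)}"
    and "q + q' + (g + g') \<le> \<rho>" "\<rho> \<le> 2 - (c + c')" "g + g' \<le> \<eta>" "\<eta> \<le> 2 - (q + q') - (c + c')"
    and "2 - (c + c') + (g + g') \<le> \<rho> + \<eta>"
  shows "\<exists>r e. (q + g \<le> r \<and> r \<le> 1 - c \<and> g \<le> e \<and> e \<le> 1 - q - c \<and> 1 - c + g \<le> r + e) \<and>
    (q' + g' \<le> \<rho> - r \<and> \<rho> - r \<le> 1 - c' \<and> g' \<le> \<eta> - e \<and> \<eta> - e \<le> 1 - q' - c' \<and> 1 - c' + g' \<le> (\<rho> - r) + (\<eta> - e))"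
proof -
  \<comment> \<open>From here a finite check: sixteen pairs of pole kinds and nine totals, each
    split into a share of 0 or 1 for the first pole and a remainder.\<close>
  have "\<rho> \<in> {0, 1, 2}" "\<eta> \<in> {0, 1, 2}" using assms by auto
  then have "\<exists>r\<in>{0,1}. \<exists>e\<in>{0,1}. (q + g \<le> r \<and> r \<le> 1 - c \<and> g \<le> e \<and> e \<le> 1 - q - c \<and> 1 - c + g \<le> r + e) \<and>
    (q' + g' \<le> \<rho> - r \<and> \<rho> - r \<le> 1 - c' \<and> g' \<le> \<eta> - e \<and> \<eta> - e \<le> 1 - q' - c' \<and> 1 - c' + g' \<le> (\<rho> - r) + (\<eta> - e))"
    using assms by (elim insertE emptyE) simp_all
  then show ?thesis by blast
qed

section \<open>Parallel composition in terms of pole counts\<close>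

lemma parallel_full_poles:
  assumes ok: "parallel_ok X Y"
  shows "full_poles X = full_pole (psrc X) (fan_s X) + full_pole (psnk X) (fan_t X)"
    "full_poles Y = full_pole (psrc X) (fan_s Y) + full_pole (psnk X) (fan_t Y)"
    "full_poles (par X Y) = full_pole (psrc X) (fan_s Y @ fan_s X) + full_pole (psnk X) (fan_t X @ fan_t Y)"
  using ok by (auto simp: parallel_ok_def full_poles_def par_def)

lemma parallel_full_poles_bounds:
  assumes ok: "parallel_ok X Y"
  shows "0 \<le> full_poles X" "0 \<le> full_poles Y" "0 \<le> full_poles (par X Y)"
    "full_poles (par X Y) \<le> 2 - full_poles X - full_poles Y"
  using pole_turn_iff(3)[OF parallel_flank(1)[OF ok]] pole_turn_iff(3)[OF parallel_flank(2)[OF ok]]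
  unfolding parallel_full_poles[OF ok] by auto

text \<open>The inequalities of two poles add up to inequalities of the same shape for the totals,
  and \<open>pole_turn_sum\<close> splits every admissible total again. So it does not matter which
  pole contributes what.\<close>

lemma achieves_par_counts:
  assumes ok: "parallel_ok X Y" and bal: "balanced Y"
  defines "q \<equiv> full_poles X" and "c \<equiv> full_poles Y" and "g \<equiv> full_poles (par X Y)"
  shows "achieves (par X Y) x \<longleftrightarrow> (\<exists>xl xr \<rho> \<eta>. achieves X xl \<and> achieves Y xr \<and>
    q + g \<le> \<rho> \<and> \<rho> \<le> 2 - c \<and> g \<le> \<eta> \<and> \<eta> \<le> 2 - q - c \<and> 2 - c + g \<le> \<rho> + \<eta> \<and>
    xl = xr + 4 - c - \<eta> \<and> x = xr + \<rho>)" (is "_ = ?R")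
proof -
  note fs = parallel_flank(2)[OF ok] and ft = parallel_flank(1)[OF ok]
  note p = achieves_par[OF ok bal, unfolded pole_turn_iff(2)[OF fs] pole_turn_iff(1)[OF ft]]
  note e = parallel_full_poles[OF ok]
  show ?thesis
  proof
    assume "achieves (par X Y) x"
    then show ?R unfolding p q_def c_def g_def e
    proof (elim exE conjE, goal_cases)
      case (1 xl xr \<rho> \<eta> \<rho>' \<eta>')
      then show ?case
        by (intro exI[of _ xl] exI[of _ xr] exI[of _ "\<rho> + \<rho>'"] exI[of _ "\<eta> + \<eta>'"] conjI)
          (assumption | linarith)+
    qed
  next
    assume ?R
    then obtain xl xr \<rho> \<eta> where h: "achieves X xl" "achieves Y xr"
      "q + g \<le> \<rho>" "\<rho> \<le> 2 - c" "g \<le> \<eta>" "\<eta> \<le> 2 - q - c" "2 - c + g \<le> \<rho> + \<eta>"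
      "xl = xr + 4 - c - \<eta>" "x = xr + \<rho>" by blast
    define s t where "s = psrc X" and "t = psnk X"
    have 3: "(full_pole s (fan_s X), full_pole s (fan_s Y), full_pole s (fan_s Y @ fan_s X))
        \<in> {(0, 0, 0), (0, 0, 1), (1, 0, 0), (0, 1, 0)}"
      "(full_pole t (fan_t X), full_pole t (fan_t Y), full_pole t (fan_t X @ fan_t Y))
        \<in> {(0, 0, 0), (0, 0, 1), (1, 0, 0), (0, 1, 0)}"
      using pole_turn_iff(3)[OF fs] pole_turn_iff(3)[OF ft] by (auto simp: s_def t_def)
    have h': "full_pole s (fan_s X) + full_pole t (fan_t X) + (full_pole s (fan_s Y @ fan_s X) + full_pole t (fan_t X @ fan_t Y)) \<le> \<rho>"
      "\<rho> \<le> 2 - (full_pole s (fan_s Y) + full_pole t (fan_t Y))"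
      "full_pole s (fan_s Y @ fan_s X) + full_pole t (fan_t X @ fan_t Y) \<le> \<eta>"
      "\<eta> \<le> 2 - (full_pole s (fan_s X) + full_pole t (fan_t X)) - (full_pole s (fan_s Y) + full_pole t (fan_t Y))"
      "2 - (full_pole s (fan_s Y) + full_pole t (fan_t Y)) + (full_pole s (fan_s Y @ fan_s X) + full_pole t (fan_t X @ fan_t Y)) \<le> \<rho> + \<eta>"
      using h(3-7) unfolding q_def c_def g_def e s_def t_def by linarith+
    from pole_turn_sum[OF 3 h'] obtain r f where
      rf: "full_pole s (fan_s X) + full_pole s (fan_s Y @ fan_s X) \<le> r \<and> r \<le> 1 - full_pole s (fan_s Y) \<and>
        full_pole s (fan_s Y @ fan_s X) \<le> f \<and> f \<le> 1 - full_pole s (fan_s X) - full_pole s (fan_s Y) \<and>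
        1 - full_pole s (fan_s Y) + full_pole s (fan_s Y @ fan_s X) \<le> r + f"
      "full_pole t (fan_t X) + full_pole t (fan_t X @ fan_t Y) \<le> \<rho> - r \<and> \<rho> - r \<le> 1 - full_pole t (fan_t Y) \<and>
        full_pole t (fan_t X @ fan_t Y) \<le> \<eta> - f \<and> \<eta> - f \<le> 1 - full_pole t (fan_t X) - full_pole t (fan_t Y) \<and>
        1 - full_pole t (fan_t Y) + full_pole t (fan_t X @ fan_t Y) \<le> (\<rho> - r) + (\<eta> - f)" by blast
    show "achieves (par X Y) x"
      unfolding p using h rf unfolding s_def t_def c_def
      by (elim conjE, intro exI[of _ xl] exI[of _ xr] exI[of _ r] exI[of _ f] exI[of _ "\<rho> - r"]
          exI[of _ "\<eta> - f"] conjI) (assumption | linarith)+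
  qed
qed

text \<open>Elimination of \<open>xl\<close>, \<open>xr\<close>, \<open>\<rho>\<close>,
  \<open>\<eta>\<close>. The two bounds on the difference of the components express that
  \<open>4 - c - \<eta>\<close> ranges from \<open>2 + q\<close> to
  \<open>4 - c - g\<close>.\<close>

lemma realizes_par:
  assumes ok: "parallel_ok X Y" and bal: "balanced Y" and X: "realizes X a A" and Y: "realizes Y b B"
  defines "q \<equiv> full_poles X" and "c \<equiv> full_poles Y" and "g \<equiv> full_poles (par X Y)"
  shows "(\<exists>x. achieves (par X Y) x) \<longleftrightarrow> a - B \<le> 4 - c - g \<and> 2 + q \<le> A - b" (is ?P)
    and "a - B \<le> 4 - c - g \<Longrightarrow> 2 + q \<le> A - b \<Longrightarrow>
      realizes (par X Y) (max (b + g + q) (a - 2 + g)) (min (B + 2 - c) (A - q - c))"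
proof -
  have bd: "0 \<le> q" "0 \<le> c" "0 \<le> g" "g \<le> 2 - q - c"
    using parallel_full_poles_bounds[OF ok] by (auto simp: q_def c_def g_def)
  have ab: "a \<le> A" "b \<le> B" using X Y by (auto simp: realizes_def)
  have e: "achieves (par X Y) x \<longleftrightarrow> (\<exists>xl xr \<rho> \<eta>. a \<le> xl \<and> xl \<le> A \<and> b \<le> xr \<and> xr \<le> B \<and>
    q + g \<le> \<rho> \<and> \<rho> \<le> 2 - c \<and> g \<le> \<eta> \<and> \<eta> \<le> 2 - q - c \<and> 2 - c + g \<le> \<rho> + \<eta> \<and>
    xl = xr + 4 - c - \<eta> \<and> x = xr + \<rho>)" for x
    unfolding achieves_par_counts[OF ok bal] using X Y unfolding realizes_def q_def c_def g_def
    by (simp only: conj_assoc)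
  have 1: "a - B \<le> 4 - c - g \<and> 2 + q \<le> A - b \<and>
      max (b + g + q) (a - 2 + g) \<le> x \<and> x \<le> min (B + 2 - c) (A - q - c)" if "achieves (par X Y) x" for x
    using that unfolding e by (elim exE conjE, intro conjI max.boundedI min.boundedI) linarith+
  have 2: "achieves (par X Y) x" if cond: "a - B \<le> 4 - c - g" "2 + q \<le> A - b"
    and x: "max (b + g + q) (a - 2 + g) \<le> x" "x \<le> min (B + 2 - c) (A - q - c)" for x
  proof -
    \<comment> \<open>The least value compatible with its own lower bound, with
      \<open>xr \<le> B\<close>, and with \<open>xl \<le> A\<close> when \<open>\<eta>\<close> is
      maximal.\<close>
    define \<rho> where "\<rho> = max (q + g) (max (x - B) (x + 2 - A + q))"
    have r: "q + g \<le> \<rho>" "x - B \<le> \<rho>" "x + 2 - A + q \<le> \<rho>"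
      "\<rho> = q + g \<or> \<rho> = x - B \<or> \<rho> = x + 2 - A + q" by (auto simp: \<rho>_def max_def)
    \<comment> \<open>The largest value that respects its own upper bound and still keeps
      \<open>xl\<close> at least \<open>a\<close>.\<close>
    define \<eta> where "\<eta> = min (2 - q - c) (x + 4 - c - a - \<rho>)"
    have f: "\<eta> \<le> 2 - q - c" "\<eta> \<le> x + 4 - c - a - \<rho>" "\<eta> = 2 - q - c \<or> \<eta> = x + 4 - c - a - \<rho>"
      by (auto simp: \<eta>_def min_def)
    have xx: "b + g + q \<le> x" "a - 2 + g \<le> x" "x \<le> B + 2 - c" "x \<le> A - q - c" using x by auto
    show ?thesis unfolding e
    proof (intro exI conjI)
      show "q + g \<le> \<rho>" "\<eta> \<le> 2 - q - c" by fact+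
      show "\<rho> \<le> 2 - c" using r(4) xx cond bd by (elim disjE) linarith+
      show "g \<le> \<eta>" using r(4) f(3) xx cond bd ab by (elim disjE) linarith+
      show "2 - c + g \<le> \<rho> + \<eta>" using r f(3) xx by (elim disjE) linarith+
      show "x = (x - \<rho>) + \<rho>" by simp
      show "b \<le> x - \<rho>" using r(4) xx cond ab by (elim disjE) linarith+
      show "x - \<rho> \<le> B" using r by linarith
      show "x - \<rho> + 4 - c - \<eta> = x - \<rho> + 4 - c - \<eta>" ..
      show "a \<le> x - \<rho> + 4 - c - \<eta>" using f(2) by linarith
      show "x - \<rho> + 4 - c - \<eta> \<le> A" using r(3) f(3) ab by (elim disjE) linarith+
    qed
  qed
  have 3: "max (b + g + q) (a - 2 + g) \<le> min (B + 2 - c) (A - q - c)"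
    if "a - B \<le> 4 - c - g" "2 + q \<le> A - b"
    using that bd ab by (intro max.boundedI min.boundedI) linarith+
  show ?P using 1 2 3 by blast
  show "realizes (par X Y) (max (b + g + q) (a - 2 + g)) (min (B + 2 - c) (A - q - c))"
    if "a - B \<le> 4 - c - g" "2 + q \<le> A - b"
    unfolding realizes_def using 1 2 3 that by blast
qed

lemma achieves_parD:
  "parallel_ok X Y \<Longrightarrow> balanced Y \<Longrightarrow> achieves (par X Y) x \<Longrightarrow> (\<exists>y. achieves X y) \<and> (\<exists>z. achieves Y z)"
  using achieves_par_counts by blast

end

section \<open>Types of parallel nodes\<close>

text \<open>A pole is abstracted to the triple of its indegrees in the two components and its
  outdegree.\<close>

fun ptype_num :: "nat \<times> nat \<times> nat \<Rightarrow> nat \<times> nat \<times> nat \<Rightarrow> ptype \<Rightarrow> bool" where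
  "ptype_num (a, b, m) (a', b', n) (I2O lam bet) \<longleftrightarrow>
     1 \<le> lam \<and> lam \<le> bet \<and> bet \<le> 2 \<and> a + b = 2 \<and> a' + b' = 2 \<and> (m = lam \<and> n = bet \<or> n = lam \<and> m = bet)"
| "ptype_num (a, b, m) (a', b', n) (I3O d lam bet) \<longleftrightarrow>
     1 \<le> lam \<and> lam \<le> bet \<and> bet \<le> 2 \<and> \<not> (lam = 2 \<and> bet = 2) \<and>
     (a + b = 2 \<and> a' + b' = 3 \<and> (if d = Left then a' else b') = 2 \<or>
      a' + b' = 2 \<and> a + b = 3 \<and> (if d = Left then a else b) = 2) \<and>
     (m = lam \<and> n = bet \<or> n = lam \<and> m = bet)"
| "ptype_num (a, b, m) (a', b', n) (I3 d d') \<longleftrightarrow>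
     (d, d') \<in> {(Left, Left), (Left, Right), (Right, Right)} \<and> a + b = 3 \<and> a' + b' = 3 \<and>
     ((if d = Left then a else b) = 2 \<and> (if d' = Left then a' else b') = 2 \<or>
      (if d = Left then a' else b') = 2 \<and> (if d' = Left then a else b) = 2)"

text \<open>\<open>q\<close>, \<open>c\<close>, \<open>g\<close> are the numbers of full poles of
  the left child, the right child and the composition, as reals. The parameters \<gamma> and \<phi>
  of a type are just \<open>g\<close> and \<open>c\<close> in disguise.\<close>

fun ptype_counts :: "ptype \<Rightarrow> real \<Rightarrow> real \<Rightarrow> real \<Rightarrow> bool" where
  "ptype_counts (I2O lam bet) q c g \<longleftrightarrow> q = 0 \<and> c = 0 \<and> gam lam bet = g"
| "ptype_counts (I3O d lam bet) q c g \<longleftrightarrow> q + c = 1 \<and> phi d = c \<and> gam lam bet = g"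
| "ptype_counts (I3 d d') q c g \<longleftrightarrow> q + c = 2 \<and> phi d + phi d' = c \<and> g = 0"

text \<open>The possible triples at a pole: both indegrees and the outdegree are at least one and
  add up to at most four.\<close>

definition pole_states :: "(nat \<times> nat \<times> nat) set" where
  "pole_states = {(1, 1, 1), (1, 1, 2), (2, 1, 1), (1, 2, 1)}"

fun pole_counts :: "nat \<times> nat \<times> nat \<Rightarrow> int \<times> int \<times> int" where
  "pole_counts (a, b, m) = (if a = 2 then 1 else 0, if b = 2 then 1 else 0, if a + b = 2 \<and> m = 2 then 1 else 0)"

fun ptype_witness :: "nat \<times> nat \<times> nat \<Rightarrow> nat \<times> nat \<times> nat \<Rightarrow> ptype" where
  "ptype_witness (a, b, m) (a', b', n) =
     (if a + b = 2 \<and> a' + b' = 2 then I2O (min m n) (max m n)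
      else if a + b = 2 then I3O (if a' = 2 then Left else Right) (min m n) (max m n)
      else if a' + b' = 2 then I3O (if a = 2 then Left else Right) (min m n) (max m n)
      else if a = 2 then I3 Left (if a' = 2 then Left else Right)
      else I3 (if a' = 2 then Left else Right) Right)"

lemma side_not: "d \<noteq> Left \<longleftrightarrow> d = Right"
  by (cases d) auto

text \<open>Makes the description by \<open>THE\<close> usable. The type is unique because
  \<open>lam \<le> bet\<close> and the exclusion of \<open>(Right, Left)\<close> fix the order in
  which the poles are listed.\<close>

lemma ptype_num_unique:
  assumes "u \<in> pole_states" "u' \<in> pole_states"
  shows "ptype_num u u' \<tau> \<longleftrightarrow> \<tau> = ptype_witness u u'"
  using assms unfolding pole_states_def
  by (elim insertE emptyE; cases \<tau>) (auto simp: side_not split: if_splits)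

lemma ptype_witness_counts:
  assumes "u \<in> pole_states" "u' \<in> pole_states"
    and "pole_counts u = (q, c, g)" "pole_counts u' = (q', c', g')"
  shows "ptype_counts (ptype_witness u u') (of_int (q + q')) (of_int (c + c')) (of_int (g + g'))"
  using assms unfolding pole_states_def
  by (elim insertE emptyE) (auto simp: gam_def phi_def)

text \<open>One formula for all three families: substituting \<open>q = 0\<close>,
  \<open>1 - c\<close> or \<open>2 - c\<close> together with the values of \<gamma> and \<phi> gives
  the listed constants.\<close>

lemma PNode2_formula:
  assumes t: "ptype_counts (ptype_of M l r) q c g"
    and l: "rep_interval M l = (ml, Ml)" and r: "rep_interval M r = (mr, Mr)"
  shows "rep_interval M (PNode [l, r]) =
      (max (mr + c / 2 + q + g / 2) (ml + q / 2 - 2 + g / 2),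
       min (Mr + 2 - c / 2 - g / 2) (Ml - q / 2 - c - g / 2))" (is ?A)
    and "rep_condition M dm (PNode [l, r]) \<longleftrightarrow>
      spiralities (ml - Mr, Ml - mr) \<inter> spiralities (2 + (q + c) / 2, 4 - (q + c) / 2 - g) \<noteq> {}" (is ?B)
proof -
  have "?A \<and> ?B"
  proof (cases "ptype_of M l r")
    case (I2O lam bet)
    have "q = 0" "c = 0" "gam lam bet = g" using t I2O by auto
    then show ?thesis using I2O l r by (auto simp: max_def min_def)
  next
    case (I3O d lam bet)
    have e: "q = 1 - c" "phi d = c" "gam lam bet = g" using t I3O by auto
    have "2 + (q + c) / 2 = 5 / 2" "4 - (q + c) / 2 - g = 7 / 2 - g" using e by (simp_all add: field_simps)
    then show ?thesis using I3O l r e by (simp add: max_def min_def field_simps)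
  next
    case (I3 d d')
    have e: "q = 2 - c" "phi d + phi d' = c" "g = 0" using t I3 by auto
    have "2 + (q + c) / 2 = 3" "4 - (q + c) / 2 - g = 3" using e by (simp_all add: field_simps)
    moreover have "spiralities (3, 3) = {3}" by (auto simp: spiralities_def)
    ultimately show ?thesis using I3 l r e by (simp add: max_def min_def field_simps)
  qed
  then show ?A ?B by auto
qed

context rotation_system
begin

lemma fan_card: "fan v xs A \<Longrightarrow> card (out M v \<inter> A) = length xs"
  by (metis distinct_card fan_nonempty)

text \<open>The last two claims, with the fans exchanged, are for the source, where the right
  component comes first.\<close>

lemma flank_state:
  assumes "flank v xs ys"
  defines "n \<equiv> card (out M v) - (length xs + length ys)"
  shows "(length xs, length ys, n) \<in> pole_states" (is ?A)
    and "pole_counts (length xs, length ys, n) = (full_pole v xs, full_pole v ys, full_pole v (xs @ ys))" (is ?B)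
    and "(length ys, length xs, n) \<in> pole_states" (is ?C)
    and "pole_counts (length ys, length xs, n) = (full_pole v ys, full_pole v xs, full_pole v (xs @ ys))" (is ?D)
proof -
  have "(card (out M v) = 3 \<and> length xs = 1 \<and> length ys = 1)
    \<or> (card (out M v) = 4 \<and> length xs = 1 \<and> length ys = 1)
    \<or> (card (out M v) = 4 \<and> length xs = 2 \<and> length ys = 1)
    \<or> (card (out M v) = 4 \<and> length xs = 1 \<and> length ys = 2)"
    using flank_degree[OF assms(1)] by linarith
  then show ?A ?B ?C ?D
    unfolding n_def by (elim disjE; simp add: pole_states_def full_pole_def)+
qed

lemma ptype_of_counts:
  assumes ok: "parallel_ok X Y" and X: "represents X l" and Y: "represents Y r"
  shows "ptype_counts (ptype_of M l r) (of_int (full_poles X)) (of_int (full_poles Y))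
    (of_int (full_poles (par X Y)))"
proof -
  define s t where "s = psrc X" and "t = psnk X"
  have w: "psrc Y = s" "psnk Y = t" "valid X" "valid Y"
    using ok by (auto simp: parallel_ok_def s_def t_def)
  have p: "source M l = s" "sink M l = t" "source M r = s" "sink M r = t" "pert M l = pset X" "pert M r = pset Y"
    using X Y w by (auto simp: represents_def s_def t_def)
  note f = valid_fans[OF w(3), folded s_def t_def] valid_fans[OF w(4), unfolded w(1,2)]
  note fs = parallel_flank(2)[OF ok, folded s_def] and ft = parallel_flank(1)[OF ok, folded t_def]
  have dj: "pset X \<inter> pset Y = {}" using ok by (auto simp: parallel_ok_def)
  define a b m a' b' n where "a = length (fan_s X)" and "b = length (fan_s Y)"
    and "m = card (out M s) - (length (fan_s Y) + length (fan_s X))"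
    and "a' = length (fan_t X)" and "b' = length (fan_t Y)"
    and "n = card (out M t) - (length (fan_t X) + length (fan_t Y))"
  have i1: "indeg M l s = a" "indeg M r s = b" "indeg M l t = a'" "indeg M r t = b'"
    using fan_card[OF f(1)] fan_card[OF f(2)] fan_card[OF f(3)] fan_card[OF f(4)]
    unfolding indeg_def p a_def b_def a'_def b'_def by auto
  have c2: "card (out M v \<inter> (pset X \<union> pset Y)) = card (out M v \<inter> pset X) + card (out M v \<inter> pset Y)" for v
    unfolding Int_Un_distrib using dj by (intro card_Un_disjoint) auto
  have i2: "indeg M (PNode [l, r]) s = a + b" "indeg M (PNode [l, r]) t = a' + b'"
    using i1 c2[of s] c2[of t] by (simp_all add: indeg_def p)
  have o: "outdeg M (PNode [l, r]) s = m" "outdeg M (PNode [l, r]) t = n"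
    using i2 card_Diff_subset_Int[of "out M s" "pset X \<union> pset Y"]
      card_Diff_subset_Int[of "out M t" "pset X \<union> pset Y"]
    by (simp_all add: outdeg_def indeg_def p m_def n_def a_def b_def a'_def b'_def add.commute)
  have hp: "has_ptype M l r \<tau> \<longleftrightarrow> ptype_num (a, b, m) (a', b', n) \<tau>" for \<tau>
    by (cases \<tau>) (auto simp: Let_def p i1 i2 o simp del: source.simps(1) sink.simps(1))
  note st = flank_state(3,4)[OF fs] flank_state(1,2)[OF ft]
  have "ptype_of M l r = ptype_witness (a, b, m) (a', b', n)"
    unfolding ptype_of_def hp
    using ptype_num_unique st unfolding a_def b_def m_def a'_def b'_def n_def by simp
  then show ?thesis
    using ptype_witness_counts[OF st(1,3,2,4)]
    unfolding parallel_full_poles[OF ok] a_def b_def m_def a'_def b'_def n_def s_def t_def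
    by (simp add: add.commute)
qed

text \<open>The intervals of the children are integer intervals shifted by \<open>q / 2\<close> and
  \<open>c / 2\<close>, so the formula for the node turns into the integer criterion of
  \<open>realizes_par\<close>.\<close>

lemma PNode2_interval:
  assumes ok: "parallel_ok X Y" and X: "represents X l" and Y: "represents Y r" and bal: "balanced Y"
    and iX: "has_interval X (rep_interval M l)" and iY: "has_interval Y (rep_interval M r)"
  shows "rep_condition M dm (PNode [l, r]) \<longleftrightarrow> (\<exists>x. achieves (par X Y) x)"
    and "rep_condition M dm (PNode [l, r]) \<Longrightarrow> has_interval (par X Y) (rep_interval M (PNode [l, r]))"
proof -
  define q c g where "q = full_poles X" and "c = full_poles Y" and "g = full_poles (par X Y)"
  obtain a A where a: "realizes X a A" "rep_interval M l = (of_int a - of_int q / 2, of_int A - of_int q / 2)"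
    using iX unfolding has_interval_def q_def by blast
  obtain b B where b: "realizes Y b B" "rep_interval M r = (of_int b - of_int c / 2, of_int B - of_int c / 2)"
    using iY unfolding has_interval_def c_def by blast
  note pc = ptype_of_counts[OF ok X Y, folded q_def c_def g_def]
  note form = PNode2_formula[OF pc a(2) b(2)]
  note real = realizes_par[OF ok bal a(1) b(1), folded q_def c_def g_def]
  have bd: "0 \<le> q" "0 \<le> c" "0 \<le> g" "g \<le> 2 - q - c"
    using parallel_full_poles_bounds[OF ok] by (auto simp: q_def c_def g_def)
  have ab: "a \<le> A" "b \<le> B" using a b by (auto simp: realizes_def)
  \<comment> \<open>The common half-integer offset of the difference interval and of its target
    interval.\<close>
  define h where "h = (of_int c - of_int q :: real) / 2"
  have e: "of_int a - of_int q / 2 - (of_int B - of_int c / 2) = of_int (a - B) + h"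
    "of_int A - of_int q / 2 - (of_int b - of_int c / 2) = of_int (A - b) + h"
    "2 + (of_int q + of_int c) / 2 = of_int (2 + q) + h"
    "4 - (of_int q + of_int c) / 2 - of_int g = of_int (4 - c - g) + h"
    by (simp_all add: h_def field_simps)
  have cond: "rep_condition M dm (PNode [l, r]) \<longleftrightarrow> a - B \<le> 4 - c - g \<and> 2 + q \<le> A - b"
    unfolding form(2) e spiralities_meet using bd ab by auto
  then show "rep_condition M dm (PNode [l, r]) \<longleftrightarrow> (\<exists>x. achieves (par X Y) x)"
    using real(1) by simp
  assume "rep_condition M dm (PNode [l, r])"
  then have r: "realizes (par X Y) (max (b + g + q) (a - 2 + g)) (min (B + 2 - c) (A - q - c))"
    using cond real(2) by blast
  have "rep_interval M (PNode [l, r]) =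
    (of_int (max (b + g + q) (a - 2 + g)) - of_int g / 2, of_int (min (B + 2 - c) (A - q - c)) - of_int g / 2)"
    unfolding form(1) by (auto simp: max_def min_def field_simps)
  then show "has_interval (par X Y) (rep_interval M (PNode [l, r]))"
    unfolding has_interval_def g_def[symmetric] using r by blast
qed

lemma PNode3_interval:
  assumes ok: "parallel_ok X (par Y Z)" and ok': "parallel_ok Y Z" and bal: "balanced Y" "balanced Z"
    and iX: "has_interval X (rep_interval M l)" and iY: "has_interval Y (rep_interval M c)"
    and iZ: "has_interval Z (rep_interval M r)"
  shows "rep_condition M dm (PNode [l, c, r]) \<longleftrightarrow> (\<exists>x. achieves (par X (par Y Z)) x)"
    and "rep_condition M dm (PNode [l, c, r]) \<Longrightarrow>
      has_interval (par X (par Y Z)) (rep_interval M (PNode [l, c, r]))"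
proof -
  have w: "psrc Y = psrc X" "psnk Y = psnk X" "psrc Z = psrc X" "psnk Z = psnk X"
    using ok ok' by (auto simp: parallel_ok_def par_def)
  have len: "length (fan_s X) = 1" "length (fan_s Y) = 1" "length (fan_s Z) = 1" "card (out M (psrc X)) = 4"
    "length (fan_t X) = 1" "length (fan_t Y) = 1" "length (fan_t Z) = 1" "card (out M (psnk X)) = 4"
    using flank_degree[OF parallel_flank(1)[OF ok]] flank_degree[OF parallel_flank(2)[OF ok]]
      flank_degree(3,4)[OF parallel_flank(1)[OF ok']] flank_degree(3,4)[OF parallel_flank(2)[OF ok']]
    by (simp_all add: par_def)
  \<comment> \<open>Three components use three of the four arcs at each pole. The right two together
    have indegree and outdegree two there, so only the intermediate composition has full
    poles.\<close>
  have fp: "full_poles X = 0" "full_poles Y = 0" "full_poles Z = 0" "full_poles (par Y Z) = 2"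
    "full_poles (par X (par Y Z)) = 0"
    using w len by (simp_all add: full_poles_def full_pole_def par_def)
  obtain a A where a: "realizes X a A" "rep_interval M l = (of_int a, of_int A)"
    using iX unfolding has_interval_def fp by auto
  obtain b B where b: "realizes Y b B" "rep_interval M c = (of_int b, of_int B)"
    using iY unfolding has_interval_def fp by auto
  obtain d D where d: "realizes Z d D" "rep_interval M r = (of_int d, of_int D)"
    using iZ unfolding has_interval_def fp by auto
  have le: "a \<le> A" "b \<le> B" "d \<le> D" using a b d by (auto simp: realizes_def)
  define u U where "u = max (a - 2) (max b (d + 2))" and "U = min (A - 2) (min B (D + 2))"
  note r1 = realizes_par[OF ok' bal(2) b(1) d(1), unfolded fp]
  have bYZ: "balanced (par Y Z)" using balanced_par[OF ok' bal] .
  have main: "(\<exists>x. achieves (par X (par Y Z)) x) \<longleftrightarrow> u \<le> U"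
    "u \<le> U \<Longrightarrow> realizes (par X (par Y Z)) u U"
  proof -
    \<comment> \<open>The condition for the pair \<open>Y\<close>, \<open>Z\<close> alone follows
      from either side of the equivalence, so the case in which it fails is settled for
      both.\<close>
    have D1: "(\<exists>x. achieves (par X (par Y Z)) x) \<Longrightarrow> b - D \<le> 2 \<and> 2 \<le> B - d"
      using achieves_parD[OF ok bYZ] r1(1) by auto
    show "(\<exists>x. achieves (par X (par Y Z)) x) \<longleftrightarrow> u \<le> U"
    proof (cases "b - D \<le> 2 \<and> 2 \<le> B - d")
      case True
      have yz: "realizes (par Y Z) (max (d + 2) b) (min (D + 2) B)"
        using r1(2) True by (simp add: add.commute)
      show ?thesis using realizes_par(1)[OF ok bYZ a(1) yz, unfolded fp] True le
        unfolding u_def U_def by auto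
    next
      case False
      then show ?thesis using D1 unfolding u_def U_def by auto
    qed
    assume uU: "u \<le> U"
    have yz: "realizes (par Y Z) (max (d + 2) b) (min (D + 2) B)"
      using r1(2) uU unfolding u_def U_def by (simp add: add.commute)
    have "a - min (D + 2) B \<le> 2" "2 \<le> A - max (d + 2) b"
      using uU unfolding u_def U_def by linarith+
    then have "realizes (par X (par Y Z)) (max (max (d + 2) b) (a - 2)) (min (min (D + 2) B) (A - 2))"
      using realizes_par(2)[OF ok bYZ a(1) yz, unfolded fp] by simp
    moreover have "max (max (d + 2) b) (a - 2) = u" "min (min (D + 2) B) (A - 2) = U"
      unfolding u_def U_def by (simp_all add: max.commute max.left_commute min.commute min.left_commute)
    ultimately show "realizes (par X (par Y Z)) u U" by simp
  qed
  have s: "spiralities (of_int x, of_int y) = of_int ` {x..y}" for x y :: int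
    using spiralities_shift[of x 0 y] by simp
  have "rep_condition M dm (PNode [l, c, r]) \<longleftrightarrow>
     spiralities (of_int (a - 2), of_int (A - 2)) \<inter> spiralities (of_int b, of_int B) \<inter>
       spiralities (of_int (d + 2), of_int (D + 2)) \<noteq> {}"
    using a b d by simp
  also have "\<dots> \<longleftrightarrow> u \<le> U"
    unfolding s
  proof
    assume "of_int ` {a - 2..A - 2} \<inter> of_int ` {b..B} \<inter> (of_int ` {d + 2..D + 2} :: real set) \<noteq> {}"
    then show "u \<le> U" unfolding u_def U_def by auto
  next
    assume "u \<le> U"
    then have "real_of_int u \<in> of_int ` {a - 2..A - 2} \<inter> of_int ` {b..B} \<inter> of_int ` {d + 2..D + 2}"
      unfolding u_def U_def by auto
    then show "of_int ` {a - 2..A - 2} \<inter> of_int ` {b..B} \<inter> (of_int ` {d + 2..D + 2} :: real set) \<noteq> {}"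
      by blast
  qed
  finally have cond: "rep_condition M dm (PNode [l, c, r]) \<longleftrightarrow> u \<le> U" .
  then show "rep_condition M dm (PNode [l, c, r]) \<longleftrightarrow> (\<exists>x. achieves (par X (par Y Z)) x)"
    using main(1) by simp
  have "rep_interval M (PNode [l, c, r]) = (of_int u, of_int U)"
    using a b d by (simp add: u_def U_def of_int_max of_int_min)
  then show "has_interval (par X (par Y Z)) (rep_interval M (PNode [l, c, r]))"
    if "rep_condition M dm (PNode [l, c, r])"
    using main(2) cond that unfolding has_interval_def fp by auto
qed

text \<open>Two consecutive children of an S-node are not both Q*-nodes, so by this lemma one of
  them has indegree at least two at the joint and the joint turn is fixed.\<close>

lemma PNode_fans:
  assumes ok: "proper_node (PNode ts)"
  shows "2 \<le> length (fan_s (piece_of M (PNode ts)))" "2 \<le> length (fan_t (piece_of M (PNode ts)))"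
proof -
  have rep: "\<forall>\<mu>\<in>set ts. represents (piece_of M \<mu>) \<mu>"
    using represents_piece_of proper_PNode_child[OF ok] by (metis in_set_conv_nth)
  have "2 \<le> length ts" using ok by (auto simp: proper_node_def)
  then obtain x y r where ts: "ts = x # y # r" by (cases ts; cases "tl ts") auto
  have "parallel_ok (piece_of M x) (fold_nonempty par (piece_of M y # map (piece_of M) r))"
    using PNode_parallel_chain[OF ok rep] ts by simp
  from flank_degree(3,4)[OF parallel_flank(1)[OF this]] flank_degree(3,4)[OF parallel_flank(2)[OF this]]
  show "2 \<le> length (fan_s (piece_of M (PNode ts)))" "2 \<le> length (fan_t (piece_of M (PNode ts)))"
    by (simp_all add: ts par_def[of "piece_of M x"])
qed

text \<open>The last clause speaks of all descendants: an interval formula means something only if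
  the conditions below hold, so realizability must first be passed to the children. The flag
  \<open>dm\<close> may be arbitrary since a root never occurs below a proper node.\<close>

theorem node_intervals:
  assumes "proper_node \<nu>"
  shows "balanced (piece_of M \<nu>) \<and>
    ((\<forall>\<nu>'\<in>nodes \<nu>. rep_condition M dm \<nu>') \<longrightarrow> has_interval (piece_of M \<nu>) (rep_interval M \<nu>)) \<and>
    ((\<exists>x. achieves (piece_of M \<nu>) x) \<longrightarrow> (\<forall>\<nu>'\<in>nodes \<nu>. rep_condition M dm \<nu>'))"
  using assms
proof (induction \<nu>)
  case (QNode p)
  let ?F = "fold_nonempty ser (map (edge_piece M) p)"
  note ch = QNode_series_chain[OF QNode]
  have p: "p \<noteq> []" using QNode by (simp add: proper_node_def)
  have l: "length (fan_s ?F) = 1" "length (fan_t ?F) = 1"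
    using fold_ser(4,5)[of "map (edge_piece M) p"] p by (simp_all add: hd_map last_map edge_piece_def)
  have f: "full_poles ?F = 0" using l by (simp add: full_poles_def full_pole_def)
  have "realizes ?F (1 - int (length p)) (int (length p) - 1)"
    unfolding realizes_def path_achieves[OF ch] using p by (cases p) auto
  then have "has_interval ?F (rep_interval M (QNode p))"
    unfolding has_interval_def f by (intro exI conjI) (assumption, simp)
  moreover have "balanced ?F"
    using edge_balanced by (intro series_chain_balanced[OF ch]) auto
  ultimately show ?case by simp
next
  case (SNode ts)
  have pn: "proper_node \<mu>" if "\<mu> \<in> set ts" for \<mu>
    using that proper_SNode_child[OF SNode.prems] by (metis in_set_conv_nth)
  have rep: "\<forall>\<mu>\<in>set ts. represents (piece_of M \<mu>) \<mu>" using represents_piece_of pn by blast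
  note ch = SNode_series_chain[OF SNode.prems rep]
  have sp: "spq_node M (SNode ts)" using SNode.prems by (simp add: proper_node_def)
  have long: "2 \<le> length (fan_s (piece_of M \<mu>)) \<and> 2 \<le> length (fan_t (piece_of M \<mu>))"
    if "\<mu> \<in> set ts" "\<not> is_QNode \<mu>" for \<mu>
  proof (cases \<mu>)
    case (PNode us)
    then show ?thesis using PNode_fans[of us] pn[OF that(1)] by blast
  qed (use that sp in auto)
  have n: "\<forall>i. Suc i < length (map (piece_of M) ts) \<longrightarrow>
     \<not> (length (fan_t (map (piece_of M) ts ! i)) = 1 \<and> length (fan_s (map (piece_of M) ts ! Suc i)) = 1)"
  proof (intro allI impI)
    fix i assume "Suc i < length (map (piece_of M) ts)"
    then have i: "Suc i < length ts" by simp
    then have "\<not> is_QNode (ts ! i) \<or> \<not> is_QNode (ts ! Suc i)" using sp by simp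
    then show "\<not> (length (fan_t (map (piece_of M) ts ! i)) = 1 \<and>
        length (fan_s (map (piece_of M) ts ! Suc i)) = 1)"
      using long[of "ts ! i"] long[of "ts ! Suc i"] i by auto
  qed
  show ?case
  proof (intro conjI impI)
    show "balanced (piece_of M (SNode ts))"
      using series_chain_balanced[OF ch] SNode.IH pn by auto
    assume c: "\<forall>\<nu>'\<in>nodes (SNode ts). rep_condition M dm \<nu>'"
    have "\<forall>i<length (map (piece_of M) ts).
        has_interval (map (piece_of M) ts ! i) (map (rep_interval M) ts ! i)"
    proof (intro allI impI)
      fix i assume "i < length (map (piece_of M) ts)"
      then have i: "i < length ts" "ts ! i \<in> set ts" by auto
      then have "\<forall>\<nu>'\<in>nodes (ts ! i). rep_condition M dm \<nu>'" using c by auto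
      then show "has_interval (map (piece_of M) ts ! i) (map (rep_interval M) ts ! i)"
        using SNode.IH[OF i(2)] pn[OF i(2)] i by simp
    qed
    from series_chain_interval[OF ch _ this n]
    show "has_interval (piece_of M (SNode ts)) (rep_interval M (SNode ts))"
      by (simp add: comp_def)
  next
    assume "\<exists>x. achieves (piece_of M (SNode ts)) x"
    then have "\<forall>X\<in>set (map (piece_of M) ts). \<exists>y. achieves X y"
      using series_chain_achievesD[OF ch] by auto
    then show "\<forall>\<nu>'\<in>nodes (SNode ts). rep_condition M dm \<nu>'"
      using SNode.IH pn by auto
  qed
next
  case (PNode ts)
  have pn: "proper_node \<mu>" if "\<mu> \<in> set ts" for \<mu>
    using that proper_PNode_child[OF PNode.prems] by (metis in_set_conv_nth)
  have rep: "\<forall>\<mu>\<in>set ts. represents (piece_of M \<mu>) \<mu>" using represents_piece_of pn by blast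
  note ch = PNode_parallel_chain[OF PNode.prems rep]
  have sp: "length ts = 2 \<or> length ts = 3" using PNode.prems by (auto simp: proper_node_def)
  have bal: "balanced (piece_of M \<mu>)"
    and int: "\<forall>\<nu>'\<in>nodes \<mu>. rep_condition M dm \<nu>' \<Longrightarrow> has_interval (piece_of M \<mu>) (rep_interval M \<mu>)"
    and ach: "achieves (piece_of M \<mu>) x \<Longrightarrow> \<forall>\<nu>'\<in>nodes \<mu>. rep_condition M dm \<nu>'"
    if "\<mu> \<in> set ts" for \<mu> x
    using PNode.IH[OF that] pn[OF that] by blast+
  from sp show ?case
  proof
    assume "length ts = 2"
    then obtain l r where ts: "ts = [l, r]" by (auto simp: length_Suc_conv numeral_2_eq_2)
    let ?X = "piece_of M l" and ?Y = "piece_of M r"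
    have ok: "parallel_ok ?X ?Y" using ch ts by simp
    have m: "l \<in> set ts" "r \<in> set ts" using ts by auto
    have R: "represents ?X l" "represents ?Y r" using rep m by auto
    have P: "piece_of M (PNode ts) = par ?X ?Y" using ts by simp
    have N: "nodes (PNode ts) = insert (PNode [l, r]) (nodes l \<union> nodes r)" using ts by simp
    note I = PNode2_interval[OF ok R bal[OF m(2)] int[OF m(1)] int[OF m(2)]]
    show ?case unfolding P N
    proof (intro conjI impI)
      show "balanced (par ?X ?Y)" using balanced_par[OF ok bal[OF m(1)] bal[OF m(2)]] .
      assume "\<forall>\<nu>'\<in>insert (PNode [l, r]) (nodes l \<union> nodes r). rep_condition M dm \<nu>'"
      then show "has_interval (par ?X ?Y) (rep_interval M (PNode ts))"
        unfolding ts by (intro I(2)[of dm]) blast+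
    next
      assume h: "\<exists>x. achieves (par ?X ?Y) x"
      then have "(\<exists>x. achieves ?X x) \<and> (\<exists>x. achieves ?Y x)" using achieves_parD[OF ok bal[OF m(2)]] by blast
      then have lr: "\<forall>\<nu>'\<in>nodes l. rep_condition M dm \<nu>'" "\<forall>\<nu>'\<in>nodes r. rep_condition M dm \<nu>'"
        using ach[OF m(1)] ach[OF m(2)] by blast+
      then have "rep_condition M dm (PNode [l, r])" using I(1)[of dm] h by blast
      then show "\<forall>\<nu>'\<in>insert (PNode [l, r]) (nodes l \<union> nodes r). rep_condition M dm \<nu>'" using lr by blast
    qed
  next
    assume "length ts = 3"
    then obtain l c r where ts: "ts = [l, c, r]" by (auto simp: length_Suc_conv numeral_3_eq_3)
    let ?X = "piece_of M l" and ?Y = "piece_of M c" and ?Z = "piece_of M r"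
    have ok: "parallel_ok ?X (par ?Y ?Z)" "parallel_ok ?Y ?Z" using ch ts by simp_all
    have m: "l \<in> set ts" "c \<in> set ts" "r \<in> set ts" using ts by auto
    have P: "piece_of M (PNode ts) = par ?X (par ?Y ?Z)" using ts by simp
    have N: "nodes (PNode ts) = insert (PNode [l, c, r]) (nodes l \<union> nodes c \<union> nodes r)" using ts by auto
    have bYZ: "balanced (par ?Y ?Z)" using balanced_par[OF ok(2) bal[OF m(2)] bal[OF m(3)]] .
    note I = PNode3_interval[OF ok bal[OF m(2)] bal[OF m(3)] int[OF m(1)] int[OF m(2)] int[OF m(3)]]
    show ?case unfolding P N
    proof (intro conjI impI)
      show "balanced (par ?X (par ?Y ?Z))" using balanced_par[OF ok(1) bal[OF m(1)] bYZ] .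
      assume "\<forall>\<nu>'\<in>insert (PNode [l, c, r]) (nodes l \<union> nodes c \<union> nodes r). rep_condition M dm \<nu>'"
      then show "has_interval (par ?X (par ?Y ?Z)) (rep_interval M (PNode ts))"
        unfolding ts by (intro I(2)[of dm]) blast+
    next
      assume h: "\<exists>x. achieves (par ?X (par ?Y ?Z)) x"
      then have "(\<exists>x. achieves ?X x) \<and> (\<exists>x. achieves (par ?Y ?Z) x)" using achieves_parD[OF ok(1) bYZ] by blast
      then have "(\<exists>x. achieves ?X x) \<and> (\<exists>x. achieves ?Y x) \<and> (\<exists>x. achieves ?Z x)"
        using achieves_parD[OF ok(2) bal[OF m(3)]] by blast
      then have lr: "\<forall>\<nu>'\<in>nodes l. rep_condition M dm \<nu>'" "\<forall>\<nu>'\<in>nodes c. rep_condition M dm \<nu>'"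
          "\<forall>\<nu>'\<in>nodes r. rep_condition M dm \<nu>'"
        using ach[OF m(1)] ach[OF m(2)] ach[OF m(3)] by blast+
      then have "rep_condition M dm (PNode [l, c, r])" using I(1)[of dm] h by blast
      then show "\<forall>\<nu>'\<in>insert (PNode [l, c, r]) (nodes l \<union> nodes c \<union> nodes r). rep_condition M dm \<nu>'"
        using lr by blast
    qed
  qed
qed (simp add: proper_node_def)

end

section \<open>Rectilinear representations as turns\<close>

fun turn_of :: "nat \<Rightarrow> int" where
  "turn_of n = (if n = 90 then 1 else if n = 180 then 0 else if n = 270 then -1 else -2)"

declare turn_of.simps [simp del]

lemma turn_of_values:
  assumes "n \<in> {90, 180, 270, 360}"
  shows "90 * turn_of n = 180 - int n" "turn_of n \<in> {-2, -1, 0, 1}" "turn_of n = -2 \<longleftrightarrow> n = 360"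
    "turn_of n = (if n = 90 then 1 else 0) - (if n = 270 then 1 else 0) - 2 * (if n = 360 then 1 else 0)"
    "180 \<le> n \<longleftrightarrow> turn_of n \<le> 0"
  using assms by (auto simp: turn_of.simps)

lemma num_angles_no_bends: "num_angles ang (\<lambda>_. []) f x = int (card {a \<in> f. ang a = x})"
  by (simp add: num_angles_def)

lemma sum_turn_of:
  assumes "finite f" "\<forall>a\<in>f. ang a \<in> {90, 180, 270, 360}"
  shows "(\<Sum>a\<in>f. turn_of (ang a)) =
    num_angles ang (\<lambda>_. []) f 90 - num_angles ang (\<lambda>_. []) f 270 - 2 * num_angles ang (\<lambda>_. []) f 360"
proof -
  have c: "int (card {a \<in> f. ang a = x}) = (\<Sum>a\<in>f. if ang a = x then 1 else 0)" for x
    using assms(1) by (simp add: sum.If_cases Int_def)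
  have "(\<Sum>a\<in>f. turn_of (ang a)) = (\<Sum>a\<in>f. (if ang a = 90 then 1 else 0) -
      (if ang a = 270 then 1 else 0) - 2 * (if ang a = 360 then 1 else 0))"
    using assms(2) by (intro sum.cong refl turn_of_values(4)) auto
  then show ?thesis
    unfolding num_angles_no_bends c by (simp only: sum_subtractf sum_distrib_left)
qed

context rotation_system
begin

text \<open>The counterpart of \<open>good\<close> for whole graphs; it admits the turn -2 of a full
  angle at a vertex of degree one.\<close>

definition vertex_ok :: "('a \<Rightarrow> int) \<Rightarrow> 'v \<Rightarrow> bool" where
  "vertex_ok \<phi> v \<longleftrightarrow> (\<forall>x\<in>out M v. \<phi> x \<in> {-2, -1, 0, 1} \<and> (\<phi> x = -2 \<longrightarrow> card (out M v) = 1)) \<and>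
     (\<Sum>x\<in>out M v. \<phi> x) = 2 * int (card (out M v)) - 4"

definition turning :: "('a \<Rightarrow> int) \<Rightarrow> bool" where
  "turning \<phi> \<longleftrightarrow> (\<forall>v\<in>vertices M. vertex_ok \<phi> v) \<and>
     (\<forall>f\<in>faces M. (\<Sum>a\<in>f. \<phi> (opp M a)) = (if f = outer M then -4 else 4))"

lemma face_darts: "f \<in> faces M \<Longrightarrow> f \<subseteq> darts M"
proof -
  assume "f \<in> faces M"
  then obtain a where a: "a \<in> darts M" "f = orbit (\<lambda>b. rot M (opp M b)) a"
    by (auto simp: faces_def face_of_def)
  have "x \<in> darts M" if "x \<in> orbit (\<lambda>b. rot M (opp M b)) a" for x
    using that by induction (use a in auto)
  then show ?thesis using a by blast
qed

lemma sum_in_arcs: "(\<Sum>a\<in>in_arcs (dgraph M) v. h a) = (\<Sum>x\<in>out M v. h (opp M x))"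
proof -
  have "in_arcs (dgraph M) v = opp M ` out M v"
    using bidirected by (rule bidirected_digraph.in_arcs_eq)
  then show ?thesis by (simp add: sum.reindex inj_on_def)
qed

lemma turning_of_rep:
  assumes "rectilinear_rep M ang"
  shows "turning (\<lambda>x. turn_of (ang (opp M x)))"
proof -
  have val: "ang a \<in> {90, 180, 270, 360}" "ang a = 360 \<longrightarrow> card (out M (tgt M a)) = 1" if "a \<in> darts M" for a
    using assms that by (auto simp: rectilinear_rep_def orthogonal_rep_def out_degree_def)
  have vert: "(\<Sum>a\<in>in_arcs (dgraph M) v. ang a) = 360" if "v \<in> vertices M" for v
    using assms that by (auto simp: rectilinear_rep_def orthogonal_rep_def)
  have face: "num_angles ang (\<lambda>_. []) f 90 - num_angles ang (\<lambda>_. []) f 270 -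
      2 * num_angles ang (\<lambda>_. []) f 360 = (if f = outer M then - 4 else 4)" if "f \<in> faces M" for f
    using assms that by (auto simp: rectilinear_rep_def orthogonal_rep_def)
  have "vertex_ok (\<lambda>x. turn_of (ang (opp M x))) v" if v: "v \<in> vertices M" for v
  proof -
    have x: "ang (opp M x) \<in> {90, 180, 270, 360}" "ang (opp M x) = 360 \<longrightarrow> card (out M v) = 1"
      if "x \<in> out M v" for x
      using val[of "opp M x"] outD(1,2)[OF that] by auto
    have "90 * (\<Sum>x\<in>out M v. turn_of (ang (opp M x))) = (\<Sum>x\<in>out M v. 180 - int (ang (opp M x)))"
      unfolding sum_distrib_left using x(1) by (intro sum.cong refl turn_of_values(1)) auto
    also have "\<dots> = 180 * int (card (out M v)) - int (\<Sum>x\<in>out M v. ang (opp M x))"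
      by (simp add: sum_subtractf)
    also have "(\<Sum>x\<in>out M v. ang (opp M x)) = 360"
      using vert[OF v] unfolding sum_in_arcs .
    finally have "(\<Sum>x\<in>out M v. turn_of (ang (opp M x))) = 2 * int (card (out M v)) - 4" by simp
    moreover have "turn_of (ang (opp M x)) \<in> {-2, -1, 0, 1} \<and>
        (turn_of (ang (opp M x)) = -2 \<longrightarrow> card (out M v) = 1)" if "x \<in> out M v" for x
      using x[OF that] turn_of_values(2,3)[OF x(1)[OF that]] by simp
    ultimately show ?thesis unfolding vertex_ok_def by blast
  qed
  moreover have "(\<Sum>a\<in>f. turn_of (ang (opp M (opp M a)))) = (if f = outer M then -4 else 4)"
    if f: "f \<in> faces M" for f
  proof -
    have "finite f" "\<forall>a\<in>f. ang a \<in> {90, 180, 270, 360}"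
      using face_darts[OF f] finite_darts finite_subset val(1) by (blast, blast)
    then show ?thesis using sum_turn_of[of f ang] face[OF f] by simp
  qed
  ultimately show ?thesis unfolding turning_def by blast
qed

lemma rep_of_turning:
  assumes "turning \<phi>"
  shows "rectilinear_planar M"
proof -
  define ang where "ang a = nat (180 - 90 * \<phi> (opp M a))" for a
  have val: "ang a \<in> {90, 180, 270, 360} \<and> turn_of (ang a) = \<phi> (opp M a) \<and>
      (ang a = 360 \<longrightarrow> card (out M (tgt M a)) = 1)" if a: "a \<in> darts M" for a
  proof -
    have o: "opp M a \<in> out M (tgt M a)" unfolding in_out_iff using a by simp
    have "vertex_ok \<phi> (tgt M a)" using assms a by (simp add: turning_def)
    then have "\<phi> (opp M a) \<in> {-2, -1, 0, 1}" "\<phi> (opp M a) = -2 \<longrightarrow> card (out M (tgt M a)) = 1"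
      using o unfolding vertex_ok_def by blast+
    then show ?thesis by (auto simp: ang_def turn_of.simps)
  qed
  have "(\<Sum>a\<in>in_arcs (dgraph M) v. ang a) = 360" if v: "v \<in> vertices M" for v
  proof -
    have "ang (opp M x) \<in> {90, 180, 270, 360}" "turn_of (ang (opp M x)) = \<phi> x" if "x \<in> out M v" for x
      using val[of "opp M x"] outD(1)[OF that] by auto
    then have iv: "int (ang (opp M x)) = 180 - 90 * \<phi> x" if "x \<in> out M v" for x
      using turn_of_values(1)[of "ang (opp M x)"] that by fastforce
    have "int (\<Sum>x\<in>out M v. ang (opp M x)) = (\<Sum>x\<in>out M v. 180 - 90 * \<phi> x)"
      unfolding of_nat_sum by (intro sum.cong refl iv)
    also have "\<dots> = 180 * int (card (out M v)) - 90 * (\<Sum>x\<in>out M v. \<phi> x)"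
      by (simp add: sum_subtractf sum_distrib_left)
    also have "(\<Sum>x\<in>out M v. \<phi> x) = 2 * int (card (out M v)) - 4"
      using assms v by (simp add: turning_def vertex_ok_def)
    finally have "int (\<Sum>x\<in>out M v. ang (opp M x)) = int 360" by simp
    then show ?thesis unfolding sum_in_arcs by (simp only: of_nat_eq_iff)
  qed
  moreover have "num_angles ang (\<lambda>_. []) f 90 - num_angles ang (\<lambda>_. []) f 270 -
      2 * num_angles ang (\<lambda>_. []) f 360 = (if f = outer M then - 4 else 4)" if f: "f \<in> faces M" for f
  proof -
    have fd: "f \<subseteq> darts M" by (rule face_darts[OF f])
    then have "finite f" using finite_darts finite_subset by blast
    moreover have "\<forall>a\<in>f. ang a \<in> {90, 180, 270, 360}" using val fd by blast
    ultimately have "num_angles ang (\<lambda>_. []) f 90 - num_angles ang (\<lambda>_. []) f 270 -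
      2 * num_angles ang (\<lambda>_. []) f 360 = (\<Sum>a\<in>f. turn_of (ang a))" using sum_turn_of by metis
    also have "\<dots> = (\<Sum>a\<in>f. \<phi> (opp M a))" using val fd by (intro sum.cong) auto
    finally show ?thesis using assms f by (simp add: turning_def)
  qed
  ultimately have "rectilinear_rep M ang"
    unfolding rectilinear_rep_def orthogonal_rep_def out_degree_def using val by simp
  then show ?thesis unfolding rectilinear_planar_def by blast
qed

section \<open>Vertices of degree at least two\<close>

lemma good_imp_vertex_ok: "good \<theta> v \<Longrightarrow> vertex_ok \<theta> v"
  unfolding good_def vertex_ok_def by fastforce

lemma vertex_ok_imp_good:
  assumes "vertex_ok \<theta> v" "2 \<le> card (out M v)"
  shows "good \<theta> v"
  using assms unfolding good_def vertex_ok_def by fastforce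

lemma face_sum_set: "distinct f \<Longrightarrow> (\<Sum>a\<in>set f. \<phi> (opp M a)) = face_sum \<phi> f"
  by (simp add: face_sum_def sum_list_distinct_conv_sum_set)

text \<open>On owned vertices this makes \<open>good\<close> and \<open>vertex_ok\<close>
  equivalent, which links local representations to rectilinear ones.\<close>

definition degree_ge_2 :: "('v, 'a) piece \<Rightarrow> bool" where
  "degree_ge_2 X \<longleftrightarrow> (\<forall>v\<in>own X. 2 \<le> card (out M v))"

lemma degree_ge_2_ser: "series_ok X Y \<Longrightarrow> degree_ge_2 X \<Longrightarrow> degree_ge_2 Y \<Longrightarrow> degree_ge_2 (ser X Y)"
  using series_degree[of X Y] by (auto simp: degree_ge_2_def ser_def simp del: in_out_arcs_conv)

lemma degree_ge_2_par: "parallel_ok X Y \<Longrightarrow> degree_ge_2 X \<Longrightarrow> degree_ge_2 Y \<Longrightarrow> degree_ge_2 (par X Y)"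
  using flank_degree[OF parallel_flank(1), of X Y] flank_degree[OF parallel_flank(2), of X Y]
  by (auto simp: degree_ge_2_def par_def)

lemma series_chain_degree:
  "series_chain Xs \<Longrightarrow> \<forall>X\<in>set Xs. degree_ge_2 X \<Longrightarrow> degree_ge_2 (fold_nonempty ser Xs)"
  by (induction Xs rule: series_chain.induct) (auto intro: degree_ge_2_ser)

lemma parallel_chain_degree:
  "parallel_chain Xs \<Longrightarrow> \<forall>X\<in>set Xs. degree_ge_2 X \<Longrightarrow> degree_ge_2 (fold_nonempty par Xs)"
  by (induction Xs rule: parallel_chain.induct) (auto intro: degree_ge_2_par)

lemma node_degree: "proper_node \<nu> \<Longrightarrow> degree_ge_2 (piece_of M \<nu>)"
proof (induction \<nu>)
  case (QNode p)
  then show ?case using series_chain_degree[OF QNode_series_chain[OF QNode]]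
    by (auto simp: degree_ge_2_def edge_piece_def)
next
  case (SNode ts)
  have pn: "proper_node \<mu>" if "\<mu> \<in> set ts" for \<mu>
    using that proper_SNode_child[OF SNode.prems] by (metis in_set_conv_nth)
  have rep: "\<forall>\<mu>\<in>set ts. represents (piece_of M \<mu>) \<mu>" using represents_piece_of pn by blast
  show ?case
    using series_chain_degree[OF SNode_series_chain[OF SNode.prems rep]] SNode.IH pn by simp
next
  case (PNode ts)
  have pn: "proper_node \<mu>" if "\<mu> \<in> set ts" for \<mu>
    using that proper_PNode_child[OF PNode.prems] by (metis in_set_conv_nth)
  have rep: "\<forall>\<mu>\<in>set ts. represents (piece_of M \<mu>) \<mu>" using represents_piece_of pn by blast
  show ?case
    using parallel_chain_degree[OF PNode_parallel_chain[OF PNode.prems rep]] PNode.IH pn by simp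
qed (simp add: proper_node_def)

text \<open>Guarantees that every vertex is an end of some arc and hence is owned by the root piece
  or is an end of the reference edge.\<close>

lemma connected_out_nonempty:
  assumes c: "connected (dgraph M)" and v: "v \<in> vertices M" and a: "a \<in> darts M"
  shows "out M v \<noteq> {}"
proof (cases "v = src M a")
  case True
  then show ?thesis using a in_out_iff by blast
next
  case False
  let ?S = "mk_symmetric (dgraph M)"
  have "v \<rightarrow>\<^sup>*\<^bsub>with_proj ?S\<^esub> src M a"
    using c v src_vertex[OF a] by (auto simp: connected_def strongly_connected_def mk_symmetric_def)
  then have "\<exists>w. (v, w) \<in> parcs ?S"
    using False by (cases rule: pre_digraph.converse_reachable_cases) auto
  then obtain w where "(v, w) \<in> parcs ?S" by blast
  then obtain b where b: "b \<in> darts M" "v = src M b \<or> v = tgt M b" by (auto simp: mk_symmetric_def)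
  then have "b \<in> out M v \<or> opp M b \<in> out M v" unfolding in_out_iff by auto
  then show ?thesis by blast
qed

end

lemma rotation_system_plane: "plane_graph M \<Longrightarrow> four_graph M \<Longrightarrow> rotation_system M"
  unfolding plane_graph_def four_graph_def rotation_system_def out_degree_def by blast

section \<open>The reference edge\<close>

context rotation_system
begin

lemma pole_sum:
  assumes "distinct xs" "xs \<noteq> []"
  shows "(\<Sum>x\<in>set xs. h x) = (h (last xs) :: int) + (\<Sum>x\<in>set xs - {last xs}. h x)"
    and "card (set xs - {last xs}) = length xs - 1"
  using assms by (simp_all add: sum.remove[of "set xs" "last xs"] distinct_card)

text \<open>Deleting \<open>\<epsilon>\<close> adds two angles, and 2 - (\<alpha> + \<beta>)/90 is
  the sum of their turns minus 2. For a remaining single arc the two angles must be straight to give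
  360 degrees.\<close>

lemma merge_pole:
  assumes o: "out M v = insert \<epsilon> (set xs)" "\<epsilon> \<notin> set xs" "distinct xs" "xs \<noteq> []"
    and g: "good \<theta> v" and z: "length xs = 1 \<Longrightarrow> \<theta> (last xs) = 0 \<and> \<theta> \<epsilon> = 0"
    and \<phi>: "\<phi> (last xs) = \<theta> (last xs) + \<theta> \<epsilon> - 2" "\<And>x. x \<in> set xs \<Longrightarrow> x \<noteq> last xs \<Longrightarrow> \<phi> x = \<theta> x"
  shows "(\<forall>x\<in>set xs. \<phi> x \<in> {-2, -1, 0, 1} \<and> (\<phi> x = -2 \<longrightarrow> length xs = 1)) \<and>
    (\<Sum>x\<in>set xs. \<phi> x) = 2 * int (length xs) - 4"
proof -
  have c: "card (out M v) = length xs + 1" using o by (simp add: distinct_card)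
  have val: "\<theta> x \<in> {-1, 0, 1}" if "x \<in> out M v" for x using g that unfolding good_def by blast
  have st: "(\<Sum>x\<in>out M v. \<theta> x) = \<theta> \<epsilon> + (\<Sum>x\<in>set xs. \<theta> x)" using o by simp
  then have s: "\<theta> \<epsilon> + \<theta> (last xs) + (\<Sum>x\<in>set xs - {last xs}. \<theta> x) = 2 * int (length xs) - 2"
    using g c pole_sum(1)[OF o(3,4), of \<theta>] unfolding good_def by simp
  have "(\<Sum>x\<in>set xs - {last xs}. \<phi> x) = (\<Sum>x\<in>set xs - {last xs}. \<theta> x)"
    using \<phi>(2) by (intro sum.cong) auto
  then have "(\<Sum>x\<in>set xs. \<phi> x) = 2 * int (length xs) - 4"
    using s \<phi>(1) pole_sum(1)[OF o(3,4), of \<phi>] by simp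
  moreover have "\<phi> x \<in> {-2, -1, 0, 1} \<and> (\<phi> x = -2 \<longrightarrow> length xs = 1)" if x: "x \<in> set xs" for x
  proof (cases "x = last xs")
    case False
    then show ?thesis using val[of x] \<phi>(2)[OF x] x o(1) by auto
  next
    case True
    have m: "\<theta> \<epsilon> \<in> {-1, 0, 1}" "\<theta> (last xs) \<in> {-1, 0, 1}"
      using val[of \<epsilon>] val[of "last xs"] o by auto
    show ?thesis
    proof (cases "length xs = 1")
      case l1: True
      then show ?thesis using True z \<phi>(1) by simp
    next
      case False
      have "0 < length xs" using o(4) by simp
      \<comment> \<open>The other turns are at most 1, so the two merged ones sum to at least 1 and
        the result is not below -1.\<close>
      have "(\<Sum>x\<in>set xs - {last xs}. \<theta> x) \<le> (\<Sum>x\<in>set xs - {last xs}. 1)"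
        using val o(1) by (intro sum_mono) fastforce
      also have "\<dots> = int (length xs) - 1"
        unfolding sum_constant pole_sum(2)[OF o(3,4)] using o(4) by (cases xs) auto
      finally have "1 \<le> \<theta> \<epsilon> + \<theta> (last xs)" using s False \<open>0 < length xs\<close> by linarith
      then show ?thesis using True \<phi>(1) m by auto
    qed
  qed
  ultimately show ?thesis by blast
qed

text \<open>A right angle is cut off from an angle of 180 or 270 degrees; what remains has the old
  turn plus 1.\<close>

lemma split_pole:
  assumes o: "out M v = insert \<epsilon> (set xs)" "\<epsilon> \<notin> set xs" "distinct xs" "2 \<le> length xs"
    and v: "\<forall>x\<in>set xs. \<phi> x \<in> {-2, -1, 0, 1} \<and> (\<phi> x = -2 \<longrightarrow> length xs = 1)"
    and s: "(\<Sum>x\<in>set xs. \<phi> x) = 2 * int (length xs) - 4" and room: "\<phi> (last xs) \<le> 0"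
    and \<theta>: "\<theta> (last xs) = 1" "\<theta> \<epsilon> = \<phi> (last xs) + 1" "\<And>x. x \<in> set xs \<Longrightarrow> x \<noteq> last xs \<Longrightarrow> \<theta> x = \<phi> x"
  shows "good \<theta> v"
proof -
  have ne: "xs \<noteq> []" using o(4) by auto
  have c: "card (out M v) = length xs + 1" using o by (simp add: distinct_card)
  have "(\<Sum>x\<in>set xs - {last xs}. \<theta> x) = (\<Sum>x\<in>set xs - {last xs}. \<phi> x)"
    using \<theta>(3) by (intro sum.cong) auto
  then have "(\<Sum>x\<in>set xs. \<theta> x) + \<theta> \<epsilon> = (\<Sum>x\<in>set xs. \<phi> x) + 2"
    using pole_sum(1)[OF o(3) ne, of \<theta>] pole_sum(1)[OF o(3) ne, of \<phi>] \<theta>(1,2) by simp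
  then have "(\<Sum>x\<in>out M v. \<theta> x) = 2 * int (card (out M v)) - 4" using o s c by simp
  moreover have "\<theta> x \<in> {-1, 0, 1}" if "x \<in> out M v" for x
  proof -
    have "\<phi> y \<in> {-1, 0, 1}" if "y \<in> set xs" for y using v that o(4) by auto
    moreover from this[of "last xs"] have "\<phi> (last xs) \<in> {-1, 0}" using room ne by auto
    moreover have "x = \<epsilon> \<or> x = last xs \<or> x \<in> set xs \<and> x \<noteq> last xs" using \<open>x \<in> out M v\<close> o(1) by auto
    ultimately show ?thesis using \<theta> by (elim disjE) auto
  qed
  ultimately show ?thesis unfolding good_def by blast
qed

end

locale rooted_map = rotation_system M for M :: "('v, 'a) plane_map" +
  fixes e :: 'a and \<eta> :: "'a spq"
  assumes e_dart: "e \<in> darts M" and node: "spq_node M \<eta>"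
    and poles: "source M \<eta> = src M e" "sink M \<eta> = tgt M e"
    and e_notin: "e \<notin> pert M \<eta>" "opp M e \<notin> pert M \<eta>"
    and darts_eq: "darts M = {e, opp M e} \<union> pert M \<eta>"
    and no_isolated: "\<And>v. v \<in> vertices M \<Longrightarrow> out M v \<noteq> {}"
begin

abbreviation "X \<equiv> piece_of M \<eta>"
abbreviation "s \<equiv> src M e"
abbreviation "t \<equiv> tgt M e"

lemma opp_e: "opp M e \<in> darts M" "src M (opp M e) = t"
  using e_dart by simp_all

lemma proper: "proper_node \<eta>"
proof -
  have "out M w \<subseteq> pert M \<eta>" if "w \<in> ends M (pert M \<eta>) - {s, t}" for w
  proof
    fix a assume "a \<in> out M w"
    then have "a \<in> darts M" "src M a = w" using outD by blast+
    then show "a \<in> pert M \<eta>" using that darts_eq opp_e by auto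
  qed
  then show ?thesis using node poles by (auto simp: proper_node_def closed_off_def)
qed

lemma X: "valid X" "psrc X = s" "psnk X = t" "pset X = pert M \<eta>"
  using represents_piece_of[OF proper] poles by (auto simp: represents_def)

lemma s_neq_t: "s \<noteq> t"
  using validD(1)[OF X(1)] X by simp

lemma fans: "fan s (fan_s X) (pset X)" "fan t (fan_t X) (pset X)"
  using valid_fans[OF X(1)] X(2,3) by simp_all

lemma out_poles:
  "out M s = insert e (set (fan_s X))" "e \<notin> set (fan_s X)"
  "out M t = insert (opp M e) (set (fan_t X))" "opp M e \<notin> set (fan_t X)"
proof -
  have f: "set (fan_s X) = out M s \<inter> pert M \<eta>" "set (fan_t X) = out M t \<inter> pert M \<eta>"
    using fans X(4) by (auto simp: fan_def)
  show "e \<notin> set (fan_s X)" "opp M e \<notin> set (fan_t X)" using f e_notin by auto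
  show "out M s = insert e (set (fan_s X))"
    unfolding f using e_dart darts_eq s_neq_t opp_e by auto
  show "out M t = insert (opp M e) (set (fan_t X))"
    unfolding f using e_dart darts_eq s_neq_t opp_e by auto
qed

lemma rot_poles:
  "rot M (last (fan_s X)) = e" "rot M e = hd (fan_s X)"
  "rot M (last (fan_t X)) = opp M e" "rot M (opp M e) = hd (fan_t X)"
proof -
  have f: "fan_s X \<noteq> []" "distinct (fan_s X)" "rot_chain (fan_s X)"
    "fan_t X \<noteq> []" "distinct (fan_t X)" "rot_chain (fan_t X)" using fans by (auto simp: fan_def)
  show "rot M (last (fan_s X)) = e"
    using rot_last_block[of "fan_s X" "[e]" s] f out_poles by auto
  show "rot M e = hd (fan_s X)"
    using rot_last_block[of "[e]" "fan_s X" s] f out_poles by auto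
  show "rot M (last (fan_t X)) = opp M e"
    using rot_last_block[of "fan_t X" "[opp M e]" t] f out_poles by auto
  show "rot M (opp M e) = hd (fan_t X)"
    using rot_last_block[of "[opp M e]" "fan_t X" t] f out_poles by auto
qed

lemma degree_poles:
  "card (out M s) = length (fan_s X) + 1" "card (out M t) = length (fan_t X) + 1"
  "1 \<le> length (fan_s X)" "1 \<le> length (fan_t X)"
proof -
  have "distinct (fan_s X)" "distinct (fan_t X)" using fans by (auto simp: fan_def)
  then show "card (out M s) = length (fan_s X) + 1" "card (out M t) = length (fan_t X) + 1"
    unfolding out_poles(1,3) using out_poles(2,4) by (simp_all add: distinct_card)
  show "1 \<le> length (fan_s X)" "1 \<le> length (fan_t X)" using fans by (auto simp: fan_def Suc_le_eq)
qed

text \<open>The two faces at the reference edge. The one through \<open>lbd X\<close> lies to the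
  right of \<open>e\<close>, hence is the external one when \<open>e\<close> is on the external
  face; the other is bounded by \<open>rbd X\<close> and must have sum 4.\<close>

lemma face_cycles: "face_cycle (opp M e # rbd X)" "face_cycle (e # lbd X)"
proof -
  note b = valid_boundaries[OF X(1)] and l = valid_last[OF X(1)]
  have d: "distinct (rbd X)" "distinct (lbd X)" "face_chain (rbd X)" "face_chain (lbd X)"
    "set (rbd X) \<subseteq> pset X" "set (lbd X) \<subseteq> pset X" using b(1,2) by (auto simp: boundary_def)
  show "face_cycle (opp M e # rbd X)"
    using d l b rot_poles e_notin X(4) by (auto simp: face_cycle_def successively_Cons)
  show "face_cycle (e # lbd X)"
    using d l b rot_poles e_notin X(4) by (auto simp: face_cycle_def successively_Cons)
qed

section \<open>Faces and vertices seen from the root\<close>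

definition cycles :: "'a list set" where
  "cycles = {opp M e # rbd X, e # lbd X} \<union> inner X"

lemma cycles_face_cycle: "f \<in> cycles \<Longrightarrow> face_cycle f"
  using face_cycles valid_inner(2)[OF X(1)] by (auto simp: cycles_def)

lemma darts_cycles: "darts M = \<Union>(set ` cycles)"
  unfolding darts_eq X(4)[symmetric] valid_inner(1)[OF X(1)] cycles_def by auto

text \<open>Every arc lies on a listed cycle, and each cycle is the whole orbit of any of its
  arcs.\<close>

lemma faces_cycles: "faces M = set ` cycles"
proof
  show "faces M \<subseteq> set ` cycles"
    using darts_cycles cycles_face_cycle face_cycle_face_of by (fastforce simp: faces_def)
  show "set ` cycles \<subseteq> faces M"
  proof
    fix F assume "F \<in> set ` cycles"
    then obtain f where f: "f \<in> cycles" "F = set f" by blast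
    then have "hd f \<in> set f" using cycles_face_cycle by (auto simp: face_cycle_def)
    moreover from this have "hd f \<in> darts M" using darts_cycles f by blast
    ultimately show "F \<in> faces M"
      using face_cycle_face_of[OF cycles_face_cycle[OF f(1)]] f(2) by (auto simp: faces_def)
  qed
qed

lemma inner_avoids: "f \<in> inner X \<Longrightarrow> e \<notin> set f \<and> opp M e \<notin> set f"
  using valid_inner(2)[OF X(1)] X(4) e_notin by blast

lemma boundary_avoids: "e \<notin> set (rbd X)" "opp M e \<notin> set (rbd X)" "e \<notin> set (lbd X)" "opp M e \<notin> set (lbd X)"
  using valid_boundaries(1,2)[OF X(1)] X(4) e_notin by (auto simp: boundary_def)

lemma vertices_eq: "vertices M = own X \<union> {s, t}"
proof
  show "vertices M \<subseteq> own X \<union> {s, t}"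
  proof
    fix v assume v: "v \<in> vertices M"
    then obtain a where a: "a \<in> out M v" using no_isolated by blast
    have "a \<in> darts M" "src M a = v" using outD[OF a] by blast+
    then have "v \<in> {s, t} \<union> ends M (pset X)" using darts_eq opp_e X(4) by (auto simp: ends_def)
    then show "v \<in> own X \<union> {s, t}" using valid_own(2)[OF X(1)] X(2,3) by auto
  qed
  have "ends M (pset X) \<subseteq> vertices M" using validD(2)[OF X(1)] by (auto simp: ends_def)
  then show "own X \<union> {s, t} \<subseteq> vertices M" using valid_own(1)[OF X(1)] e_dart by auto
qed

text \<open>The reference edge is the only outside arc at either pole, so at the root turn and
  spirality coincide.\<close>

lemma full_poles_X: "full_poles X = 0"
  using degree_poles by (simp add: full_poles_def full_pole_def X)

lemma turn_balance: "local_rep X \<theta> \<Longrightarrow> turn_l X \<theta> = - turn_r X \<theta>"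
  using node_intervals[OF proper] full_poles_X by (fastforce simp: balanced_def)

lemma root_face_sums:
  shows "face_sum \<theta> (opp M e # rbd X) = turn_r X \<theta> +
     (if length (fan_t X) = 1 then \<theta> (last (fan_t X)) else 0) + (if length (fan_s X) = 1 then \<theta> e else 0)" (is ?R)
    and "face_sum \<theta> (e # lbd X) = turn_l X \<theta> +
     (if length (fan_s X) = 1 then \<theta> (last (fan_s X)) else 0) + (if length (fan_t X) = 1 then \<theta> (opp M e) else 0)" (is ?L)
proof -
  note b = valid_boundaries[OF X(1)] and l = valid_last[OF X(1)]
  have p: "pred (hd (fan_s X)) = e" "pred (hd (fan_t X)) = opp M e"
    using rot_poles pred_rot e_dart opp_e by metis+
  have k: "2 \<le> length (fan_s X) \<longleftrightarrow> length (fan_s X) \<noteq> 1" "2 \<le> length (fan_t X) \<longleftrightarrow> length (fan_t X) \<noteq> 1"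
    using degree_poles(3,4) by linarith+
  show ?R
    unfolding turn_r_def p k using face_sum_butlast[OF l(5), of \<theta>] b by simp
  show ?L
    unfolding turn_l_def p k using face_sum_butlast[OF l(6), of \<theta>] b by simp
qed

lemma pole_opposite:
  "length (fan_s X) = 1 \<Longrightarrow> good \<theta> s \<longleftrightarrow> \<theta> e \<in> {-1, 0, 1} \<and> \<theta> (last (fan_s X)) = - \<theta> e"
  "length (fan_t X) = 1 \<Longrightarrow> good \<theta> t \<longleftrightarrow> \<theta> (opp M e) \<in> {-1, 0, 1} \<and> \<theta> (last (fan_t X)) = - \<theta> (opp M e)"
proof -
  assume l: "length (fan_s X) = 1"
  have o: "out M s = {e, last (fan_s X)}" "e \<noteq> last (fan_s X)"
    using out_poles(1,2) length_one[OF l] by (metis list.set(1,2), metis list.set_intros(1))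
  show "good \<theta> s \<longleftrightarrow> \<theta> e \<in> {-1, 0, 1} \<and> \<theta> (last (fan_s X)) = - \<theta> e"
    unfolding good_def o(1) using o(2) by auto
next
  assume l: "length (fan_t X) = 1"
  have o: "out M t = {opp M e, last (fan_t X)}" "opp M e \<noteq> last (fan_t X)"
    using out_poles(3,4) length_one[OF l] by (metis list.set(1,2), metis list.set_intros(1))
  show "good \<theta> t \<longleftrightarrow> \<theta> (opp M e) \<in> {-1, 0, 1} \<and> \<theta> (last (fan_t X)) = - \<theta> (opp M e)"
    unfolding good_def o(1) using o(2) by auto
qed

lemma own_poles: "s \<in> own X \<longleftrightarrow> length (fan_s X) \<noteq> 1" "t \<in> own X \<longleftrightarrow> length (fan_t X) \<noteq> 1"
  using valid_own(3,4)[OF X(1)] degree_poles(3,4) X(2,3) by auto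

text \<open>Right and left turn cancel without full poles, and at a pole of degree two the two turns
  are opposite. Hence the external face needs no separate check.\<close>

lemma root_faces_opposite:
  assumes "local_rep X \<theta>" "good \<theta> s" "good \<theta> t"
  shows "face_sum \<theta> (e # lbd X) = - face_sum \<theta> (opp M e # rbd X)"
  using turn_balance[OF assms(1)] pole_opposite[of \<theta>] assms(2,3) unfolding root_face_sums by auto

text \<open>A pole of indegree one is not owned, so the turn there may be chosen freely.\<close>

lemma extend_to_poles:
  assumes "local_rep X \<theta>'" "i \<in> {-1, 0, 1}" "j \<in> {-1, 0, 1}"
  shows "\<exists>\<theta>. local_rep X \<theta> \<and> turn_r X \<theta> = turn_r X \<theta>' \<and> good \<theta> s \<and> good \<theta> t \<and>
    (length (fan_s X) = 1 \<longrightarrow> \<theta> e = i) \<and> (length (fan_t X) = 1 \<longrightarrow> \<theta> (last (fan_t X)) = j)"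
proof -
  \<comment> \<open>The face through \<open>rbd X\<close> meets the source at \<open>e\<close> and
    the sink at \<open>last (fan_t X)\<close>, so these arcs receive \<open>i\<close> and
    \<open>j\<close>; their partners at a pole of degree two get the negatives.\<close>
  define \<theta> where "\<theta> a = (if src M a \<in> own X then \<theta>' a
    else if a = e then i else if a = last (fan_s X) then - i
    else if a = opp M e then - j else if a = last (fan_t X) then j else 0)" for a
  have ag: "agree (own X) \<theta> \<theta>'" unfolding agree_def \<theta>_def using outD(2) by simp
  have lr: "local_rep X \<theta>" using agree_local_rep[OF X(1) ag] assms(1) by simp
  have src: "src M (last (fan_s X)) = s" "src M (last (fan_t X)) = t"
    using fan_last[OF fans(1)] fan_last[OF fans(2)] by auto
  have neq: "last (fan_s X) \<noteq> e" "last (fan_t X) \<noteq> opp M e" 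
    using out_poles(2,4) fans by (metis fan_def last_in_set)+
  have gs: "good \<theta> s \<and> (length (fan_s X) = 1 \<longrightarrow> \<theta> e = i)"
  proof (cases "length (fan_s X) = 1")
    case True
    then have "\<theta> e = i" "\<theta> (last (fan_s X)) = - i"
      using own_poles src neq by (auto simp: \<theta>_def)
    then show ?thesis using pole_opposite(1)[OF True] assms(2) by auto
  next
    case False
    then show ?thesis using own_poles lr by (auto simp: local_rep_def)
  qed
  have gt: "good \<theta> t \<and> (length (fan_t X) = 1 \<longrightarrow> \<theta> (last (fan_t X)) = j)"
  proof (cases "length (fan_t X) = 1")
    case True
    have "last (fan_t X) \<noteq> e" "opp M e \<noteq> e" "last (fan_t X) \<noteq> last (fan_s X)" "opp M e \<noteq> last (fan_s X)"
      using src s_neq_t opp_e by metis+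
    then have "\<theta> (opp M e) = - j" "\<theta> (last (fan_t X)) = j"
      using own_poles True src neq opp_e by (auto simp: \<theta>_def)
    then show ?thesis using pole_opposite(2)[OF True] assms(3) by auto
  next
    case False
    then show ?thesis using own_poles lr by (auto simp: local_rep_def)
  qed
  show ?thesis using lr agree_turn_r[OF X(1) ag] gs gt by blast
qed

definition root_slack :: int where
  "root_slack = (if length (fan_s X) = 1 then 1 else 0) + (if length (fan_t X) = 1 then 1 else 0)"

text \<open>The inner face at \<open>e\<close> requires turn 4, and each pole of indegree one can
  make up for a deviation of one unit; this is where the allowed root intervals around 4 come
  from.\<close>

lemma rectilinear_iff_achieves:
  assumes "e \<in> outer M" "outer M \<in> faces M"
  shows "rectilinear_planar M \<longleftrightarrow> (\<exists>x. achieves X x \<and> \<bar>x - 4\<bar> \<le> root_slack)"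
proof -
  have out: "outer M = set (e # lbd X)"
  proof -
    obtain f where f: "f \<in> cycles" "outer M = set f" using assms(2) faces_cycles by blast
    then have "f = e # lbd X"
      using assms(1) boundary_avoids inner_avoids opp_neq[OF e_dart] by (auto simp: cycles_def)
    then show ?thesis using f by simp
  qed
  have ne: "set (opp M e # rbd X) \<noteq> outer M" "f \<in> inner X \<Longrightarrow> set f \<noteq> outer M" for f
    unfolding out using boundary_avoids inner_avoids opp_neq[OF e_dart] by auto
  have "rectilinear_planar M \<longleftrightarrow> (\<exists>\<theta>. local_rep X \<theta> \<and> good \<theta> s \<and> good \<theta> t \<and> face_sum \<theta> (opp M e # rbd X) = 4)"
  proof
    assume "rectilinear_planar M"
    then obtain \<theta> where th: "turning \<theta>" using turning_of_rep unfolding rectilinear_planar_def by blast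
    have g: "good \<theta> v" if "v \<in> own X \<union> {s, t}" for v
    proof -
      have "2 \<le> card (out M v)"
        using that node_degree[OF proper] degree_poles by (auto simp: degree_ge_2_def)
      moreover have "vertex_ok \<theta> v" using th that vertices_eq by (auto simp: turning_def)
      ultimately show ?thesis using vertex_ok_imp_good by blast
    qed
    have f4: "face_sum \<theta> f = 4" if "f \<in> cycles" "set f \<noteq> outer M" for f
      using th that faces_cycles face_sum_set[of f \<theta>] cycles_face_cycle[OF that(1)]
      by (auto simp: turning_def face_cycle_def)
    have "local_rep X \<theta>" using g f4 ne(2) by (auto simp: local_rep_def cycles_def)
    moreover have "face_sum \<theta> (opp M e # rbd X) = 4" using f4 ne(1) unfolding cycles_def by blast
    ultimately show "\<exists>\<theta>. local_rep X \<theta> \<and> good \<theta> s \<and> good \<theta> t \<and> face_sum \<theta> (opp M e # rbd X) = 4"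
      using g by blast
  next
    assume "\<exists>\<theta>. local_rep X \<theta> \<and> good \<theta> s \<and> good \<theta> t \<and> face_sum \<theta> (opp M e # rbd X) = 4"
    then obtain \<theta> where th: "local_rep X \<theta>" "good \<theta> s" "good \<theta> t" "face_sum \<theta> (opp M e # rbd X) = 4" by blast
    have "turning \<theta>"
      unfolding turning_def
    proof (intro conjI ballI)
      fix v assume "v \<in> vertices M"
      then have "good \<theta> v" using th vertices_eq by (auto simp: local_rep_def)
      then show "vertex_ok \<theta> v" by (rule good_imp_vertex_ok)
    next
      fix F assume "F \<in> faces M"
      then obtain f where f: "f \<in> cycles" "F = set f" using faces_cycles by blast
      have "(\<Sum>a\<in>F. \<theta> (opp M a)) = face_sum \<theta> f"
        using f cycles_face_cycle[OF f(1)] face_sum_set[of f \<theta>] by (simp add: face_cycle_def)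
      moreover have "face_sum \<theta> (e # lbd X) = -4" using root_faces_opposite[OF th(1-3)] th(4) by simp
      moreover have "f = opp M e # rbd X \<or> f = e # lbd X \<or> f \<in> inner X" using f(1) by (auto simp: cycles_def)
      ultimately show "(\<Sum>a\<in>F. \<theta> (opp M a)) = (if F = outer M then -4 else 4)"
        using th(1,4) f(2) ne out by (auto simp: local_rep_def)
    qed
    then show "rectilinear_planar M" by (rule rep_of_turning)
  qed
  also have "\<dots> \<longleftrightarrow> (\<exists>x. achieves X x \<and> \<bar>x - 4\<bar> \<le> root_slack)"
  proof
    assume "\<exists>\<theta>. local_rep X \<theta> \<and> good \<theta> s \<and> good \<theta> t \<and> face_sum \<theta> (opp M e # rbd X) = 4"
    then obtain \<theta> where th: "local_rep X \<theta>" "good \<theta> s" "good \<theta> t" "face_sum \<theta> (opp M e # rbd X) = 4" by blast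
    have "\<bar>turn_r X \<theta> - 4\<bar> \<le> root_slack"
      using th(4) pole_opposite[of \<theta>] th(2,3) unfolding root_face_sums root_slack_def by auto
    then show "\<exists>x. achieves X x \<and> \<bar>x - 4\<bar> \<le> root_slack" using th(1) unfolding achieves_def by blast
  next
    assume "\<exists>x. achieves X x \<and> \<bar>x - 4\<bar> \<le> root_slack"
    then obtain \<theta>' where th: "local_rep X \<theta>'" "\<bar>turn_r X \<theta>' - 4\<bar> \<le> root_slack" unfolding achieves_def by blast
    define y where "y = 4 - turn_r X \<theta>'"
    have "\<exists>i j. i \<in> {-1, 0, 1} \<and> j \<in> {-1, 0, 1} \<and>
        y = (if length (fan_t X) = 1 then j else 0) + (if length (fan_s X) = 1 then i else 0)"
    proof -
      have "y \<in> {-2, -1, 0, 1, 2}" using th(2) unfolding y_def root_slack_def by (auto split: if_splits)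
      \<comment> \<open>If it is free, the source absorbs one unit in the direction of
        \<open>y\<close>; the rest is then small enough for the sink.\<close>
      define i where "i = (if length (fan_s X) = 1 then sgn y else 0)"
      have "i \<in> {-1, 0, 1}" "y - i \<in> {-1, 0, 1}"
        "y = (if length (fan_t X) = 1 then y - i else 0) + (if length (fan_s X) = 1 then i else 0)"
        using th(2) unfolding y_def[symmetric] i_def root_slack_def
        by (auto simp: y_def sgn_if split: if_splits)
      then show ?thesis by blast
    qed
    then obtain i j where ij: "i \<in> {-1, 0, 1}" "j \<in> {-1, 0, 1}"
        "y = (if length (fan_t X) = 1 then j else 0) + (if length (fan_s X) = 1 then i else 0)" by blast
    obtain \<theta> where t: "local_rep X \<theta>" "turn_r X \<theta> = turn_r X \<theta>'" "good \<theta> s" "good \<theta> t"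
      "length (fan_s X) = 1 \<longrightarrow> \<theta> e = i" "length (fan_t X) = 1 \<longrightarrow> \<theta> (last (fan_t X)) = j"
      using extend_to_poles[OF th(1) ij(1,2)] by blast
    have "face_sum \<theta> (opp M e # rbd X) = 4"
      unfolding root_face_sums using t ij(3) y_def by auto
    then show "\<exists>\<theta>. local_rep X \<theta> \<and> good \<theta> s \<and> good \<theta> t \<and> face_sum \<theta> (opp M e # rbd X) = 4"
      using t by blast
  qed
  finally show ?thesis .
qed

lemma root_spiralities_eq:
  "root_spiralities M \<eta> = spiralities (of_int (4 - root_slack), of_int (4 + root_slack))"
proof -
  have i: "indeg M \<eta> s = length (fan_s X)" "indeg M \<eta> t = length (fan_t X)"
    using fan_card[OF fans(1)] fan_card[OF fans(2)] by (simp_all add: indeg_def X(4))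
  have "{w \<in> {source M \<eta>, sink M \<eta>}. indeg M \<eta> w = 1} =
      (if length (fan_s X) = 1 then {s} else {}) \<union> (if length (fan_t X) = 1 then {t} else {})"
    unfolding poles using i by auto
  moreover have "spiralities (4, 4) = {4}" by (auto simp: spiralities_def)
  ultimately show ?thesis using s_neq_t by (simp add: root_spiralities_def root_slack_def)
qed

lemma nodes_root: "nodes (Root (QNode [e]) \<eta>) = {Root (QNode [e]) \<eta>, QNode [e]} \<union> nodes \<eta>"
  by simp

text \<open>If a condition below the root fails, no turn is realizable at all, so the root condition
  is compared with the turns only when \<open>rep_interval M \<eta>\<close> is known to be
  correct.\<close>

theorem rectilinear_iff_conditions:
  assumes "e \<in> outer M" "outer M \<in> faces M"
  shows "rectilinear_planar M \<longleftrightarrow> (\<forall>\<nu>\<in>nodes (Root (QNode [e]) \<eta>). rep_condition M False \<nu>)"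
proof -
  note N = node_intervals[OF proper, of False]
  have "(\<exists>x. achieves X x \<and> \<bar>x - 4\<bar> \<le> root_slack) \<longleftrightarrow>
    (\<forall>\<nu>\<in>nodes \<eta>. rep_condition M False \<nu>) \<and> rep_condition M False (Root (QNode [e]) \<eta>)"
  proof (cases "\<forall>\<nu>\<in>nodes \<eta>. rep_condition M False \<nu>")
    case False
    then show ?thesis using N by blast
  next
    case True
    then obtain a A where a: "realizes X a A" "rep_interval M \<eta> = (of_int a, of_int A)"
      using N unfolding has_interval_def full_poles_X by auto
    have sl: "0 \<le> root_slack" by (simp add: root_slack_def)
    have "rep_condition M False (Root (QNode [e]) \<eta>) \<longleftrightarrow> max a (4 - root_slack) \<le> min A (4 + root_slack)"
      using spiralities_meet[of a 0 A "4 - root_slack" "4 + root_slack"]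
      by (simp add: a(2) root_spiralities_eq)
    also have "\<dots> \<longleftrightarrow> (\<exists>x. achieves X x \<and> \<bar>x - 4\<bar> \<le> root_slack)"
    proof
      assume "max a (4 - root_slack) \<le> min A (4 + root_slack)"
      then show "\<exists>x. achieves X x \<and> \<bar>x - 4\<bar> \<le> root_slack"
        using a(1) sl unfolding realizes_def by (intro exI[of _ "max a (4 - root_slack)"]) auto
    next
      assume "\<exists>x. achieves X x \<and> \<bar>x - 4\<bar> \<le> root_slack"
      then obtain x where "a \<le> x" "x \<le> A" "\<bar>x - 4\<bar> \<le> root_slack" using a(1) unfolding realizes_def by blast
      then show "max a (4 - root_slack) \<le> min A (4 + root_slack)" using sl by linarith
    qed
    finally show ?thesis using True by blast
  qed
  then show ?thesis unfolding rectilinear_iff_achieves[OF assms] nodes_root by auto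
qed

end

section \<open>Dummy reference edges\<close>

locale dummy_edge_map = rooted_map M e \<eta> for M :: "('v, 'a) plane_map" and e \<eta> +
  fixes G :: "('v, 'a) plane_map"
  assumes G_rotation: "rotation_system G" and dummy: "adds_dummy_edge G e M"
begin

interpretation G: rotation_system G
  by (rule G_rotation)

lemma G_darts: "darts G = pset X"
  using dummy darts_eq e_notin X(4) by (auto simp: adds_dummy_edge_def)

lemma pset_avoids: "a \<in> pset X \<Longrightarrow> a \<notin> {e, opp M e}"
  using e_notin unfolding X(4) by (metis empty_iff insert_iff)

lemma G_vertices: "vertices G = own X \<union> {s, t}"
  using dummy vertices_eq by (simp add: adds_dummy_edge_def)

lemma G_arcs:
  assumes "a \<in> pset X"
  shows "src G a = src M a" "tgt G a = tgt M a" "opp G a = opp M a"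
    "rot G a = (if rot M a \<in> {e, opp M e} then rot M (rot M a) else rot M a)"
  using dummy assms G_darts by (auto simp: adds_dummy_edge_def)

lemma G_out: "out G v = out M v - {e, opp M e}"
proof -
  have "a \<in> out G v \<longleftrightarrow> a \<in> out M v - {e, opp M e}" for a
    unfolding G.in_out_iff Diff_iff in_out_iff G_darts
    using G_arcs(1) darts_eq X(4) e_notin by auto
  then show ?thesis by blast
qed

lemma G_out_poles: "out G s = set (fan_s X)" "out G t = set (fan_t X)"
  and G_out_inner: "v \<noteq> s \<Longrightarrow> v \<noteq> t \<Longrightarrow> out G v = out M v"
proof -
  have "opp M e \<notin> set (fan_s X)" "e \<notin> set (fan_t X)"
    using fans X(4) e_notin by (auto simp: fan_def)
  then show "out G s = set (fan_s X)" "out G t = set (fan_t X)"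
    unfolding G_out out_poles(1,3) using out_poles(2,4) by auto
  assume v: "v \<noteq> s" "v \<noteq> t"
  have "e \<notin> out M v" "opp M e \<notin> out M v" using v opp_e outD(2) by metis+
  then show "out G v = out M v" unfolding G_out by blast
qed

lemma distinct_fans: "distinct (fan_s X)" "distinct (fan_t X)" "fan_s X \<noteq> []" "fan_t X \<noteq> []"
  using fans by (auto simp: fan_def)

lemma G_face_chain:
  assumes "face_chain f" "set f \<subseteq> pset X"
  shows "G.face_chain f"
  unfolding successively_conv_nth
proof (intro allI impI)
  fix i assume i: "Suc i < length f"
  then have f: "f ! i \<in> pset X" "f ! Suc i \<in> pset X" using assms(2) nth_mem[of i f] nth_mem[of "Suc i" f] by auto
  then have o: "opp M (f ! i) \<in> pset X" using validD(3)[OF X(1)] by blast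
  have r: "rot M (opp M (f ! i)) = f ! Suc i" using assms(1) i by (simp add: successively_conv_nth)
  have "f ! Suc i \<notin> {e, opp M e}" by (rule pset_avoids[OF f(2)])
  then show "rot G (opp G (f ! i)) = f ! Suc i"
    using r G_arcs(3)[OF f(1)] G_arcs(4)[OF o] by simp
qed

lemma G_inner_cycle:
  assumes "f \<in> inner X"
  shows "G.face_cycle f"
proof -
  have f: "face_cycle f" "set f \<subseteq> pset X" using valid_inner(2)[OF X(1)] assms by blast+
  have ne: "f \<noteq> []" using f(1) by (simp add: face_cycle_def)
  then have l: "last f \<in> pset X" "hd f \<in> pset X" using f(2) by auto
  then have "opp M (last f) \<in> pset X" using validD(3)[OF X(1)] by blast
  moreover have "rot M (opp M (last f)) = hd f" using f(1) by (simp add: face_cycle_def)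
  moreover have "hd f \<notin> {e, opp M e}" by (rule pset_avoids[OF l(2)])
  ultimately have "rot G (opp G (last f)) = hd f" using G_arcs(3)[OF l(1)] G_arcs(4)[of "opp M (last f)"] by simp
  then show ?thesis
    using f G_face_chain[of f] unfolding face_cycle_def G.face_cycle_def by blast
qed

text \<open>A common arc would make the two face cycles at \<open>e\<close> equal, but only one of
  them contains \<open>opp M e\<close>.\<close>

lemma boundaries_disjoint: "set (rbd X) \<inter> set (lbd X) = {}"
proof (rule ccontr)
  assume "set (rbd X) \<inter> set (lbd X) \<noteq> {}"
  then obtain a where "a \<in> set (rbd X)" "a \<in> set (lbd X)" by blast
  then have "set (opp M e # rbd X) = set (e # lbd X)"
    using face_cycle_face_of[OF face_cycles(1), of a] face_cycle_face_of[OF face_cycles(2), of a] by simp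
  then show False using boundary_avoids opp_neq[OF e_dart] by auto
qed

text \<open>Skipping the dummy arcs, the rotation leads from the end of one boundary walk directly
  to the start of the other, so the two faces at \<open>e\<close> join.\<close>

lemma G_outer_cycle: "G.face_cycle (rbd X @ lbd X)"
proof -
  note b = valid_boundaries[OF X(1)] and l = valid_last[OF X(1)]
  have d: "distinct (rbd X)" "distinct (lbd X)" "face_chain (rbd X)" "face_chain (lbd X)"
    "set (rbd X) \<subseteq> pset X" "set (lbd X) \<subseteq> pset X" using b(1,2) by (auto simp: boundary_def)
  have m: "last (rbd X) \<in> pset X" "last (lbd X) \<in> pset X" using d(5,6) l by auto
  have n: "last (fan_t X) \<in> pset X" "last (fan_s X) \<in> pset X"
    using fan_last[OF fans(1)] fan_last[OF fans(2)] by auto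
  have "rot G (opp G (last (rbd X))) = hd (lbd X)" "rot G (opp G (last (lbd X))) = hd (rbd X)"
    using G_arcs(3)[OF m(1)] G_arcs(3)[OF m(2)] G_arcs(4)[OF n(1)] G_arcs(4)[OF n(2)] b rot_poles by simp_all
  moreover have "G.face_chain (rbd X)" "G.face_chain (lbd X)" using G_face_chain d by blast+
  ultimately show ?thesis
    unfolding G.face_cycle_def successively_append_iff using d(1,2) l boundaries_disjoint by simp
qed

lemma G_outer: "outer G = set (rbd X @ lbd X)"
proof -
  have "outer G = (face_of M e \<union> face_of M (opp M e)) - {e, opp M e}"
    using dummy by (simp add: adds_dummy_edge_def)
  moreover have "face_of M e = set (e # lbd X)" "face_of M (opp M e) = set (opp M e # rbd X)"
    using face_cycle_face_of[OF face_cycles(1), of "opp M e"] face_cycle_face_of[OF face_cycles(2), of e] by simp_all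
  ultimately show ?thesis using boundary_avoids by auto
qed

lemma G_faces: "faces G = insert (outer G) (set ` inner X)"
proof -
  let ?C = "insert (rbd X @ lbd X) (inner X)"
  have c: "G.face_cycle f" if "f \<in> ?C" for f using that G_outer_cycle G_inner_cycle by blast
  have d: "darts G = \<Union>(set ` ?C)" unfolding G_darts valid_inner(1)[OF X(1)] by auto
  have "faces G = set ` ?C"
  proof
    show "faces G \<subseteq> set ` ?C"
    proof
      fix F assume "F \<in> faces G"
      then obtain a where a: "a \<in> darts G" "F = face_of G a" by (auto simp: faces_def)
      then obtain f where "f \<in> ?C" "a \<in> set f" using d by blast
      then show "F \<in> set ` ?C" using G.face_cycle_face_of[OF c] a by blast
    qed
    show "set ` ?C \<subseteq> faces G"
    proof
      fix F assume "F \<in> set ` ?C"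
      then obtain f where f: "f \<in> ?C" "F = set f" by blast
      then have h: "hd f \<in> set f" using c by (auto simp: G.face_cycle_def)
      then have "hd f \<in> darts G" using d f by blast
      then show "F \<in> faces G"
        using G.face_cycle_face_of[OF c[OF f(1)] h] f(2) unfolding faces_def by blast
    qed
  qed
  then show ?thesis using G_outer by simp
qed

lemma inner_not_outer: "f \<in> inner X \<Longrightarrow> set f \<noteq> outer G"
proof
  assume f: "f \<in> inner X" and eq: "set f = outer G"
  have "hd (rbd X) \<in> set (rbd X)" using valid_last(5)[OF X(1)] by simp
  then have h: "hd (rbd X) \<in> set f" "hd (rbd X) \<in> set (opp M e # rbd X)" using eq G_outer by auto
  have "face_cycle f" using valid_inner(2)[OF X(1)] f by blast
  then have "set f = set (opp M e # rbd X)"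
    using face_cycle_face_of h face_cycles(1) by metis
  then show False using inner_avoids[OF f] by auto
qed

lemma G_face_sum:
  assumes "set f \<subseteq> pset X" "distinct f"
  shows "(\<Sum>a\<in>set f. \<phi> (opp G a)) = face_sum \<phi> f"
proof -
  have "(\<Sum>a\<in>set f. \<phi> (opp G a)) = (\<Sum>a\<in>set f. \<phi> (opp M a))"
    using assms(1) G_arcs(3) by (intro sum.cong) auto
  then show ?thesis using face_sum_set[OF assms(2)] by simp
qed

section \<open>Angles affected by the dummy edge\<close>

lemma face_sum_cong:
  "(\<And>a. a \<in> set f \<Longrightarrow> \<phi> (opp M a) = \<theta> (opp M a)) \<Longrightarrow> face_sum \<phi> f = face_sum \<theta> f"
  by (simp add: face_sum_def cong: map_cong)

text \<open>The modified angles are those followed by a dummy arc. On an inner face the next arc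
  belongs to the piece, so inner faces keep their sums.\<close>

lemma inner_not_last:
  assumes "f \<in> inner X" "a \<in> set f"
  shows "opp M a \<noteq> last (fan_s X)" "opp M a \<noteq> last (fan_t X)" "opp M a \<notin> {e, opp M e}"
proof -
  have f: "face_cycle f" "set f \<subseteq> pset X" using valid_inner(2)[OF X(1)] assms by blast+
  have ne: "f \<noteq> []" using f(1) by (simp add: face_cycle_def)
  have "rot M (opp M a) \<in> set f"
    using f(1) ne successively_successor[of "\<lambda>x. rot M (opp M x)" f a] set_butlast_last[OF ne] assms(2)
    by (cases f) (auto simp: face_cycle_def)
  then have "rot M (opp M a) \<notin> {e, opp M e}" using f(2) pset_avoids by blast
  then show "opp M a \<noteq> last (fan_s X)" "opp M a \<noteq> last (fan_t X)" using rot_poles by auto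
  have "opp M a \<in> pset X" using f(2) assms(2) validD(3)[OF X(1)] by blast
  then show "opp M a \<notin> {e, opp M e}" by (rule pset_avoids)
qed

lemma butlast_not_last:
  assumes "a \<in> set (butlast (rbd X)) \<or> a \<in> set (butlast (lbd X))"
  shows "opp M a \<noteq> last (fan_s X)" "opp M a \<noteq> last (fan_t X)"
proof -
  have b: "face_chain (rbd X)" "face_chain (lbd X)" "set (rbd X) \<subseteq> pset X" "set (lbd X) \<subseteq> pset X"
    using valid_boundaries(1,2)[OF X(1)] by (auto simp: boundary_def)
  have "rot M (opp M a) \<in> set (tl (rbd X)) \<or> rot M (opp M a) \<in> set (tl (lbd X))"
    using assms successively_successor[OF b(1)] successively_successor[OF b(2)] by blast
  then have "rot M (opp M a) \<in> pset X"
    using b(3,4) valid_last(5,6)[OF X(1)] list.set_sel(2)[of "rbd X"] list.set_sel(2)[of "lbd X"] by blast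
  then have "rot M (opp M a) \<notin> {e, opp M e}" by (rule pset_avoids)
  then show "opp M a \<noteq> last (fan_s X)" "opp M a \<noteq> last (fan_t X)" using rot_poles by auto
qed

lemma last_fans_neq: "last (fan_s X) \<noteq> last (fan_t X)"
  using fan_last[OF fans(1)] fan_last[OF fans(2)] s_neq_t by metis

text \<open>Any local representation suffices: after the dummy edge is removed, its two incident
  faces need only the right joint sum.\<close>

lemma G_rectilinearI:
  assumes "local_rep X \<theta>'"
  shows "rectilinear_planar G"
proof -
  \<comment> \<open>Turn 0 at a pole of indegree one makes the dummy edge continue straight, so that
    removing it leaves an angle of 360 degrees.\<close>
  obtain \<theta> where th: "local_rep X \<theta>" "good \<theta> s" "good \<theta> t"
    "length (fan_s X) = 1 \<longrightarrow> \<theta> e = 0" "length (fan_t X) = 1 \<longrightarrow> \<theta> (last (fan_t X)) = 0"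
    using extend_to_poles[OF assms, of 0 0] by auto
  define \<phi> where "\<phi> x = (if x = last (fan_s X) then \<theta> x + \<theta> e - 2
     else if x = last (fan_t X) then \<theta> x + \<theta> (opp M e) - 2 else \<theta> x)" for x
  have st: "last (fan_s X) \<noteq> last (fan_t X)" by (rule last_fans_neq)
  have ms: "last (fan_t X) \<notin> set (fan_s X)" "last (fan_s X) \<notin> set (fan_t X)"
  proof -
    have "x \<in> set (fan_s X) \<Longrightarrow> src M x = s" "x \<in> set (fan_t X) \<Longrightarrow> src M x = t" for x
      using out_poles(1,3) outD(2) by blast+
    then show "last (fan_t X) \<notin> set (fan_s X)" "last (fan_s X) \<notin> set (fan_t X)"
      using fan_last[OF fans(1)] fan_last[OF fans(2)] s_neq_t by metis+
  qed
  have "G.vertex_ok \<phi> v" if v: "v \<in> vertices G" for v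
  proof -
    consider "v = s" | "v = t" | "v \<noteq> s" "v \<noteq> t" "v \<in> own X" using v G_vertices by blast
    then show ?thesis
    proof cases
      case 1
      have "(\<forall>x\<in>set (fan_s X). \<phi> x \<in> {-2, -1, 0, 1} \<and> (\<phi> x = -2 \<longrightarrow> length (fan_s X) = 1)) \<and>
        (\<Sum>x\<in>set (fan_s X). \<phi> x) = 2 * int (length (fan_s X)) - 4"
        using out_poles(1,2) distinct_fans(1,3) th(2)
      proof (rule merge_pole)
        show "\<theta> (last (fan_s X)) = 0 \<and> \<theta> e = 0" if "length (fan_s X) = 1"
          using pole_opposite(1)[OF that, of \<theta>] th(2,4) that by auto
      qed (use ms in \<open>auto simp: \<phi>_def\<close>)
      then show ?thesis unfolding G.vertex_ok_def 1 G_out_poles distinct_card[OF distinct_fans(1)] .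
    next
      case 2
      have "(\<forall>x\<in>set (fan_t X). \<phi> x \<in> {-2, -1, 0, 1} \<and> (\<phi> x = -2 \<longrightarrow> length (fan_t X) = 1)) \<and>
        (\<Sum>x\<in>set (fan_t X). \<phi> x) = 2 * int (length (fan_t X)) - 4"
        using out_poles(3,4) distinct_fans(2,4) th(3)
      proof (rule merge_pole)
        show "\<theta> (last (fan_t X)) = 0 \<and> \<theta> (opp M e) = 0" if "length (fan_t X) = 1"
          using pole_opposite(2)[OF that, of \<theta>] th(3,5) that by auto
      qed (use ms st in \<open>auto simp: \<phi>_def\<close>)
      then show ?thesis unfolding G.vertex_ok_def 2 G_out_poles distinct_card[OF distinct_fans(2)] .
    next
      case 3
      have "\<phi> x = \<theta> x" if "x \<in> out M v" for x
        using outD(2)[OF that] 3(1,2) fan_last[OF fans(1)] fan_last[OF fans(2)] by (auto simp: \<phi>_def)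
      moreover have "vertex_ok \<theta> v" using th(1) 3(3) good_imp_vertex_ok by (simp add: local_rep_def)
      ultimately show ?thesis
        unfolding G.vertex_ok_def vertex_ok_def G_out_inner[OF 3(1,2)] by simp
    qed
  qed
  moreover have "(\<Sum>a\<in>F. \<phi> (opp G a)) = (if F = outer G then -4 else 4)" if F: "F \<in> faces G" for F
  proof -
    consider "F = outer G" | f where "f \<in> inner X" "F = set f" using F G_faces by blast
    then show ?thesis
    proof cases
      case 1
      note b = valid_boundaries[OF X(1)] and l = valid_last[OF X(1)]
      have d: "distinct (rbd X @ lbd X)" "set (rbd X @ lbd X) \<subseteq> pset X"
        using b(1,2) boundaries_disjoint by (auto simp: boundary_def)
      have e1: "face_sum \<phi> (butlast (rbd X)) = face_sum \<theta> (butlast (rbd X))"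
        "face_sum \<phi> (butlast (lbd X)) = face_sum \<theta> (butlast (lbd X))"
        using butlast_not_last by (auto intro!: face_sum_cong simp: \<phi>_def)
      \<comment> \<open>The two face sums cancel; the two merged angles contribute -2 each, which
        gives the required -4.\<close>
      have "face_sum \<phi> (rbd X @ lbd X) = face_sum \<theta> (opp M e # rbd X) + face_sum \<theta> (e # lbd X) - 4"
        using face_sum_butlast[OF l(5), of \<phi>] face_sum_butlast[OF l(6), of \<phi>]
          face_sum_butlast[OF l(5), of \<theta>] face_sum_butlast[OF l(6), of \<theta>] e1 b st
        by (simp add: \<phi>_def)
      also have "\<dots> = -4" using root_faces_opposite[OF th(1-3)] by simp
      finally show ?thesis using 1 G_face_sum[OF d(2,1), of \<phi>] G_outer by simp
    next
      case 2
      have f: "face_cycle f" "set f \<subseteq> pset X" using valid_inner(2)[OF X(1)] 2(1) by blast+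
      have "face_sum \<phi> f = face_sum \<theta> f"
        using inner_not_last[OF 2(1)] by (intro face_sum_cong) (simp add: \<phi>_def)
      also have "\<dots> = 4" using th(1) 2(1) by (simp add: local_rep_def)
      finally show ?thesis
        using G_face_sum[OF f(2), of \<phi>] f(1) inner_not_outer[OF 2(1)] 2(2) by (simp add: face_cycle_def)
    qed
  qed
  ultimately have "G.turning \<phi>" unfolding G.turning_def by blast
  then show ?thesis by (rule G.rep_of_turning)
qed

text \<open>\<open>room\<close> makes the turns at the split angles nonpositive, which is the
  premise of \<open>split_pole\<close> at owned poles. Unowned poles do not matter for a local
  representation.\<close>

lemma G_rectilinearD:
  assumes rep: "rectilinear_rep G ang" and room: "leaves_room_for G M e ang"
  shows "\<exists>\<theta>. local_rep X \<theta>"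
proof -
  define \<phi> where "\<phi> x = turn_of (ang (opp G x))" for x
  have tu: "G.turning \<phi>" using G.turning_of_rep[OF rep] unfolding \<phi>_def .
  have ro: "\<phi> x \<le> 0" if x: "x \<in> pset X" "rot M x \<in> {e, opp M e}" for x
  proof -
    have o: "opp M x \<in> darts G" using x validD(3)[OF X(1)] G_darts by blast
    then have "180 \<le> ang (opp M x)" using room[unfolded leaves_room_for_def, rule_format, of "opp M x"] x(2) by simp
    moreover have "ang (opp M x) \<in> {90, 180, 270, 360}"
      using rep o unfolding rectilinear_rep_def orthogonal_rep_def by blast
    ultimately show ?thesis using turn_of_values(5) G_arcs(3)[OF x(1)] by (simp add: \<phi>_def)
  qed
  \<comment> \<open>At each end the part before the dummy arc becomes a right angle and the dummy
    arc carries the remainder.\<close>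
  define \<theta> where "\<theta> x = (if x = e then \<phi> (last (fan_s X)) + 1 else if x = opp M e then \<phi> (last (fan_t X)) + 1
     else if x = last (fan_s X) \<or> x = last (fan_t X) then 1 else \<phi> x)" for x
  have vk: "G.vertex_ok \<phi> v" if "v \<in> own X \<union> {s, t}" for v
    using tu that unfolding G.turning_def G_vertices by blast
  have ls: "last (fan_s X) \<in> pset X" "last (fan_t X) \<in> pset X"
    using fan_last[OF fans(1)] fan_last[OF fans(2)] by auto
  have ne: "last (fan_s X) \<noteq> e" "last (fan_s X) \<noteq> opp M e" "last (fan_t X) \<noteq> e" "last (fan_t X) \<noteq> opp M e" "opp M e \<noteq> e"
    using pset_avoids[OF ls(1)] pset_avoids[OF ls(2)] opp_neq[OF e_dart] by auto
  have srcs: "x \<in> set (fan_s X) \<Longrightarrow> src M x = s \<and> x \<in> pset X" "x \<in> set (fan_t X) \<Longrightarrow> src M x = t \<and> x \<in> pset X" for x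
  proof -
    have "set (fan_s X) = out M s \<inter> pset X" "set (fan_t X) = out M t \<inter> pset X"
      using fans by (simp_all add: fan_def)
    then show "x \<in> set (fan_s X) \<Longrightarrow> src M x = s \<and> x \<in> pset X"
      "x \<in> set (fan_t X) \<Longrightarrow> src M x = t \<and> x \<in> pset X" for x
      using outD(2)[of x] by (metis IntE)+
  qed
  have lsrc: "src M (last (fan_s X)) = s" "src M (last (fan_t X)) = t"
    using fan_last[OF fans(1)] fan_last[OF fans(2)] by auto
  have "good \<theta> v" if v: "v \<in> own X" for v
  proof -
    consider "v = s" | "v = t" | "v \<noteq> s" "v \<noteq> t" by blast
    then show ?thesis
    proof cases
      case 1
      have k: "2 \<le> length (fan_s X)" using own_poles(1) v 1 degree_poles(3) by auto
      have ok: "(\<forall>x\<in>set (fan_s X). \<phi> x \<in> {-2, -1, 0, 1} \<and> (\<phi> x = -2 \<longrightarrow> length (fan_s X) = 1))"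
        "(\<Sum>x\<in>set (fan_s X). \<phi> x) = 2 * int (length (fan_s X)) - 4"
        using vk[of s] unfolding G.vertex_ok_def G_out_poles distinct_card[OF distinct_fans(1)] by auto
      have "good \<theta> s"
        using out_poles(1,2) distinct_fans(1) k ok
      proof (rule split_pole)
        show "\<phi> (last (fan_s X)) \<le> 0" using ro[OF ls(1)] rot_poles by simp
        show "\<theta> (last (fan_s X)) = 1" "\<theta> e = \<phi> (last (fan_s X)) + 1" using ne by (auto simp: \<theta>_def)
        fix x assume x: "x \<in> set (fan_s X)" "x \<noteq> last (fan_s X)"
        have "x \<noteq> e" "x \<noteq> opp M e" "x \<noteq> last (fan_t X)"
          using srcs(1)[OF x(1)] lsrc s_neq_t opp_e out_poles(2) x(1) by auto
        then show "\<theta> x = \<phi> x" using x by (simp add: \<theta>_def)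
      qed
      then show ?thesis using 1 by simp
    next
      case 2
      have k: "2 \<le> length (fan_t X)" using own_poles(2) v 2 degree_poles(4) by auto
      have ok: "(\<forall>x\<in>set (fan_t X). \<phi> x \<in> {-2, -1, 0, 1} \<and> (\<phi> x = -2 \<longrightarrow> length (fan_t X) = 1))"
        "(\<Sum>x\<in>set (fan_t X). \<phi> x) = 2 * int (length (fan_t X)) - 4"
        using vk[of t] unfolding G.vertex_ok_def G_out_poles distinct_card[OF distinct_fans(2)] by auto
      have "good \<theta> t"
        using out_poles(3,4) distinct_fans(2) k ok
      proof (rule split_pole)
        show "\<phi> (last (fan_t X)) \<le> 0" using ro[OF ls(2)] rot_poles by simp
        show "\<theta> (last (fan_t X)) = 1" "\<theta> (opp M e) = \<phi> (last (fan_t X)) + 1" using ne by (auto simp: \<theta>_def)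
        fix x assume x: "x \<in> set (fan_t X)" "x \<noteq> last (fan_t X)"
        have "x \<noteq> e" "x \<noteq> opp M e" "x \<noteq> last (fan_s X)"
          using srcs(2)[OF x(1)] lsrc s_neq_t opp_e out_poles(4) x(1) by auto
        then show "\<theta> x = \<phi> x" using x by (simp add: \<theta>_def)
      qed
      then show ?thesis using 2 by simp
    next
      case 3
      have "\<theta> x = \<phi> x" if "x \<in> out M v" for x
        using outD(2)[OF that] 3 lsrc opp_e by (auto simp: \<theta>_def)
      moreover have "2 \<le> card (out M v)" using node_degree[OF proper] v by (simp add: degree_ge_2_def)
      moreover have "vertex_ok \<phi> v"
        using vk[of v] v unfolding G.vertex_ok_def vertex_ok_def G_out_inner[OF 3] by simp
      ultimately show ?thesis using vertex_ok_imp_good[of \<phi> v] by (simp add: good_def)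
    qed
  qed
  moreover have "face_sum \<theta> f = 4" if f: "f \<in> inner X" for f
  proof -
    have c: "face_cycle f" "set f \<subseteq> pset X" using valid_inner(2)[OF X(1)] f by blast+
    have "face_sum \<theta> f = face_sum \<phi> f"
      using inner_not_last[OF f] by (intro face_sum_cong) (simp add: \<theta>_def)
    also have "\<dots> = 4"
      using tu f G_faces inner_not_outer[OF f] G_face_sum[OF c(2), of \<phi>] c(1)
      by (auto simp: G.turning_def face_cycle_def)
    finally show ?thesis .
  qed
  ultimately show ?thesis unfolding local_rep_def by blast
qed

text \<open>Existence of a local representation of the root piece has no constraint on its turn, so
  the conditions below the root are equivalent to it.\<close>

theorem dummy_iff_conditions:
  assumes "rectilinear_planar G \<Longrightarrow> \<exists>ang. rectilinear_rep G ang \<and> leaves_room_for G M e ang"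
  shows "rectilinear_planar G \<longleftrightarrow> (\<forall>\<nu>\<in>nodes (Root (QNode [e]) \<eta>). rep_condition M True \<nu>)"
proof -
  note N = node_intervals[OF proper, of True]
  have "rectilinear_planar G \<longleftrightarrow> (\<exists>\<theta>. local_rep X \<theta>)"
    using assms G_rectilinearI G_rectilinearD by blast
  also have "\<dots> \<longleftrightarrow> (\<exists>x. achieves X x)" unfolding achieves_def by blast
  also have "\<dots> \<longleftrightarrow> (\<forall>\<nu>\<in>nodes \<eta>. rep_condition M True \<nu>)"
    using N unfolding has_interval_def realizes_def by blast
  finally show ?thesis unfolding nodes_root by simp
qed

end

text \<open>The last hypothesis is the drawing-level form of the convention that a dummy edge can be
  added in the external face: some representation leaves at least 180 degrees at the places where
  the edge is inserted.\<close>

theorem theorem2: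
  fixes G B :: "('v, 'a) plane_map" and e :: 'a and T :: "'a spq"
  assumes "plane_graph G" and "four_graph G" and "series_parallel G"
    and "decomposed_graph G e B" and "spq_tree B e T"
    and "e \<notin> darts G \<Longrightarrow> rectilinear_planar G \<Longrightarrow>
      \<exists>ang. rectilinear_rep G ang \<and> leaves_room_for G B e ang"
  shows "rectilinear_planar G \<longleftrightarrow> (\<forall>\<nu>\<in>nodes T. rep_condition B (e \<notin> darts G) \<nu>)"
proof -
  obtain \<eta> where T: "T = Root (QNode [e]) \<eta>" and eta: "e \<in> darts B" "e \<in> outer B" "spq_node B \<eta>"
    "source B \<eta> = src B e" "sink B \<eta> = tgt B e" "{e, opp B e} \<inter> pert B \<eta> = {}"
    "{e, opp B e} \<union> pert B \<eta> = darts B"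
    using assms(5) unfolding spq_tree_def by blast
  have B: "plane_graph B" "four_graph B"
    using assms(1,2,4) by (auto simp: decomposed_graph_def adds_dummy_edge_def split: if_splits)
  interpret rotation_system B using rotation_system_plane B by blast
  have "connected (dgraph B)" using B(1) by (simp add: plane_graph_def)
  then interpret rooted_map B e \<eta>
    \<comment> \<open>Connectivity together with the arc \<open>e\<close> excludes isolated
      vertices.\<close>
    using eta connected_out_nonempty by unfold_locales auto
  show ?thesis
  proof (cases "biconnected G")
    case True
    then have "B = G" using assms(4) by (simp add: decomposed_graph_def)
    moreover have "outer B \<in> faces B" using B(1) by (simp add: plane_graph_def)
    ultimately show ?thesis using rectilinear_iff_conditions[OF eta(2)] eta(1) T by simp
  next
    case False
    then have d: "adds_dummy_edge G e B" using assms(4) by (simp add: decomposed_graph_def)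
    interpret dummy_edge_map B e \<eta> G
      by (intro dummy_edge_map.intro rooted_map_axioms dummy_edge_map_axioms.intro
          rotation_system_plane assms(1,2) d)
    have "e \<notin> darts G" using d by (auto simp: adds_dummy_edge_def)
    then show ?thesis using dummy_iff_conditions assms(6) T by simp
  qed
qed

end
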